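(* Take $\mathcal C=\mathbb R^{d_u}$ and assume $\inf_{y\in\mathcal C}F(y)>-\infty$. There exist constants $\overline\alpha>0$ and $0<\underline\beta\le\overline\beta$ such that for every $\alpha\in(0,\overline\alpha]$ there exist a constant $\lambda=\lambda(\eta,\alpha)\in(0,1)$, an integer $D^0=D^0(\eta,\alpha)$ and constants $c_1,c_2\ge 0$, not depending on $K$ and $D$, with the following property: for all integers $K\ge1$ and $D\ge D^0$ and every $\beta\in[\underline\beta,\overline\beta]$, the iterates $y^0,\dots,y^{K-1}$ produced by the algorithm described in the context with constant step sizes $\alpha_k=\alpha$, $\beta_k=\beta$ satisfy $$\frac1K\sum_{k=0}^{K-1}\|\nabla F(y^k)\|^2\le \frac{c_1}{K}+c_2\,\lambda^D .$$
   Context: Setting. $N\ge1$, $d_1,\dots,d_N\ge1$, $d_u\ge1$ are integers, $d=\sum_i d_i$, $d^{\max}=\max_i d_i$; $\mathcal H_i=\{h_i\in\mathbb R^{d_i}:h_i\ge0,\ \mathbf 1^\top h_i=1\}$, $\mathcal H=\mathcal H_1\times\dots\times\mathcal H_N\subset\mathbb R^d$; $\mathcal C\subseteq\mathbb R^{d_u}$ is a nonempty closed convex set; $\eta>0$. $f(h,y)$ and $g(h,y)$ are real functions of $h\in\mathcal H$, $y\in\mathcal C$ having the derivatives appearing below, and $g(\cdot,y)$ is convex for every $y$. Let $\overline\psi(h)=\sum_{i=1}^N\sum_{j=1}^{d_i}(h_{i,j}\ln h_{i,j}-h_{i,j})$ and $g^\eta(h,y)=g(h,y)+\eta\,\overline\psi(h)$.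 For each $y$ let $h^*(y)$ be the unique minimizer of $g^\eta(\cdot,y)$ over $\mathcal H$, $R_*(y)=\partial h^*(y)/\partial y\in\mathbb R^{d\times d_u}$ its Jacobian, $F(y)=f(h^*(y),y)$, and $\nabla F(y)=\nabla_yf(h^*(y),y)+R_*(y)^\top\nabla_hf(h^*(y),y)$. $\|\cdot\|$ is the Euclidean norm for vectors and the spectral norm for matrices. Assumptions (positive constants, uniform in all variables; $h,h'\in\mathcal H$, $y,y'\in\mathcal C$). With $z=(h,y)$: $\nabla_zf$ is $L_f$-Lipschitz on $\mathcal H\times\mathcal C$ and $\|\nabla_zf\|\le\Omega_f$. For each $y$: $\nabla_hg(\cdot,y)$ is $L_g$-Lipschitz, $\|\nabla_hg(h,y)\|\le\Omega_g$, $\nabla_y\nabla_hg(\cdot,y)$ is $\tau_g^h$-Lipschitz and $\nabla_h^2g(\cdot,y)$ is $\rho_g^h$-Lipschitz in $h$, $\|\nabla_h^2g(h,y)\|\le L_g$, $\|\nabla_y\nabla_hg(h,y)\|\le\Lambda_g$. For each $h$: $\nabla_y\nabla_hg(h,\cdot)$ is $\tau_g^y$-Lipschitz and $\nabla_h^2g(h,\cdot)$ is $\rho_g^y$-Lipschitz in $y$. Let $\nu^{\min}=e^{-2\Omega_g/\eta}/d^{\max}$ and $\widetilde{\mathcal H}=\{h\in\mathcal H:h_{i,j}\ge\nu^{\min}\ \forall i,j\}$. Algorithm. Inputs: integers $K,D\ge1$, step sizes $\alpha_k,\beta_k>0$, $y^0\in\mathcal C$, $h^0\in\widetilde{\mathcal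 H}$. For $k=0,\dots,K-1$: set $h^{0,0}=h^0$ and $h^{k,0}=h^{k-1,D}$ if $k>0$; set $R_{k,0}=0\in\mathbb R^{d\times d_u}$. For $t=0,\dots,D-1$ put $$h_i^{k,t+1}=\frac{h_i^{k,t}\circ\exp(-\alpha_k\nabla_{h_i}g^\eta(h^{k,t},y^k))}{(h_i^{k,t})^\top\exp(-\alpha_k\nabla_{h_i}g^\eta(h^{k,t},y^k))}\quad(i=1,\dots,N),$$ ($\circ$, $\exp$, and $1/h$ below are componentwise), and let $R_{k,t+1}$ be obtained by differentiating this update with respect to $y^k$ ($R_{k,t}$ standing for $\partial h^{k,t}/\partial y^k$), i.e. $R_{k,t+1}=M_{k,t}R_{k,t}+U_{k,t}$, where $B_{k,t}=\mathrm{blkdiag}_i(\mathrm{diag}(h_i^{k,t+1})-h_i^{k,t+1}(h_i^{k,t+1})^\top)$, $M_{k,t}=B_{k,t}[(1-\eta\alpha_k)\mathrm{diag}(1/h^{k,t})-\alpha_k\nabla_h^2g(h^{k,t},y^k)]$, $U_{k,t}=-\alpha_kB_{k,t}\nabla_y\nabla_hg(h^{k,t},y^k)$. Then set $\widehat\nabla F(y^k)=\nabla_yf(h^{k,D},y^k)+R_{k,D}^\top\nabla_hf(h^{k,D},y^k)$ and $y^{k+1}=\mathrm{Proj}_{\mathcal C}(y^k-\beta_k\widehat\nabla F(y^k))$. *)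

theory Defs
  imports "HOL-Analysis.Analysis"
begin

text \<open>
  A point of the product of simplices is a vector \<open>h :: real^'n\<close>; a map \<open>blk :: 'n \<Rightarrow> 'p\<close> assigns
  to each scalar coordinate the index of the simplex it belongs to. Thus \<open>N = CARD('p)\<close>,
  \<open>d = CARD('n)\<close>, \<open>d\<^sub>i = block_dim blk i\<close>, and \<open>d\<^sub>i \<ge> 1\<close> for all \<open>i\<close> means \<open>surj blk\<close>.

  The product of simplices has empty interior, so gradients in \<open>h\<close> are not determined by the
  function on it. Gradients and second derivatives are therefore passed as explicit functions:
  \<open>gh\<close>, \<open>ghh\<close>, \<open>ghy\<close> stand for the gradient of \<open>g\<close> in \<open>h\<close>, its Hessian in \<open>h\<close> and the Jacobian
  of \<open>gh\<close> in \<open>y\<close>; \<open>fh\<close>, \<open>fy\<close> stand for the partial gradients of \<open>f\<close>.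
\<close>

definition block_dim :: "('n::finite \<Rightarrow> 'p::finite) \<Rightarrow> 'p \<Rightarrow> nat" where
  "block_dim blk i = card {j. blk j = i}"

definition max_block_dim :: "('n::finite \<Rightarrow> 'p::finite) \<Rightarrow> nat" where
  "max_block_dim blk = Max (range (block_dim blk))"

definition simplex_prod :: "('n::finite \<Rightarrow> 'p::finite) \<Rightarrow> (real^'n) set" where
  "simplex_prod blk = {h. (\<forall>j. 0 \<le> h $ j) \<and> (\<forall>i. (\<Sum>j | blk j = i. h $ j) = 1)}"

definition nu_min :: "('n::finite \<Rightarrow> 'p::finite) \<Rightarrow> real \<Rightarrow> real \<Rightarrow> real" where
  "nu_min blk \<eta> \<Omega>g = exp (- 2 * \<Omega>g / \<eta>) / real (max_block_dim blk)"

definition trunc_simplex_prod :: "('n::finite \<Rightarrow> 'p::finite) \<Rightarrow> real \<Rightarrow> real \<Rightarrow> (real^'n) set" where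
  "trunc_simplex_prod blk \<eta> \<Omega>g = {h \<in> simplex_prod blk. \<forall>j. nu_min blk \<eta> \<Omega>g \<le> h $ j}"

text \<open>The library norm on matrices is the Frobenius norm.\<close>

definition spectral_norm :: "real^'m^'n \<Rightarrow> real" where
  "spectral_norm A = onorm (\<lambda>v. A *v v)"

text \<open>Since \<open>ln 0 = 0\<close> in HOL, boundary points obey the convention \<open>0 * ln 0 = 0\<close>.\<close>

definition entropy :: "real^'n \<Rightarrow> real" where
  "entropy h = (\<Sum>j\<in>UNIV. h $ j * ln (h $ j) - h $ j)"

definition g_reg :: "(real^'n \<Rightarrow> real^'u \<Rightarrow> real) \<Rightarrow> real \<Rightarrow> real^'n \<Rightarrow> real^'u \<Rightarrow> real" where
  "g_reg g \<eta> h y = g h y + \<eta> * entropy h"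

text \<open>The derivative of \<open>x * ln x - x\<close> is \<open>ln x\<close>; only used at points with positive coordinates.\<close>

definition g_reg_grad ::
  "(real^'n \<Rightarrow> real^'u \<Rightarrow> real^'n) \<Rightarrow> real \<Rightarrow> real^'n \<Rightarrow> real^'u \<Rightarrow> real^'n" where
  "g_reg_grad gh \<eta> h y = gh h y + \<eta> *\<^sub>R (\<chi> j. ln (h $ j))"

definition h_star ::
  "('n::finite \<Rightarrow> 'p::finite) \<Rightarrow> (real^'n \<Rightarrow> real^'u \<Rightarrow> real) \<Rightarrow> real \<Rightarrow> real^'u \<Rightarrow> real^'n" where
  "h_star blk g \<eta> y =
     (THE h. is_arg_min (\<lambda>h. g_reg g \<eta> h y) (\<lambda>h. h \<in> simplex_prod blk) h)"

definition R_star ::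
  "('n::finite \<Rightarrow> 'p::finite) \<Rightarrow> (real^'u) set \<Rightarrow> (real^'n \<Rightarrow> real^'u \<Rightarrow> real) \<Rightarrow> real \<Rightarrow> real^'u
    \<Rightarrow> real^'u^'n" where
  "R_star blk C g \<eta> y = jacobian (h_star blk g \<eta>) (at y within C)"

definition F_obj ::
  "('n::finite \<Rightarrow> 'p::finite) \<Rightarrow> (real^'n \<Rightarrow> real^'u \<Rightarrow> real) \<Rightarrow> (real^'n \<Rightarrow> real^'u \<Rightarrow> real) \<Rightarrow> real
    \<Rightarrow> real^'u \<Rightarrow> real" where
  "F_obj blk f g \<eta> y = f (h_star blk g \<eta> y) y"

definition F_grad ::
  "('n::finite \<Rightarrow> 'p::finite) \<Rightarrow> (real^'u) set \<Rightarrow> (real^'n \<Rightarrow> real^'u \<Rightarrow> real^'n)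
    \<Rightarrow> (real^'n \<Rightarrow> real^'u \<Rightarrow> real^'u) \<Rightarrow> (real^'n \<Rightarrow> real^'u \<Rightarrow> real) \<Rightarrow> real
    \<Rightarrow> real^'u \<Rightarrow> real^'u" where
  "F_grad blk C fh fy g \<eta> y =
     fy (h_star blk g \<eta> y) y
       + transpose (R_star blk C g \<eta> y) *v fh (h_star blk g \<eta> y) y"

definition md_step ::
  "('n::finite \<Rightarrow> 'p::finite) \<Rightarrow> (real^'n \<Rightarrow> real^'u \<Rightarrow> real^'n) \<Rightarrow> real \<Rightarrow> real \<Rightarrow> real^'u
    \<Rightarrow> real^'n \<Rightarrow> real^'n" where
  "md_step blk gh \<eta> \<alpha> y h =
     (\<chi> j. h $ j * exp (- \<alpha> * g_reg_grad gh \<eta> h y $ j)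
           / (\<Sum>l | blk l = blk j. h $ l * exp (- \<alpha> * g_reg_grad gh \<eta> h y $ l)))"

primrec md_iter ::
  "('n::finite \<Rightarrow> 'p::finite) \<Rightarrow> (real^'n \<Rightarrow> real^'u \<Rightarrow> real^'n) \<Rightarrow> real \<Rightarrow> real \<Rightarrow> real^'u
    \<Rightarrow> real^'n \<Rightarrow> nat \<Rightarrow> real^'n" where
  "md_iter blk gh \<eta> \<alpha> y h 0 = h"
| "md_iter blk gh \<eta> \<alpha> y h (Suc t) = md_step blk gh \<eta> \<alpha> y (md_iter blk gh \<eta> \<alpha> y h t)"

definition diag_mat :: "real^'n \<Rightarrow> real^'n^'n" where
  "diag_mat v = (\<chi> j l. if j = l then v $ j else 0)"

text \<open>The block-diagonal matrix with blocks \<open>diag h\<^sub>i - h\<^sub>i h\<^sub>i\<^sup>T\<close>.\<close>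

definition B_mat :: "('n::finite \<Rightarrow> 'p::finite) \<Rightarrow> real^'n \<Rightarrow> real^'n^'n" where
  "B_mat blk h = (\<chi> j l. if blk j = blk l then diag_mat h $ j $ l - h $ j * h $ l else 0)"

text \<open>In \<open>M_mat\<close> and \<open>U_mat\<close>, \<open>h\<close> is the current inner iterate and \<open>h'\<close> the next one.\<close>

definition M_mat ::
  "('n::finite \<Rightarrow> 'p::finite) \<Rightarrow> (real^'n \<Rightarrow> real^'u \<Rightarrow> real^'n^'n) \<Rightarrow> real \<Rightarrow> real \<Rightarrow> real^'u
    \<Rightarrow> real^'n \<Rightarrow> real^'n \<Rightarrow> real^'n^'n" where
  "M_mat blk ghh \<eta> \<alpha> y h h' =
     B_mat blk h' ** ((1 - \<eta> * \<alpha>) *\<^sub>R diag_mat (\<chi> j. 1 / h $ j) - \<alpha> *\<^sub>R ghh h y)"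

definition U_mat ::
  "('n::finite \<Rightarrow> 'p::finite) \<Rightarrow> (real^'n \<Rightarrow> real^'u \<Rightarrow> real^'u^'n) \<Rightarrow> real \<Rightarrow> real^'u
    \<Rightarrow> real^'n \<Rightarrow> real^'n \<Rightarrow> real^'u^'n" where
  "U_mat blk ghy \<alpha> y h h' = (- \<alpha>) *\<^sub>R (B_mat blk h' ** ghy h y)"

primrec R_iter ::
  "('n::finite \<Rightarrow> 'p::finite) \<Rightarrow> (real^'n \<Rightarrow> real^'u \<Rightarrow> real^'n)
    \<Rightarrow> (real^'n \<Rightarrow> real^'u \<Rightarrow> real^'n^'n) \<Rightarrow> (real^'n \<Rightarrow> real^'u \<Rightarrow> real^'u^'n)
    \<Rightarrow> real \<Rightarrow> real \<Rightarrow> real^'u \<Rightarrow> real^'n \<Rightarrow> nat \<Rightarrow> real^'u^'n" where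
  "R_iter blk gh ghh ghy \<eta> \<alpha> y h 0 = 0"
| "R_iter blk gh ghh ghy \<eta> \<alpha> y h (Suc t) =
     M_mat blk ghh \<eta> \<alpha> y (md_iter blk gh \<eta> \<alpha> y h t) (md_iter blk gh \<eta> \<alpha> y h (Suc t))
        ** R_iter blk gh ghh ghy \<eta> \<alpha> y h t
     + U_mat blk ghy \<alpha> y (md_iter blk gh \<eta> \<alpha> y h t) (md_iter blk gh \<eta> \<alpha> y h (Suc t))"

definition F_grad_est ::
  "('n::finite \<Rightarrow> 'p::finite) \<Rightarrow> (real^'n \<Rightarrow> real^'u \<Rightarrow> real^'n)
    \<Rightarrow> (real^'n \<Rightarrow> real^'u \<Rightarrow> real^'u) \<Rightarrow> (real^'n \<Rightarrow> real^'u \<Rightarrow> real^'n)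
    \<Rightarrow> (real^'n \<Rightarrow> real^'u \<Rightarrow> real^'n^'n) \<Rightarrow> (real^'n \<Rightarrow> real^'u \<Rightarrow> real^'u^'n)
    \<Rightarrow> real \<Rightarrow> real \<Rightarrow> nat \<Rightarrow> real^'n \<Rightarrow> real^'u \<Rightarrow> real^'u" where
  "F_grad_est blk fh fy gh ghh ghy \<eta> \<alpha> D h y =
     fy (md_iter blk gh \<eta> \<alpha> y h D) y
       + transpose (R_iter blk gh ghh ghy \<eta> \<alpha> y h D) *v fh (md_iter blk gh \<eta> \<alpha> y h D) y"

text \<open>The state \<open>(h\<^sup>k\<^sup>,\<^sup>0, y\<^sup>k)\<close> of the algorithm at the start of outer iteration \<open>k\<close>.\<close>

primrec alg_state ::
  "('n::finite \<Rightarrow> 'p::finite) \<Rightarrow> (real^'u) set \<Rightarrow> (real^'n \<Rightarrow> real^'u \<Rightarrow> real^'n)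
    \<Rightarrow> (real^'n \<Rightarrow> real^'u \<Rightarrow> real^'u) \<Rightarrow> (real^'n \<Rightarrow> real^'u \<Rightarrow> real^'n)
    \<Rightarrow> (real^'n \<Rightarrow> real^'u \<Rightarrow> real^'n^'n) \<Rightarrow> (real^'n \<Rightarrow> real^'u \<Rightarrow> real^'u^'n)
    \<Rightarrow> real \<Rightarrow> (nat \<Rightarrow> real) \<Rightarrow> (nat \<Rightarrow> real) \<Rightarrow> nat \<Rightarrow> real^'n \<Rightarrow> real^'u
    \<Rightarrow> nat \<Rightarrow> (real^'n) \<times> (real^'u)" where
  "alg_state blk C fh fy gh ghh ghy \<eta> \<alpha> \<beta> D h0 y0 0 = (h0, y0)"
| "alg_state blk C fh fy gh ghh ghy \<eta> \<alpha> \<beta> D h0 y0 (Suc k) =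
     (let (h, y) = alg_state blk C fh fy gh ghh ghy \<eta> \<alpha> \<beta> D h0 y0 k
      in (md_iter blk gh \<eta> (\<alpha> k) y h D,
          closest_point C (y - \<beta> k *\<^sub>R F_grad_est blk fh fy gh ghh ghy \<eta> (\<alpha> k) D h y)))"

definition y_iter ::
  "('n::finite \<Rightarrow> 'p::finite) \<Rightarrow> (real^'u) set \<Rightarrow> (real^'n \<Rightarrow> real^'u \<Rightarrow> real^'n)
    \<Rightarrow> (real^'n \<Rightarrow> real^'u \<Rightarrow> real^'u) \<Rightarrow> (real^'n \<Rightarrow> real^'u \<Rightarrow> real^'n)
    \<Rightarrow> (real^'n \<Rightarrow> real^'u \<Rightarrow> real^'n^'n) \<Rightarrow> (real^'n \<Rightarrow> real^'u \<Rightarrow> real^'u^'n)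
    \<Rightarrow> real \<Rightarrow> (nat \<Rightarrow> real) \<Rightarrow> (nat \<Rightarrow> real) \<Rightarrow> nat \<Rightarrow> real^'n \<Rightarrow> real^'u
    \<Rightarrow> nat \<Rightarrow> real^'u" where
  "y_iter blk C fh fy gh ghh ghy \<eta> \<alpha> \<beta> D h0 y0 k =
     snd (alg_state blk C fh fy gh ghh ghy \<eta> \<alpha> \<beta> D h0 y0 k)"

end

theory Submission
  imports Defs
begin

text \<open>
  The outer iteration is gradient descent on \<open>F y = f (h\<^sup>* y) y\<close> with an inexact gradient, where
  \<open>h\<^sup>*\<close> is the solution map of the regularized lower-level problem. Once \<open>F\<close> has an
  \<open>L\<close>-Lipschitz gradient, step sizes \<open>\<beta>\<close> below a multiple of \<open>1 / L\<close> give
  \<open>\<parallel>\<nabla>F y\<parallel>\<^sup>2 \<le> 2 / \<beta> * (F y - F y\<^sup>+) + \<parallel>e\<parallel>\<^sup>2\<close>, where \<open>e\<close> is the error of the gradient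
  estimate; summation telescopes. It remains to show that \<open>F\<close> is smooth and that \<open>\<parallel>e\<parallel> \<le> C p\<^sup>D\<close>
  with constants uniform in \<open>y\<close> and in the starting point of the inner loop.

  \<^bold>\<open>The solution map.\<close> A stationary point is a blockwise softmax of \<open>- \<nabla>\<^sub>h g / \<eta>\<close>, so it exists by
  Brouwer's theorem, and convexity makes it the unique minimizer. The ratios of its entries within
  a block are bounded by a constant \<open>Q\<close>; the points with this property form a region that is
  invariant under the inner iteration and on which all entries are at least some \<open>\<delta> > 0\<close>. The
  linearized stationarity condition, tested with a tangent vector \<open>u\<close>, is coercive, since the
  Hessian of the entropy contributes \<open>\<eta> * \<parallel>u\<parallel>\<^sup>2\<close> and that of \<open>g\<close> is nonnegative on tangent vectors
  (\<open>linearized_system_bound\<close>). This estimate bounds the Jacobian \<open>R\<^sup>*\<close>, shows that it is the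
  derivative of \<open>h\<^sup>*\<close>, and makes it Lipschitz, so that \<open>\<nabla>F\<close> is Lipschitz.

  \<^bold>\<open>The inner iteration.\<close> The divergence \<open>KL(h\<^sup>* \<parallel> h)\<close> contracts by the factor \<open>1 - \<alpha> \<eta> / 2\<close> in each
  step (\<open>kl_md_step_le\<close>), and it dominates the squared Euclidean distance. Since it is bounded on
  the invariant region, the inner iterates converge to \<open>h\<^sup>* y\<close> linearly and uniformly, whatever
  point of this region the loop is started from.

  \<^bold>\<open>The differentiated iteration.\<close> At \<open>h\<^sup>* y\<close> the differentiated update is an affine map with fixed
  point \<open>R\<^sup>*\<close>, and on tangent vectors its linear part \<open>v \<mapsto> (1 - \<eta> \<alpha>) v - \<alpha> B G v\<close> contracts the norm
  \<open>v \<mapsto> (\<Sum>\<^sub>j v\<^sub>j\<^sup>2 / h\<^sup>*\<^sub>j)\<^sup>1\<^sup>/\<^sup>2\<close> (\<open>jac_step_contraction\<close>). The actual updates differ from this map by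
  a geometrically small perturbation, which preserves linear convergence
  (\<open>perturbed_contraction_geometric\<close>, \<open>inner_loop_convergence\<close>).
\<close>

section \<open>Scalar inequalities and a perturbed linear recursion\<close>

text \<open>The summand of the Kullback-Leibler divergence dominates a square. Writing
  \<open>ln (b / a) = 2 * ln (sqrt (b / a)) \<le> 2 * (sqrt (b / a) - 1)\<close> bounds it below by
  \<open>(sqrt a - sqrt b)\<^sup>2\<close>. The value \<open>a = 0\<close> is included.\<close>

lemma kl_summand_ge_square:
  fixes a b :: real
  assumes "0 \<le> a" "a \<le> 1" "0 < b" "b \<le> 1"
  shows "(a - b)\<^sup>2 / 4 \<le> a * (ln a - ln b) - a + b"
proof (cases "a = 0")
  case True
  have "b * b \<le> b * 1" using assms by (intro mult_left_mono) auto
  then show ?thesis using True assms by (simp add: power2_eq_square)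
next
  case False
  then have a: "a > 0" using assms by simp
  define s t where "s = sqrt a" and "t = sqrt b"
  have st: "s > 0" "t > 0" "s \<le> 1" "t \<le> 1" "a = s\<^sup>2" "b = t\<^sup>2"
    using a assms by (auto simp: s_def t_def)
  have "ln (t / s) \<le> t / s - 1" using st by (intro ln_le_minus_one) auto
  then have "ln t - ln s \<le> t / s - 1" using st by (simp add: ln_div)
  then have "2 * s\<^sup>2 * (ln t - ln s) \<le> 2 * s\<^sup>2 * (t / s - 1)" 
    by (intro mult_left_mono) auto
  also have "\<dots> = 2 * s * t - 2 * s\<^sup>2" using st by (simp add: field_simps power2_eq_square)
  finally have 1: "(s - t)\<^sup>2 \<le> a * (ln a - ln b) - a + b"
    unfolding st(5,6) using st(1,2) 
    by (simp add: ln_realpow) (simp add: power2_eq_square algebra_simps)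
  have "(a - b)\<^sup>2 = (s - t)\<^sup>2 * (s + t)\<^sup>2" 
    unfolding st(5,6) by (simp add: power2_eq_square algebra_simps)
  also have "(s + t)\<^sup>2 \<le> 2\<^sup>2" using st by (intro power_mono) auto
  then have "(s - t)\<^sup>2 * (s + t)\<^sup>2 \<le> (s - t)\<^sup>2 * 4" by (intro mult_left_mono) auto
  finally show ?thesis using 1 by simp
qed

lemma ln_strongly_monotone:
  fixes a b :: real
  assumes "0 < a" "a \<le> 1" "0 < b" "b \<le> 1"
  shows "(a - b)\<^sup>2 \<le> (ln a - ln b) * (a - b)"
proof -
  have *: "x - y \<le> ln x - ln y" if "0 < y" "y \<le> x" "x \<le> 1" for x y :: real
  proof -
    have "ln (y / x) \<le> y / x - 1" using that by (intro ln_le_minus_one) auto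
    then have 1: "1 - y / x \<le> ln x - ln y" using that by (simp add: ln_div)
    have "(x - y) * x \<le> (x - y) * 1" using that by (intro mult_left_mono) auto
    moreover have "x > 0" using that by linarith
    ultimately have "x - y \<le> (x - y) / x"
      using pos_le_divide_eq[of x "x - y" "x - y"] by (metis mult_1_right)
    with 1 show ?thesis using that by (simp add: diff_divide_distrib)
  qed
  show ?thesis
  proof (cases "b \<le> a")
    case True
    then show ?thesis unfolding power2_eq_square using * assms by (intro mult_right_mono) auto
  next
    case False
    then have "(b - a) * (b - a) \<le> (ln b - ln a) * (b - a)"
      using * assms by (intro mult_right_mono) auto
    then show ?thesis by (simp add: power2_eq_square algebra_simps)
  qed
qed

lemma ln_Lipschitz:
  fixes a b :: real
  assumes "0 < \<delta>" "\<delta> \<le> a" "\<delta> \<le> b"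
  shows "\<bar>ln a - ln b\<bar> \<le> \<bar>a - b\<bar> / \<delta>"
proof -
  have *: "ln x - ln y \<le> \<bar>x - y\<bar> / \<delta>" if "\<delta> \<le> x" "\<delta> \<le> y" for x y
  proof -
    have "ln (x / y) \<le> x / y - 1" using that assms by (intro ln_le_minus_one) auto
    then have "ln x - ln y \<le> (x - y) / y" using that assms by (simp add: ln_div diff_divide_distrib)
    also have "\<dots> \<le> \<bar>x - y\<bar> / y" using that assms by (intro divide_right_mono) auto
    also have "\<dots> \<le> \<bar>x - y\<bar> / \<delta>" using that assms by (intro divide_left_mono) auto
    finally show ?thesis .
  qed
  show ?thesis using *[of a b] *[of b a] assms by (simp add: abs_if split: if_splits)
qed

lemma ln_second_order:
  fixes a b :: real
  assumes "0 < \<delta>" "\<delta> \<le> a" "\<delta> \<le> b"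
  shows "\<bar>ln b - ln a - (b - a) / a\<bar> \<le> (b - a)\<^sup>2 / \<delta>\<^sup>2"
proof -
  have "ln (b / a) \<le> b / a - 1" "ln (a / b) \<le> a / b - 1"
    using assms by (auto intro!: ln_le_minus_one)
  then have 1: "ln b - ln a \<le> (b - a) / a" and 2: "(b - a) / b \<le> ln b - ln a"
    using assms by (auto simp: ln_div diff_divide_distrib)
  have "(b - a) / a - (b - a) / b = (b - a)\<^sup>2 / (a * b)"
    using assms by (simp add: field_simps power2_eq_square)
  also have "\<dots> \<le> (b - a)\<^sup>2 / (\<delta> * \<delta>)"
    using assms by (intro divide_left_mono mult_mono) auto
  finally show ?thesis using 1 2 by (simp add: power2_eq_square)
qed

lemma exp_le_quadratic:
  fixes x :: real
  assumes "x \<le> 1/2"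
  shows "exp x \<le> 1 + x + 2 * x\<^sup>2"
proof -
  have "1 - x \<le> exp (- x)" using exp_ge_add_one_self[of "-x"] by simp
  then have 1: "exp x * (1 - x) \<le> 1" 
    using mult_left_mono[of "1 - x" "exp (-x)" "exp x"] by (simp add: exp_minus_inverse)
  have "0 \<le> x\<^sup>2 * (1 - 2 * x)" using assms by (intro mult_nonneg_nonneg) auto
  then have "1 \<le> (1 + x + 2 * x\<^sup>2) * (1 - x)"
    by (simp add: algebra_simps power2_eq_square)
  with 1 have "exp x * (1 - x) \<le> (1 + x + 2 * x\<^sup>2) * (1 - x)" by linarith
  then show ?thesis using assms by simp
qed

text \<open>A contraction of factor \<open>q\<close>, perturbed by a geometrically decaying multiple of the affine
  term \<open>a t + 1\<close>, still decays geometrically, with constants uniform over all such sequences.\<close>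

lemma perturbed_contraction_geometric:
  fixes q c A :: real
  assumes q: "0 < q" "q < 1" and c: "0 \<le> c" and A: "0 \<le> A"
  obtains C where "0 \<le> C"
    "\<And>a t. \<lbrakk>a 0 \<le> A; \<And>t. 0 \<le> a t; \<And>t. a (Suc t) \<le> q * a t + c * q ^ t * (a t + 1)\<rbrakk>
        \<Longrightarrow> a t \<le> C * ((1 + q) / 2) ^ t"
proof -
  define p where "p = (1 + q) / 2"
  \<comment> \<open>From some time on the multiplicative factor is at most \<open>m\<close>; the gap between \<open>m\<close> and \<open>p\<close> absorbs
    the additive term.\<close>
  define m where "m = (q + p) / 2"
  have p: "q < m" "m < p" "p < 1" "0 < p" using q by (auto simp: p_def m_def)
  have "(\<lambda>t. c * q ^ t) \<longlonglongrightarrow> c * 0"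
    using q by (intro tendsto_intros LIMSEQ_power_zero) auto
  then have "eventually (\<lambda>t. c * q ^ t < m - q) sequentially"
    using p by (intro order_tendstoD) auto
  then obtain T where T: "\<And>t. t \<ge> T \<Longrightarrow> c * q ^ t < m - q"
    unfolding eventually_sequentially by blast
  define C where "C = max (c / (p - m)) ((A + 1) * (1 + c) ^ T / p ^ T)"
  have C0: "0 \<le> C" unfolding C_def using p c by (simp add: le_max_iff_disj)
  moreover have "a t \<le> C * p ^ t"
    if a: "a 0 \<le> A" "\<And>t. 0 \<le> a t" "\<And>t. a (Suc t) \<le> q * a t + c * q ^ t * (a t + 1)"
    for a :: "nat \<Rightarrow> real" and t
  proof -
    \<comment> \<open>Each step multiplies \<open>a t + 1\<close> by at most \<open>1 + c\<close>; this is used up to the threshold \<open>T\<close>.\<close>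
    have early: "a t + 1 \<le> (A + 1) * (1 + c) ^ t" for t
    proof (induction t)
      case 0
      then show ?case using a by simp
    next
      case (Suc t)
      have "c * q ^ t * (a t + 1) \<le> c * 1 * (a t + 1)"
        using q c a(2)[of t] by (intro mult_right_mono mult_left_mono power_le_one) auto
      moreover have "q * a t \<le> 1 * a t" using q a(2)[of t] by (intro mult_right_mono) auto
      ultimately have "a (Suc t) + 1 \<le> (1 + c) * (a t + 1)"
        using a(3)[of t] by (simp add: algebra_simps)
      also have "\<dots> \<le> (1 + c) * ((A + 1) * (1 + c) ^ t)"
        using Suc c by (intro mult_left_mono) auto
      finally show ?case by (simp add: algebra_simps)
    qed
    show ?thesis
    proof (cases "t \<le> T")
      case True
      have "a t \<le> (A + 1) * (1 + c) ^ t" using early[of t] by simp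
      also have "\<dots> \<le> (A + 1) * (1 + c) ^ T"
        using A c True by (intro mult_left_mono power_increasing) auto
      also have "\<dots> = (A + 1) * (1 + c) ^ T / p ^ T * p ^ T" using p by simp
      also have "\<dots> \<le> C * p ^ T" unfolding C_def using p by (intro mult_right_mono) auto
      also have "\<dots> \<le> C * p ^ t" using C0 p True by (intro mult_left_mono power_decreasing) auto
      finally show ?thesis .
    next
      case False
      then have "T \<le> t" by simp
      then show ?thesis
      proof (induction t rule: dec_induct)
        case base
        have "a T \<le> (A + 1) * (1 + c) ^ T" using early[of T] by simp
        also have "\<dots> = (A + 1) * (1 + c) ^ T / p ^ T * p ^ T" using p by simp
        also have "\<dots> \<le> C * p ^ T" unfolding C_def using p by (intro mult_right_mono) auto
        finally show ?case .
      next
        case (step t)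
        have "a (Suc t) \<le> (q + c * q ^ t) * a t + c * q ^ t"
          using a(3)[of t] by (simp add: algebra_simps)
        also have "(q + c * q ^ t) * a t \<le> m * (C * p ^ t)"
          using T[of t] step a(2)[of t] q c p by (intro mult_mono) auto
        also have "c * q ^ t \<le> c * p ^ t" using c q p by (intro mult_left_mono power_mono) auto
        also have "c = (p - m) * (c / (p - m))" using p by simp
        also have "(p - m) * (c / (p - m)) * p ^ t \<le> (p - m) * C * p ^ t"
          using p by (intro mult_right_mono mult_left_mono) (auto simp: C_def)
        finally show ?case by (simp add: algebra_simps)
      qed
    qed
  qed
  ultimately show ?thesis using that unfolding p_def by blast
qed

section \<open>Norms of vectors and matrices\<close>

lemma norm_mult_spectral_norm:
  fixes A :: "real^'m^'n"
  shows "norm (A *v v) \<le> spectral_norm A * norm v"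
  unfolding spectral_norm_def by (intro onorm matrix_vector_mul_bounded_linear)

lemma norm_mult_spectral_norm_le:
  fixes A :: "real^'m^'n"
  assumes "spectral_norm A \<le> c"
  shows "norm (A *v v) \<le> c * norm v"
  using norm_mult_spectral_norm[of A v] mult_right_mono[OF assms norm_ge_zero, of v] by linarith

lemma norm_diff_mult_le:
  fixes A B :: "real^'m^'n"
  assumes "spectral_norm (A - B) \<le> c"
  shows "norm (A *v v - B *v v) \<le> c * norm v"
  using norm_mult_spectral_norm_le[OF assms, of v] by (simp add: matrix_vector_mult_diff_rdistrib)

lemma norm_transpose_mult_le:
  fixes A :: "real^'m^'n"
  assumes "\<And>w. norm (A *v w) \<le> c * norm w"
  shows "norm (transpose A *v u) \<le> c * norm u"
proof -
  let ?z = "transpose A *v u"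
  have "norm ?z * norm ?z = ?z \<bullet> ?z" by (simp add: dot_square_norm power2_eq_square)
  also have "\<dots> = u \<bullet> (A *v ?z)" by (simp add: dot_lmul_matrix inner_commute)
  also have "\<dots> \<le> norm u * norm (A *v ?z)" by (rule norm_cauchy_schwarz)
  also have "\<dots> \<le> norm u * (c * norm ?z)" by (intro mult_left_mono assms) auto
  finally have *: "norm ?z * norm ?z \<le> (c * norm u) * norm ?z" by (simp add: mult_ac)
  show ?thesis
  proof (cases "?z = 0")
    case True
    have "0 \<le> c * norm (axis undefined 1 :: real^'m)"
      using assms[of "axis undefined 1"] norm_ge_zero order_trans by blast
    then have "0 \<le> c" by simp
    then show ?thesis using True by simp
  next
    case False
    then show ?thesis using * by simp
  qed
qed

lemma norm_le_card_times:
  fixes v :: "real^'n"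
  assumes "\<And>j. \<bar>v $ j\<bar> \<le> c"
  shows "norm v \<le> real CARD('n) * c"
proof -
  have "norm v \<le> (\<Sum>j\<in>UNIV. \<bar>v $ j\<bar>)" by (rule norm_le_l1_cart)
  also have "\<dots> \<le> (\<Sum>j\<in>(UNIV::'n set). c)" by (intro sum_mono assms)
  finally show ?thesis by simp
qed

lemma norm_le_componentwise_mult:
  fixes u v :: "real^'n"
  assumes "\<And>j. \<bar>u $ j\<bar> \<le> c * \<bar>v $ j\<bar>" and "0 \<le> c"
  shows "norm u \<le> c * norm v"
proof -
  have "norm u \<le> norm (c *\<^sub>R v)"
    using assms by (intro norm_le_componentwise_cart) (auto simp: abs_mult)
  then show ?thesis using assms by simp
qed

text \<open>First-order Taylor formula with a quadratic remainder for a map whose derivative is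
  Lipschitz.\<close>

lemma linearization_quadratic_error:
  fixes \<phi> :: "'a::real_normed_vector \<Rightarrow> 'b::real_normed_vector"
  assumes S: "convex S" "a \<in> S" "b \<in> S"
    and d: "\<And>x. x \<in> S \<Longrightarrow> (\<phi> has_derivative \<phi>' x) (at x within S)"
    and lip: "\<And>x v. x \<in> S \<Longrightarrow> norm (\<phi>' x v - \<phi>' a v) \<le> L * norm (x - a) * norm v"
    and L: "0 \<le> L"
  shows "norm (\<phi> b - \<phi> a - \<phi>' a (b - a)) \<le> L * (norm (b - a))\<^sup>2"
proof -
  have sub: "closed_segment a b \<subseteq> S" using S by (simp add: closed_segment_subset)
  have "norm (\<phi> b - \<phi> a - \<phi>' a (b - a)) \<le> norm (b - a) * (L * norm (b - a))"
  proof (rule differentiable_bound_linearization[where S = "closed_segment a b"])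
    show "a + t *\<^sub>R (b - a) \<in> closed_segment a b" if "t \<in> {0..1}" for t
      using that by (auto simp: closed_segment_def algebra_simps intro!: exI[of _ t])
    show "(\<phi> has_derivative \<phi>' x) (at x within closed_segment a b)"
      if "x \<in> closed_segment a b" for x
      using d[of x] that sub has_derivative_subset by blast
    show "onorm (\<phi>' x - \<phi>' a) \<le> L * norm (b - a)" if x: "x \<in> closed_segment a b" for x
    proof (rule onorm_bound)
      fix v :: 'a
      have "norm (x - a) \<le> norm (b - a)" using segment_bound(1)[OF x] by simp
      then have "L * norm (x - a) * norm v \<le> L * norm (b - a) * norm v"
        using L by (intro mult_right_mono mult_left_mono) auto
      then show "norm ((\<phi>' x - \<phi>' a) v) \<le> L * norm (b - a) * norm v"
        using lip[of x v] x sub by (auto simp: fun_diff_def)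
    qed (use L in auto)
  qed auto
  then show ?thesis by (simp add: power2_eq_square mult_ac)
qed

lemma convex_on_above_tangent_within:
  fixes \<phi> :: "'a::real_normed_vector \<Rightarrow> real"
  assumes c: "convex_on S \<phi>" and ab: "a \<in> S" "b \<in> S"
    and d: "(\<phi> has_derivative \<phi>') (at a within S)"
  shows "\<phi> a + \<phi>' (b - a) \<le> \<phi> b"
proof -
  interpret D: bounded_linear \<phi>' using d by (rule has_derivative_bounded_linear)
  define \<gamma> where "\<gamma> t = a + t *\<^sub>R (b - a)" for t :: real
  have mem: "\<gamma> t \<in> S" if "t \<in> {0..1}" for t
    using convex_onD[OF c] c that ab unfolding \<gamma>_def convex_on_def
    by (auto simp: convex_alt algebra_simps)
  have "((\<lambda>t. \<phi> (\<gamma> t)) has_derivative (\<lambda>t. \<phi>' (t *\<^sub>R (b - a)))) (at 0 within {0..1})"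
  proof (rule has_derivative_in_compose[where f = \<gamma> and g = \<phi>])
    show "(\<gamma> has_derivative (\<lambda>t. t *\<^sub>R (b - a))) (at 0 within {0..1})"
      unfolding \<gamma>_def by (auto intro!: derivative_eq_intros)
    show "(\<phi> has_derivative \<phi>') (at (\<gamma> 0) within \<gamma> ` {0..1})"
    proof (rule has_derivative_subset)
      show "(\<phi> has_derivative \<phi>') (at (\<gamma> 0) within S)" using d by (simp add: \<gamma>_def)
    qed (use mem in auto)
  qed
  then have "((\<lambda>t. \<phi> (\<gamma> t)) has_real_derivative \<phi>' (b - a)) (at 0 within {0..1})"
    unfolding has_field_derivative_def by (rule has_derivative_eq_rhs) (auto simp: D.scaleR)
  then have lim: "((\<lambda>t. (\<phi> (\<gamma> t) - \<phi> (\<gamma> 0)) / (t - 0)) \<longlongrightarrow> \<phi>' (b - a)) (at 0 within {0..1})"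
    by (simp add: has_field_derivative_iff)
  have "\<phi>' (b - a) \<le> \<phi> b - \<phi> a"
  proof (rule tendsto_upperbound[OF lim])
    show "at (0::real) within {0..1} \<noteq> bot"
      by (simp add: at_within_Icc_at_right)
    show "\<forall>\<^sub>F t in at 0 within {0..1}. (\<phi> (\<gamma> t) - \<phi> (\<gamma> 0)) / (t - 0) \<le> \<phi> b - \<phi> a"
      unfolding eventually_at_filter
    proof (intro always_eventually allI impI)
      fix t :: real assume t: "t \<noteq> 0" "t \<in> {0..1}"
      have "\<phi> (\<gamma> t) = \<phi> ((1 - t) *\<^sub>R a + t *\<^sub>R b)" by (simp add: \<gamma>_def algebra_simps)
      also have "\<dots> \<le> (1 - t) * \<phi> a + t * \<phi> b"
        using convex_onD[OF c, of t a b] t ab by auto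
      finally have "\<phi> (\<gamma> t) - \<phi> (\<gamma> 0) \<le> t * (\<phi> b - \<phi> a)" by (simp add: \<gamma>_def algebra_simps)
      then show "(\<phi> (\<gamma> t) - \<phi> (\<gamma> 0)) / (t - 0) \<le> \<phi> b - \<phi> a"
        using t by (simp add: divide_le_eq mult.commute)
    qed
  qed
  then show ?thesis by simp
qed

lemma has_derivative_if_quadratic_error:
  fixes \<phi> :: "'a::real_normed_vector \<Rightarrow> 'b::real_normed_vector"
  assumes lin: "bounded_linear \<phi>'"
    and err: "\<And>y. norm (\<phi> y - \<phi> x - \<phi>' (y - x)) \<le> C * (norm (y - x))\<^sup>2"
  shows "(\<phi> has_derivative \<phi>') (at x)"
  unfolding has_derivative_at
proof (intro conjI lin)
  show "(\<lambda>v. norm (\<phi> (x + v) - \<phi> x - \<phi>' v) / norm v) \<midarrow>0\<rightarrow> 0"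
  proof (rule Lim_null_comparison)
    show "\<forall>\<^sub>F v in at 0. norm (norm (\<phi> (x + v) - \<phi> x - \<phi>' v) / norm v) \<le> C * norm v"
      unfolding eventually_at_filter
    proof (intro always_eventually allI impI)
      fix v :: 'a assume "v \<noteq> 0"
      then show "norm (norm (\<phi> (x + v) - \<phi> x - \<phi>' v) / norm v) \<le> C * norm v"
        using err[of "x + v"] by (simp add: divide_le_eq power2_eq_square mult.assoc)
    qed
    show "((\<lambda>v. C * norm v) \<longlongrightarrow> 0) (at (0::'a))"
      by (intro tendsto_mult_right_zero tendsto_norm_zero tendsto_ident_at)
  qed
qed

section \<open>Products of simplices and the blockwise centring map\<close>

text \<open>The tangent space of the product of simplices, and its orthogonal complement: the vectors
  that are constant on each block.\<close>

definition tangent :: "('n::finite \<Rightarrow> 'p::finite) \<Rightarrow> (real^'n) set" where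
  "tangent blk = {v. \<forall>i. (\<Sum>j | blk j = i. v $ j) = 0}"

definition block_const :: "('n::finite \<Rightarrow> 'p::finite) \<Rightarrow> (real^'n) set" where
  "block_const blk = {c. \<forall>j l. blk j = blk l \<longrightarrow> c $ j = c $ l}"

lemma sum_over_blocks:
  fixes \<phi> :: "'n::finite \<Rightarrow> 'a::comm_monoid_add" and blk :: "'n \<Rightarrow> 'p::finite"
  shows "(\<Sum>j\<in>UNIV. \<phi> j) = (\<Sum>i\<in>UNIV. \<Sum>j | blk j = i. \<phi> j)"
  using sum.group[of UNIV UNIV blk \<phi>] by simp

lemma tangent_diff [intro]: "u \<in> tangent blk \<Longrightarrow> v \<in> tangent blk \<Longrightarrow> u - v \<in> tangent blk"
  by (simp add: tangent_def sum_subtractf)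

lemma tangent_zero [simp]: "0 \<in> tangent blk"
  by (simp add: tangent_def)

lemma tangent_scaleR [intro]: "v \<in> tangent blk \<Longrightarrow> c *\<^sub>R v \<in> tangent blk"
  by (simp add: tangent_def flip: sum_distrib_left)

lemma tangent_block_const_inner:
  assumes v: "v \<in> tangent blk" and c: "c \<in> block_const blk"
  shows "v \<bullet> c = 0"
proof -
  have "(\<Sum>j | blk j = i. v $ j * c $ j) = 0" for i
  proof (cases "\<exists>j. blk j = i")
    case True
    then obtain l where l: "blk l = i" by blast
    have "(\<Sum>j | blk j = i. v $ j * c $ j) = (\<Sum>j | blk j = i. v $ j * c $ l)"
      using c l by (intro sum.cong) (auto simp: block_const_def)
    also have "\<dots> = 0" using v by (simp add: tangent_def flip: sum_distrib_right)
    finally show ?thesis .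
  qed simp
  then show ?thesis
    by (simp add: inner_vec_def sum_over_blocks[of "\<lambda>j. v $ j * c $ j" blk])
qed

lemma block_const_diff [intro]:
  "c \<in> block_const blk \<Longrightarrow> c' \<in> block_const blk \<Longrightarrow> c - c' \<in> block_const blk"
  unfolding block_const_def mem_Collect_eq vector_minus_component by metis

lemma block_const_scaleR [intro]: "c \<in> block_const blk \<Longrightarrow> a *\<^sub>R c \<in> block_const blk"
  unfolding block_const_def mem_Collect_eq vector_scaleR_component by metis

lemma simplex_prod_nonneg: "h \<in> simplex_prod blk \<Longrightarrow> 0 \<le> h $ j"
  by (simp add: simplex_prod_def)

lemma simplex_prod_block_sum: "h \<in> simplex_prod blk \<Longrightarrow> (\<Sum>l | blk l = i. h $ l) = 1"
  by (simp add: simplex_prod_def)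

lemma simplex_prod_le_1:
  assumes "h \<in> simplex_prod blk"
  shows "h $ j \<le> 1"
proof -
  have "h $ j \<le> (\<Sum>l | blk l = blk j. h $ l)"
    using assms by (intro member_le_sum) (auto simp: simplex_prod_nonneg)
  then show ?thesis using assms by (simp add: simplex_prod_block_sum)
qed

lemma simplex_prod_diff_tangent:
  "h \<in> simplex_prod blk \<Longrightarrow> h' \<in> simplex_prod blk \<Longrightarrow> h - h' \<in> tangent blk"
  by (simp add: tangent_def simplex_prod_def sum_subtractf)

lemma simplex_prod_norm_diff_le:
  fixes h h' :: "real^'n"
  assumes "h \<in> simplex_prod blk" "h' \<in> simplex_prod blk"
  shows "norm (h - h') \<le> real CARD('n)"
proof -
  have "\<bar>(h - h') $ j\<bar> \<le> 1" for j
    using simplex_prod_nonneg[OF assms(1), of j] simplex_prod_nonneg[OF assms(2), of j]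
      simplex_prod_le_1[OF assms(1), of j] simplex_prod_le_1[OF assms(2), of j] by auto
  then have "norm (h - h') \<le> real CARD('n) * 1" by (rule norm_le_card_times)
  then show ?thesis by simp
qed

lemma convex_simplex_prod: "convex (simplex_prod blk)"
  unfolding convex_def simplex_prod_def
  by (auto simp: sum.distrib simp flip: sum_distrib_left)

lemma compact_simplex_prod:
  fixes blk :: "'n::finite \<Rightarrow> 'p::finite"
  shows "compact (simplex_prod blk)"
proof -
  have "simplex_prod blk = (\<Inter>j. {h. 0 \<le> h $ j}) \<inter> (\<Inter>i. {h. (\<Sum>j | blk j = i. h $ j) = 1})"
    by (auto simp: simplex_prod_def)
  also have "closed \<dots>"
    by (intro closed_Int closed_INT ballI closed_Collect_le closed_Collect_eq continuous_intros)
  finally have "closed (simplex_prod blk)" .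
  moreover have "bounded (simplex_prod blk)"
  proof (cases "simplex_prod blk = {}")
    case False
    then obtain h0 where h0: "h0 \<in> simplex_prod blk" by blast
    have "dist h0 h \<le> real CARD('n)" if "h \<in> simplex_prod blk" for h
      using simplex_prod_norm_diff_le[OF h0 that] by (simp add: dist_norm)
    then show ?thesis unfolding bounded_def by blast
  qed simp
  ultimately show ?thesis by (simp add: compact_eq_bounded_closed)
qed

lemma simplex_prod_nonempty:
  fixes blk :: "'n::finite \<Rightarrow> 'p::finite"
  assumes "surj blk"
  shows "simplex_prod blk \<noteq> {}"
proof -
  define h :: "real^'n" where "h = (\<chi> j. 1 / real (card {l. blk l = blk j}))"
  have "(\<Sum>j | blk j = i. h $ j) = 1" for i
  proof -
    obtain l where "blk l = i" using assms by (metis surjD)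
    then have "card {j. blk j = i} \<noteq> 0" by auto
    moreover have "(\<Sum>j | blk j = i. h $ j) = (\<Sum>j | blk j = i. 1 / real (card {l. blk l = i}))"
      by (intro sum.cong) (auto simp: h_def)
    ultimately show ?thesis by simp
  qed
  then have "h \<in> simplex_prod blk" by (simp add: simplex_prod_def h_def)
  then show ?thesis by blast
qed

lemma simplex_prod_move_tangent:
  assumes h: "h \<in> simplex_prod blk" "\<And>j. \<delta> \<le> h $ j" and v: "v \<in> tangent blk" "norm v \<le> \<delta>"
  shows "h + v \<in> simplex_prod blk"
proof -
  have "0 \<le> h $ j + v $ j" for j
    using h(2)[of j] component_le_norm_cart[of v j] v by linarith
  then show ?thesis using h v by (simp add: simplex_prod_def tangent_def sum.distrib)
qed

text \<open>Multiplication by the blockwise matrix \<open>diag h - h h\<^sup>T\<close> subtracts the \<open>h\<close>-weighted mean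
  of each block and then scales by \<open>h\<close>.\<close>

lemma B_mat_mult_nth:
  "(B_mat blk h *v x) $ j = h $ j * (x $ j - (\<Sum>l | blk l = blk j. h $ l * x $ l))"
proof -
  have "(B_mat blk h *v x) $ j
      = (\<Sum>l\<in>UNIV. (if blk l = blk j then (if j = l then h $ j * x $ l else 0) - h $ j * h $ l * x $ l else 0))"
    unfolding matrix_vector_mult_def B_mat_def diag_mat_def
    by (simp add: algebra_simps) (intro sum.cong, auto simp: algebra_simps)
  also have "\<dots> = (\<Sum>l | blk l = blk j. (if j = l then h $ j * x $ l else 0) - h $ j * h $ l * x $ l)"
    by (simp add: sum.If_cases)
  also have "\<dots> = h $ j * x $ j - (\<Sum>l | blk l = blk j. h $ j * h $ l * x $ l)"
    by (simp add: sum_subtractf)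
  finally show ?thesis by (simp add: right_diff_distrib sum_distrib_left mult.assoc)
qed

lemma diag_mat_mult_nth [simp]: "(diag_mat w *v x) $ j = w $ j * x $ j"
proof -
  have "(diag_mat w *v x) $ j = (\<Sum>l\<in>UNIV. if j = l then w $ j * x $ l else 0)"
    unfolding matrix_vector_mult_def diag_mat_def vec_lambda_beta by (intro sum.cong) auto
  then show ?thesis by simp
qed

text \<open>The Hessian of the entropy at \<open>h\<close>, applied to \<open>v\<close>.\<close>

definition entropy_hess :: "real^'n \<Rightarrow> real^'n \<Rightarrow> real^'n" where
  "entropy_hess h v = diag_mat (\<chi> j. 1 / h $ j) *v v"

lemma entropy_hess_nth [simp]: "entropy_hess h v $ j = v $ j / h $ j"
  by (simp add: entropy_hess_def)

lemma entropy_hess_diff: "entropy_hess h (u - v) = entropy_hess h u - entropy_hess h v"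
  by (simp add: entropy_hess_def matrix_vector_mult_diff_distrib)

lemma B_mat_tangent:
  assumes "h \<in> simplex_prod blk"
  shows "B_mat blk h *v x \<in> tangent blk"
proof -
  have "(\<Sum>j | blk j = i. (B_mat blk h *v x) $ j)
      = (\<Sum>j | blk j = i. h $ j * x $ j - h $ j * (\<Sum>l | blk l = i. h $ l * x $ l))" for i
    by (intro sum.cong) (auto simp: B_mat_mult_nth algebra_simps)
  then show ?thesis using assms
    by (simp add: tangent_def sum_subtractf simplex_prod_block_sum flip: sum_distrib_right)
qed

lemma B_mat_block_const:
  assumes "h \<in> simplex_prod blk" "c \<in> block_const blk"
  shows "B_mat blk h *v c = 0"
proof -
  have "(\<Sum>l | blk l = blk j. h $ l * c $ l) = c $ j" for j
  proof -
    have "(\<Sum>l | blk l = blk j. h $ l * c $ l) = (\<Sum>l | blk l = blk j. h $ l * c $ j)"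
    proof (rule sum.cong[OF refl])
      fix l assume "l \<in> {l. blk l = blk j}"
      then have "c $ l = c $ j" using assms(2) unfolding block_const_def by blast
      then show "h $ l * c $ l = h $ l * c $ j" by (rule arg_cong)
    qed
    then show ?thesis using assms(1) by (simp add: simplex_prod_block_sum flip: sum_distrib_right)
  qed
  then show ?thesis by (simp add: vec_eq_iff B_mat_mult_nth)
qed

lemma B_mat_entropy_hess:
  assumes "\<And>j. 0 < h $ j" "v \<in> tangent blk"
  shows "B_mat blk h *v entropy_hess h v = v"
proof -
  have *: "h $ l \<noteq> 0" for l
    using assms(1)[of l] by simp
  show ?thesis using assms(2)
    by (simp add: vec_eq_iff B_mat_mult_nth right_diff_distrib * tangent_def)
qed

lemma entropy_hess_B_mat:
  assumes "\<And>j. 0 < h $ j"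
  shows "entropy_hess h (B_mat blk h *v x) - x \<in> block_const blk"
proof -
  have "h $ j \<noteq> 0" for j using assms[of j] by simp
  then show ?thesis by (simp add: block_const_def B_mat_mult_nth)
qed

lemma inner_entropy_hess_ge:
  assumes "h \<in> simplex_prod blk" "\<And>j. 0 < h $ j"
  shows "(norm v)\<^sup>2 \<le> v \<bullet> entropy_hess h v"
proof -
  have "v $ j * v $ j \<le> v $ j * (v $ j / h $ j)" for j
  proof -
    have "v $ j * v $ j * h $ j \<le> v $ j * v $ j * 1"
      using simplex_prod_le_1[OF assms(1)] by (intro mult_left_mono) auto
    then show ?thesis using assms(2)[of j] by (simp add: field_simps)
  qed
  then show ?thesis
    by (simp add: power2_norm_eq_inner inner_vec_def sum_mono)
qed

lemma norm_entropy_hess_le: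
  assumes "0 < \<delta>" "\<And>j. \<delta> \<le> h $ j"
  shows "norm (entropy_hess h v) \<le> norm v / \<delta>"
proof -
  have "\<bar>entropy_hess h v $ j\<bar> \<le> (1 / \<delta>) * \<bar>v $ j\<bar>" for j
  proof -
    have "\<bar>v $ j\<bar> / h $ j \<le> \<bar>v $ j\<bar> / \<delta>"
      using assms(1) assms(2)[of j] by (intro divide_left_mono) auto
    then show ?thesis using assms(1) assms(2)[of j] by simp
  qed
  then have "norm (entropy_hess h v) \<le> (1 / \<delta>) * norm v"
    using assms(1) by (intro norm_le_componentwise_mult) auto
  then show ?thesis by simp
qed

lemma norm_entropy_hess_diff_le:
  assumes "0 < \<delta>" "\<And>j. \<delta> \<le> h $ j" "\<And>j. \<delta> \<le> h' $ j"
  shows "norm (entropy_hess h v - entropy_hess h' v) \<le> norm (h - h') * norm v / \<delta>\<^sup>2"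
proof -
  have "\<bar>(entropy_hess h v - entropy_hess h' v) $ j\<bar> \<le> (norm (h - h') / \<delta>\<^sup>2) * \<bar>v $ j\<bar>" for j
  proof -
    have p: "h $ j > 0" "h' $ j > 0" using assms(1) assms(2)[of j] assms(3)[of j] by linarith+
    have "v $ j / h $ j - v $ j / h' $ j = (h' $ j - h $ j) * v $ j / (h $ j * h' $ j)"
      using p by (simp add: field_simps)
    also have "\<bar>\<dots>\<bar> = \<bar>(h - h') $ j\<bar> * \<bar>v $ j\<bar> / (h $ j * h' $ j)"
      using p by (simp add: abs_mult abs_minus_commute)
    also have "\<dots> \<le> norm (h - h') * \<bar>v $ j\<bar> / (\<delta> * \<delta>)"
      using p assms(1) assms(2)[of j] assms(3)[of j] component_le_norm_cart[of "h - h'" j]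
      by (intro frac_le mult_mono mult_right_mono mult_nonneg_nonneg) auto
    finally show ?thesis by (simp add: power2_eq_square)
  qed
  then have "norm (entropy_hess h v - entropy_hess h' v) \<le> (norm (h - h') / \<delta>\<^sup>2) * norm v"
    by (intro norm_le_componentwise_mult) auto
  then show ?thesis by simp
qed

lemma inner_B_mat_le:
  assumes h: "h \<in> simplex_prod blk"
  shows "x \<bullet> (B_mat blk h *v x) \<le> (norm x)\<^sup>2"
proof -
  let ?m = "\<lambda>i. \<Sum>l | blk l = i. h $ l * x $ l"
  have "x \<bullet> (B_mat blk h *v x)
      = (\<Sum>j\<in>UNIV. h $ j * (x $ j * x $ j) - h $ j * x $ j * ?m (blk j))"
    by (simp add: inner_vec_def B_mat_mult_nth algebra_simps)
  also have "\<dots> = (\<Sum>j\<in>UNIV. h $ j * (x $ j * x $ j)) - (\<Sum>i\<in>UNIV. ?m i * ?m i)"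
  proof -
    have "(\<Sum>j | blk j = i. h $ j * x $ j * ?m (blk j)) = ?m i * ?m i" for i
    proof -
      have "(\<Sum>j | blk j = i. h $ j * x $ j * ?m (blk j)) = (\<Sum>j | blk j = i. h $ j * x $ j * ?m i)"
        by (intro sum.cong) auto
      then show ?thesis by (simp flip: sum_distrib_right)
    qed
    then show ?thesis
      by (simp add: sum_subtractf sum_over_blocks[of "\<lambda>j. h $ j * x $ j * ?m (blk j)" blk])
  qed
  also have "\<dots> \<le> (\<Sum>j\<in>UNIV. h $ j * (x $ j * x $ j))" by (simp add: sum_nonneg)
  also have "\<dots> \<le> (\<Sum>j\<in>UNIV. 1 * (x $ j * x $ j))"
    using simplex_prod_le_1[OF h] by (intro sum_mono mult_right_mono) auto
  finally show ?thesis by (simp add: power2_norm_eq_inner inner_vec_def)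
qed

lemma norm_B_mat_diff_le:
  fixes h h' :: "real^'n::finite"
  assumes h: "h \<in> simplex_prod blk" and h': "h' \<in> simplex_prod blk"
  shows "norm (B_mat blk h *v x - B_mat blk h' *v x)
    \<le> real CARD('n) * (2 * real CARD('n) + 1) * norm (h - h') * norm x"
proof -
  let ?n = "real CARD('n)" and ?d = "norm (h - h')"
  have mean: "\<bar>\<Sum>l | blk l = i. w l * x $ l\<bar> \<le> ?n * (c * norm x)"
    if w: "\<And>l. \<bar>w l\<bar> \<le> c" for i w c
  proof -
    have c: "0 \<le> c" using w[of undefined] by linarith
    have "\<bar>\<Sum>l | blk l = i. w l * x $ l\<bar> \<le> (\<Sum>l | blk l = i. \<bar>w l * x $ l\<bar>)" by (rule sum_abs)
    also have "\<dots> \<le> (\<Sum>l | blk l = i. c * norm x)"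
      using w c component_le_norm_cart[of x] by (intro sum_mono) (auto simp: abs_mult intro!: mult_mono)
    also have "\<dots> \<le> ?n * (c * norm x)"
      using c by (auto intro!: mult_right_mono card_mono simp del: of_nat_mult)
    finally show ?thesis .
  qed
  have "\<bar>(B_mat blk h *v x - B_mat blk h' *v x) $ j\<bar> \<le> (2 * ?n + 1) * ?d * norm x" for j
  proof -
    define a a' where "a = (\<Sum>l | blk l = blk j. h $ l * x $ l)"
      and "a' = (\<Sum>l | blk l = blk j. h' $ l * x $ l)"
    have a: "\<bar>a\<bar> \<le> ?n * (1 * norm x)"
      unfolding a_def using simplex_prod_le_1[OF h] simplex_prod_nonneg[OF h] by (intro mean) auto
    have "a - a' = (\<Sum>l | blk l = blk j. (h $ l - h' $ l) * x $ l)"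
      by (simp add: a_def a'_def sum_subtractf left_diff_distrib)
    then have aa': "\<bar>a - a'\<bar> \<le> ?n * (?d * norm x)"
      using component_le_norm_cart[of "h - h'"] by (auto intro!: mean)
    have hj: "\<bar>h $ j - h' $ j\<bar> \<le> ?d" using component_le_norm_cart[of "h - h'" j] by auto
    have h'j: "\<bar>h' $ j\<bar> \<le> 1"
      using simplex_prod_le_1[OF h'] simplex_prod_nonneg[OF h'] by auto
    have "(B_mat blk h *v x - B_mat blk h' *v x) $ j
        = (h $ j - h' $ j) * x $ j - (h $ j - h' $ j) * a - h' $ j * (a - a')"
      unfolding vector_minus_component B_mat_mult_nth a_def[symmetric] a'_def[symmetric]
      by (simp add: algebra_simps)
    also have "\<bar>\<dots>\<bar> \<le> \<bar>(h $ j - h' $ j) * x $ j\<bar> + \<bar>(h $ j - h' $ j) * a\<bar> + \<bar>h' $ j * (a - a')\<bar>"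
      by linarith
    also have "\<dots> \<le> ?d * norm x + ?d * (?n * (1 * norm x)) + 1 * (?n * (?d * norm x))"
      unfolding abs_mult using a aa' hj h'j component_le_norm_cart[of x j]
      by (intro add_mono mult_mono) auto
    also have "\<dots> = (2 * ?n + 1) * ?d * norm x" by (simp add: algebra_simps)
    finally show ?thesis .
  qed
  then have "norm (B_mat blk h *v x - B_mat blk h' *v x) \<le> ?n * ((2 * ?n + 1) * ?d * norm x)"
    by (rule norm_le_card_times)
  then show ?thesis by (simp add: mult_ac)
qed

text \<open>The norm of \<open>v\<close> in the Riemannian metric at \<open>h\<close> whose matrix is the Hessian of the entropy.\<close>

definition entropy_norm :: "real^'n \<Rightarrow> real^'n \<Rightarrow> real" where
  "entropy_norm h v = norm (\<chi> j. v $ j / sqrt (h $ j))"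

lemma entropy_norm_triangle: "entropy_norm h (u + v) \<le> entropy_norm h u + entropy_norm h v"
proof -
  have "(\<chi> j. (u + v) $ j / sqrt (h $ j)) = (\<chi> j. u $ j / sqrt (h $ j)) + (\<chi> j. v $ j / sqrt (h $ j))"
    by (simp add: vec_eq_iff add_divide_distrib)
  then show ?thesis by (simp add: entropy_norm_def norm_triangle_ineq)
qed

lemma entropy_norm_minus: "entropy_norm h (- v) = entropy_norm h v"
proof -
  have "(\<chi> j. (- v) $ j / sqrt (h $ j)) = - (\<chi> j. v $ j / sqrt (h $ j))"
    by (simp add: vec_eq_iff)
  then show ?thesis by (simp add: entropy_norm_def)
qed

lemma entropy_norm_nonneg [simp]: "0 \<le> entropy_norm h v"
  by (simp add: entropy_norm_def)

lemma entropy_norm_square: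
  assumes "\<And>j. 0 < h $ j"
  shows "(entropy_norm h v)\<^sup>2 = v \<bullet> entropy_hess h v"
proof -
  have "sqrt (h $ j) * sqrt (h $ j) = h $ j" for j using assms[of j] by simp
  then show ?thesis by (simp add: entropy_norm_def power2_norm_eq_inner inner_vec_def)
qed

lemma norm_le_entropy_norm:
  assumes "h \<in> simplex_prod blk" "\<And>j. 0 < h $ j"
  shows "norm v \<le> entropy_norm h v"
  by (rule power2_le_imp_le)
    (simp_all only: entropy_norm_square[OF assms(2)] inner_entropy_hess_ge[OF assms] entropy_norm_nonneg)

lemma entropy_norm_le:
  assumes "0 < \<delta>" "\<And>j. \<delta> \<le> h $ j"
  shows "entropy_norm h v \<le> norm v / sqrt \<delta>"
proof -
  have "\<bar>(\<chi> j. v $ j / sqrt (h $ j)) $ j\<bar> \<le> (1 / sqrt \<delta>) * \<bar>v $ j\<bar>" for j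
  proof -
    have "\<bar>v $ j\<bar> / sqrt (h $ j) \<le> \<bar>v $ j\<bar> / sqrt \<delta>"
      using assms(1) assms(2)[of j] by (intro divide_left_mono) auto
    then show ?thesis using assms(1) assms(2)[of j] by simp
  qed
  then have "entropy_norm h v \<le> (1 / sqrt \<delta>) * norm v"
    unfolding entropy_norm_def using assms(1) by (intro norm_le_componentwise_mult) auto
  then show ?thesis by simp
qed

lemma norm_B_mat_le:
  assumes "h \<in> simplex_prod blk" "\<And>j. 0 < h $ j"
  shows "entropy_norm h (B_mat blk h *v x) \<le> norm x"
proof -
  let ?b = "B_mat blk h *v x"
  have "(entropy_norm h ?b)\<^sup>2 = ?b \<bullet> x + ?b \<bullet> (entropy_hess h ?b - x)"
    using assms by (simp add: entropy_norm_square inner_diff_right)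
  also have "\<dots> = ?b \<bullet> x"
    using tangent_block_const_inner[OF B_mat_tangent[OF assms(1), of x] entropy_hess_B_mat[OF assms(2), of blk x]]
    by simp
  also have "\<dots> \<le> (norm x)\<^sup>2" using inner_B_mat_le[OF assms(1)] by (simp add: inner_commute)
  finally show ?thesis by (rule power2_le_imp_le) simp
qed

text \<open>In the entropy metric, multiplication by \<open>B\<close> turns the Euclidean gradient of a quadratic
  form into its Riemannian gradient. If the form is nonnegative at the tangent vector
  \<open>v\<close>, the first-order term of a gradient step therefore does not increase the norm.\<close>

lemma entropy_norm_gradient_step:
  fixes h v x :: "real^'n"
  assumes h: "h \<in> simplex_prod blk" "\<And>j. 0 < h $ j" and v: "v \<in> tangent blk"
    and psd: "0 \<le> v \<bullet> x" and x: "norm x \<le> L * norm v" and a: "0 \<le> a" "0 \<le> \<alpha>"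
  shows "(entropy_norm h (a *\<^sub>R v - \<alpha> *\<^sub>R (B_mat blk h *v x)))\<^sup>2
    \<le> (a\<^sup>2 + \<alpha>\<^sup>2 * L\<^sup>2) * (entropy_norm h v)\<^sup>2"
proof -
  let ?b = "B_mat blk h *v x" and ?D = "entropy_hess h"
  have D: "?D (a *\<^sub>R v - \<alpha> *\<^sub>R ?b) = a *\<^sub>R ?D v - \<alpha> *\<^sub>R ?D ?b"
    by (simp add: vec_eq_iff diff_divide_distrib)
  have sym: "?b \<bullet> ?D v = v \<bullet> ?D ?b" by (simp add: inner_vec_def mult_ac)
  have cross: "v \<bullet> ?D ?b = v \<bullet> x"
    using tangent_block_const_inner[OF v entropy_hess_B_mat[OF h(2), where x = x]]
    by (simp add: inner_diff_right)
  have expand: "(a *\<^sub>R p - \<alpha> *\<^sub>R r) \<bullet> (a *\<^sub>R p' - \<alpha> *\<^sub>R r')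
      = a\<^sup>2 * (p \<bullet> p') - a * \<alpha> * (p \<bullet> r') - a * \<alpha> * (r \<bullet> p') + \<alpha>\<^sup>2 * (r \<bullet> r')"
    for p r p' r' :: "real^'n"
    by (simp add: inner_diff_left inner_diff_right power2_eq_square algebra_simps)
  have "?b \<bullet> ?D ?b \<le> (norm x)\<^sup>2"
    using norm_B_mat_le[OF h, of x] unfolding entropy_norm_square[OF h(2), symmetric]
    by (intro power_mono) auto
  also have "\<dots> \<le> (L * norm v)\<^sup>2" using x by (intro power_mono) auto
  also have "\<dots> \<le> L\<^sup>2 * (v \<bullet> ?D v)"
    unfolding power_mult_distrib using inner_entropy_hess_ge[OF h] by (intro mult_left_mono) auto
  finally have "\<alpha>\<^sup>2 * (?b \<bullet> ?D ?b) \<le> \<alpha>\<^sup>2 * (L\<^sup>2 * (v \<bullet> ?D v))"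
    by (intro mult_left_mono) auto
  moreover have "0 \<le> a * \<alpha> * (v \<bullet> x)" using psd a by simp
  moreover have "(entropy_norm h (a *\<^sub>R v - \<alpha> *\<^sub>R ?b))\<^sup>2
      = a\<^sup>2 * (v \<bullet> ?D v) - a * \<alpha> * (v \<bullet> x) - a * \<alpha> * (v \<bullet> x) + \<alpha>\<^sup>2 * (?b \<bullet> ?D ?b)"
    unfolding entropy_norm_square[OF h(2)] D expand sym cross ..
  ultimately have "(entropy_norm h (a *\<^sub>R v - \<alpha> *\<^sub>R ?b))\<^sup>2
      \<le> a\<^sup>2 * (v \<bullet> ?D v) + \<alpha>\<^sup>2 * (L\<^sup>2 * (v \<bullet> ?D v))" by linarith
  also have "\<dots> = (a\<^sup>2 + \<alpha>\<^sup>2 * L\<^sup>2) * (entropy_norm h v)\<^sup>2"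
    unfolding entropy_norm_square[OF h(2)] by (simp add: distrib_right)
  finally show ?thesis .
qed

section \<open>Kullback-Leibler divergence and multiplicative updates\<close>

text \<open>The componentwise logarithm, which is the gradient of the entropy.\<close>

definition ln_vec :: "real^'n \<Rightarrow> real^'n" where
  "ln_vec h = (\<chi> j. ln (h $ j))"

lemma ln_vec_nth [simp]: "ln_vec h $ j = ln (h $ j)"
  by (simp add: ln_vec_def)

lemma g_reg_grad_eq: "g_reg_grad gh \<eta> h y = gh h y + \<eta> *\<^sub>R ln_vec h"
  by (simp add: g_reg_grad_def ln_vec_def)

text \<open>The divergence \<open>KL(a \<parallel> h)\<close>, summed over all blocks. Vanishing entries of
  \<open>a\<close> contribute nothing.\<close>

definition kl :: "real^'n \<Rightarrow> real^'n \<Rightarrow> real" where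
  "kl a h = (\<Sum>j\<in>UNIV. a $ j * (ln (a $ j) - ln (h $ j)))"

lemma simplex_prod_sum_eq:
  assumes "h \<in> simplex_prod blk" "h' \<in> simplex_prod blk"
  shows "(\<Sum>j\<in>UNIV. h $ j) = (\<Sum>j\<in>UNIV. h' $ j)"
  using assms by (simp add: sum_over_blocks[of _ blk] simplex_prod_block_sum)

lemma kl_ge_norm_square:
  assumes a: "a \<in> simplex_prod blk" and h: "h \<in> simplex_prod blk" "\<And>j. 0 < h $ j"
  shows "(norm (a - h))\<^sup>2 / 4 \<le> kl a h"
proof -
  have "(norm (a - h))\<^sup>2 / 4 = (\<Sum>j\<in>UNIV. (a $ j - h $ j)\<^sup>2 / 4)"
    unfolding power2_norm_eq_inner inner_vec_def sum_divide_distrib by (simp add: power2_eq_square)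
  also have "\<dots> \<le> (\<Sum>j\<in>UNIV. a $ j * (ln (a $ j) - ln (h $ j)) - a $ j + h $ j)"
    using a h by (intro sum_mono kl_summand_ge_square)
      (auto simp: simplex_prod_nonneg simplex_prod_le_1)
  also have "\<dots> = kl a h"
    using simplex_prod_sum_eq[OF a h(1)] by (simp add: kl_def sum_subtractf sum.distrib)
  finally show ?thesis .
qed

lemma kl_nonneg:
  assumes "a \<in> simplex_prod blk" "h \<in> simplex_prod blk" "\<And>j. 0 < h $ j"
  shows "0 \<le> kl a h"
  using kl_ge_norm_square[OF assms] zero_le_power2[of "norm (a - h)"] by linarith

lemma kl_symmetrized: "kl a h + kl h a = (ln_vec a - ln_vec h) \<bullet> (a - h)"
  by (simp add: kl_def inner_vec_def algebra_simps flip: sum.distrib)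

lemma entropy_bregman:
  assumes "a \<in> simplex_prod blk" "h \<in> simplex_prod blk"
  shows "entropy a = entropy h + ln_vec h \<bullet> (a - h) + kl a h"
proof -
  have "entropy a - (entropy h + ln_vec h \<bullet> (a - h) + kl a h) = (\<Sum>j\<in>UNIV. h $ j - a $ j)"
    unfolding entropy_def kl_def inner_vec_def sum.distrib[symmetric] sum_subtractf[symmetric]
    by (intro sum.cong) (auto simp: algebra_simps)
  then show ?thesis using simplex_prod_sum_eq[OF assms] by (simp add: sum_subtractf)
qed

lemma ln_vec_strongly_monotone:
  assumes "a \<in> simplex_prod blk" "\<And>j. 0 < a $ j" "b \<in> simplex_prod blk" "\<And>j. 0 < b $ j"
  shows "(norm (a - b))\<^sup>2 \<le> (ln_vec a - ln_vec b) \<bullet> (a - b)"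
proof -
  have "(norm (a - b))\<^sup>2 = (\<Sum>j\<in>UNIV. (a $ j - b $ j)\<^sup>2)"
    unfolding power2_norm_eq_inner inner_vec_def by (simp add: power2_eq_square)
  also have "\<dots> \<le> (\<Sum>j\<in>UNIV. (ln (a $ j) - ln (b $ j)) * (a $ j - b $ j))"
    using assms by (intro sum_mono ln_strongly_monotone) (auto simp: simplex_prod_le_1)
  finally show ?thesis by (simp add: inner_vec_def)
qed

text \<open>One multiplicative-weights update with exponents \<open>- x\<close>, normalized in each block.\<close>

definition exp_step :: "('n::finite \<Rightarrow> 'p::finite) \<Rightarrow> real^'n \<Rightarrow> real^'n \<Rightarrow> real^'n" where
  "exp_step blk w x = (\<chi> j. w $ j * exp (- x $ j) / (\<Sum>l | blk l = blk j. w $ l * exp (- x $ l)))"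

lemma md_step_eq_exp_step: "md_step blk gh \<eta> \<alpha> y h = exp_step blk h (\<alpha> *\<^sub>R g_reg_grad gh \<eta> h y)"
  by (simp add: md_step_def exp_step_def)

lemma exp_step_normalizer_pos:
  fixes w x :: "real^'n::finite" and blk :: "'n \<Rightarrow> 'p::finite"
  assumes "\<And>j. 0 < w $ j"
  shows "0 < (\<Sum>l | blk l = blk j. w $ l * exp (- x $ l))"
  using assms by (intro sum_pos) auto

lemma exp_step_pos:
  assumes "\<And>j. 0 < w $ j"
  shows "0 < exp_step blk w x $ j"
  using assms[of j] exp_step_normalizer_pos[OF assms, where blk = blk and x = x and j = j]
  by (simp add: exp_step_def)

lemma exp_step_simplex:
  assumes "surj blk" "\<And>j. 0 < w $ j"
  shows "exp_step blk w x \<in> simplex_prod blk"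
proof -
  have "(\<Sum>j | blk j = i. exp_step blk w x $ j) = 1" for i
  proof -
    obtain j0 where j0: "blk j0 = i" using assms(1) by (metis surjD)
    have "(\<Sum>j | blk j = i. exp_step blk w x $ j)
        = (\<Sum>j | blk j = i. w $ j * exp (- x $ j) / (\<Sum>l | blk l = i. w $ l * exp (- x $ l)))"
      by (intro sum.cong) (auto simp: exp_step_def)
    also have "\<dots> = 1"
      using exp_step_normalizer_pos[OF assms(2), where blk = blk and x = x and j = j0] j0 by (simp flip: sum_divide_distrib)
    finally show ?thesis .
  qed
  moreover have "0 \<le> exp_step blk w x $ j" for j
    by (rule less_imp_le[OF exp_step_pos[OF assms(2)]])
  ultimately show ?thesis unfolding simplex_prod_def by blast
qed

lemma ln_exp_step:
  assumes "\<And>j. 0 < w $ j"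
  shows "ln (exp_step blk w x $ j)
    = ln (w $ j) - x $ j - ln (\<Sum>l | blk l = blk j. w $ l * exp (- x $ l))"
  using assms[of j] exp_step_normalizer_pos[OF assms, where blk = blk and x = x and j = j]
  by (simp add: exp_step_def ln_div ln_mult)

lemma exp_step_diff_block_const:
  assumes "c \<in> block_const blk"
  shows "exp_step blk w (x - c) = exp_step blk w x"
proof -
  have "w $ j * exp (- (x - c) $ j) / (\<Sum>l | blk l = blk j. w $ l * exp (- (x - c) $ l))
      = w $ j * exp (- x $ j) / (\<Sum>l | blk l = blk j. w $ l * exp (- x $ l))" for j
  proof -
    have "(\<Sum>l | blk l = blk j. w $ l * exp (- (x - c) $ l))
        = (\<Sum>l | blk l = blk j. w $ l * exp (- x $ l) * exp (c $ j))"
    proof (rule sum.cong[OF refl])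
      fix l assume "l \<in> {l. blk l = blk j}"
      then have "c $ l = c $ j" using assms unfolding block_const_def by blast
      then have "- (x - c) $ l = - x $ l + c $ j" by simp
      then show "w $ l * exp (- (x - c) $ l) = w $ l * exp (- x $ l) * exp (c $ j)"
        by (simp only: exp_add mult.assoc)
    qed
    moreover have "exp (- (x - c) $ j) = exp (- x $ j) * exp (c $ j)"
      by (simp flip: exp_add)
    ultimately show ?thesis by (simp flip: sum_distrib_right)
  qed
  then show ?thesis by (simp add: exp_step_def)
qed

text \<open>The change of the divergence is \<open>a \<bullet> x\<close> plus the logarithms of the normalizers, and
  \<open>ln Z \<le> Z - 1\<close> together with the quadratic bound on the exponential controls the latter.\<close>

lemma kl_exp_step_le:
  fixes a h x :: "real^'n::finite" and blk :: "'n \<Rightarrow> 'p::finite"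
  assumes a: "a \<in> simplex_prod blk" and h: "h \<in> simplex_prod blk" "\<And>j. 0 < h $ j"
    and x: "\<And>j. \<bar>x $ j\<bar> \<le> 1/2"
  shows "kl a (exp_step blk h x) \<le> kl a h - (h - a) \<bullet> x + 2 * (norm x)\<^sup>2"
proof -
  define Z where "Z i = (\<Sum>l | blk l = i. h $ l * exp (- x $ l))" for i
  have "kl a (exp_step blk h x) - kl a h = (\<Sum>j\<in>UNIV. a $ j * x $ j + a $ j * ln (Z (blk j)))"
    unfolding kl_def sum_subtractf[symmetric] ln_exp_step[OF h(2)] Z_def
    by (intro sum.cong) (auto simp: algebra_simps)
  also have "\<dots> = a \<bullet> x + (\<Sum>i\<in>UNIV. ln (Z i))"
  proof -
    have "(\<Sum>j | blk j = i. a $ j * ln (Z (blk j))) = ln (Z i)" for i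
    proof -
      have "(\<Sum>j | blk j = i. a $ j * ln (Z (blk j))) = (\<Sum>j | blk j = i. a $ j * ln (Z i))"
        by (intro sum.cong) auto
      then show ?thesis using a by (simp add: simplex_prod_block_sum flip: sum_distrib_right)
    qed
    then show ?thesis
      by (simp add: sum.distrib inner_vec_def sum_over_blocks[of "\<lambda>j. a $ j * ln (Z (blk j))" blk])
  qed
  also have "(\<Sum>i\<in>UNIV. ln (Z i)) \<le> (\<Sum>i\<in>UNIV. \<Sum>l | blk l = i. - (h $ l * x $ l) + 2 * (x $ l * x $ l))"
  proof (rule sum_mono)
    fix i
    have "{l. blk l = i} \<noteq> {}" 
      using simplex_prod_block_sum[OF h(1), of i] by (metis sum.empty zero_neq_one)
    then have "0 < Z i" unfolding Z_def using h(2) by (intro sum_pos) auto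
    then have "ln (Z i) \<le> Z i - 1" by (rule ln_le_minus_one)
    also have "\<dots> = (\<Sum>l | blk l = i. h $ l * (exp (- x $ l) - 1))"
      using h(1) by (simp add: Z_def right_diff_distrib sum_subtractf simplex_prod_block_sum)
    also have "\<dots> \<le> (\<Sum>l | blk l = i. - (h $ l * x $ l) + 2 * (x $ l * x $ l))"
    proof (rule sum_mono)
      fix l
      have "exp (- x $ l) \<le> 1 + (- x $ l) + 2 * (- x $ l)\<^sup>2"
        using x[of l] by (intro exp_le_quadratic) auto
      then have "h $ l * (exp (- x $ l) - 1) \<le> h $ l * (- x $ l + 2 * (x $ l)\<^sup>2)"
        using h(2)[of l] by (intro mult_left_mono) auto
      also have "h $ l * (2 * (x $ l)\<^sup>2) \<le> 1 * (2 * (x $ l)\<^sup>2)"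
        using simplex_prod_le_1[OF h(1)] by (intro mult_right_mono) auto
      then have "h $ l * (- x $ l + 2 * (x $ l)\<^sup>2) \<le> - (h $ l * x $ l) + 2 * (x $ l * x $ l)"
        by (simp add: algebra_simps power2_eq_square)
      finally show "h $ l * (exp (- x $ l) - 1) \<le> - (h $ l * x $ l) + 2 * (x $ l * x $ l)" .
    qed
    finally show "ln (Z i) \<le> (\<Sum>l | blk l = i. - (h $ l * x $ l) + 2 * (x $ l * x $ l))" .
  qed
  also have "\<dots> = - (h \<bullet> x) + 2 * (norm x)\<^sup>2"
    unfolding sum_over_blocks[symmetric] power2_norm_eq_inner inner_vec_def
    by (simp add: sum_subtractf sum_distrib_left)
  finally show ?thesis by (simp add: inner_diff_left)
qed

text \<open>The points of the product of simplices whose entries are positive and, in a common block,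
  within a factor \<open>Q\<close> of each other.\<close>

definition balanced :: "('n::finite \<Rightarrow> 'p::finite) \<Rightarrow> real \<Rightarrow> (real^'n) set" where
  "balanced blk Q = {h \<in> simplex_prod blk.
     (\<forall>j. 0 < h $ j) \<and> (\<forall>j l. blk j = blk l \<longrightarrow> ln (h $ j) - ln (h $ l) \<le> ln Q)}"

lemma balanced_ge:
  fixes h :: "real^'n::finite"
  assumes h: "h \<in> balanced blk Q" and Q: "0 < Q"
  shows "1 / (Q * real CARD('n)) \<le> h $ j"
proof -
  have hj: "0 < h $ j" and h': "h \<in> simplex_prod blk" using h by (auto simp: balanced_def)
  have le: "h $ l \<le> Q * h $ j" if "blk l = blk j" for l
  proof -
    have "0 < h $ l" "ln (h $ l) - ln (h $ j) \<le> ln Q" using h that by (auto simp: balanced_def)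
    then have "ln (h $ l) \<le> ln (Q * h $ j)" using Q hj by (simp add: ln_mult)
    then show ?thesis using \<open>0 < h $ l\<close> Q hj by simp
  qed
  have "1 = (\<Sum>l | blk l = blk j. h $ l)" using h' by (simp add: simplex_prod_block_sum)
  also have "\<dots> \<le> (\<Sum>l | blk l = blk j. Q * h $ j)" by (rule sum_mono) (simp add: le)
  also have "\<dots> = real (card {l. blk l = blk j}) * (Q * h $ j)" by simp
  also have "\<dots> \<le> real CARD('n) * (Q * h $ j)"
    using Q hj by (intro mult_right_mono) (auto intro: card_mono)
  finally show ?thesis using Q by (simp add: divide_le_eq mult_ac)
qed

lemma trunc_simplex_prod_balanced:
  assumes "0 < nu_min blk \<eta> \<Omega>g"
  shows "trunc_simplex_prod blk \<eta> \<Omega>g \<subseteq> balanced blk (1 / nu_min blk \<eta> \<Omega>g)"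
proof
  fix h assume h: "h \<in> trunc_simplex_prod blk \<eta> \<Omega>g"
  let ?\<nu> = "nu_min blk \<eta> \<Omega>g"
  have hs: "h \<in> simplex_prod blk" and ge: "\<And>j. ?\<nu> \<le> h $ j"
    using h by (auto simp: trunc_simplex_prod_def)
  have pos: "0 < h $ j" for j using ge[of j] assms by linarith
  have "ln (h $ j) - ln (h $ l) \<le> ln (1 / ?\<nu>)" for j l
  proof -
    have "ln (h $ j) \<le> 0" using simplex_prod_le_1[OF hs] pos by simp
    moreover have "ln ?\<nu> \<le> ln (h $ l)" using ge pos assms by simp
    ultimately show ?thesis using assms by (simp add: ln_div)
  qed
  then show "h \<in> balanced blk (1 / ?\<nu>)" using hs pos by (simp add: balanced_def)
qed

section \<open>The regularized lower-level problem\<close>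

text \<open>The standing assumptions on the lower-level objective. The gradient \<open>gh\<close>, the Hessian \<open>ghh\<close>
  and the mixed derivative \<open>ghy\<close> are only determined up to components normal to the product of
  simplices; in particular no symmetry of \<open>ghh\<close> is assumed.\<close>

locale lower_level =
  fixes blk :: "'n::finite \<Rightarrow> 'p::finite"
    and g :: "real^'n \<Rightarrow> real^'u::finite \<Rightarrow> real"
    and gh :: "real^'n \<Rightarrow> real^'u \<Rightarrow> real^'n"
    and ghh :: "real^'n \<Rightarrow> real^'u \<Rightarrow> real^'n^'n"
    and ghy :: "real^'n \<Rightarrow> real^'u \<Rightarrow> real^'u^'n"
    and \<eta> Lg \<Omega>g \<Lambda>g \<tau>h \<tau>y \<rho>h \<rho>y :: real
  assumes surj: "surj blk"
    and eta: "\<eta> > 0"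
    and pos: "Lg > 0" "\<Omega>g > 0" "\<Lambda>g > 0" "\<tau>h > 0" "\<tau>y > 0" "\<rho>h > 0" "\<rho>y > 0"
    and g_deriv: "\<And>h y. h \<in> simplex_prod blk \<Longrightarrow>
          ((\<lambda>h. g h y) has_derivative (\<lambda>v. gh h y \<bullet> v)) (at h within simplex_prod blk)"
    and gh_deriv_h: "\<And>h y. h \<in> simplex_prod blk \<Longrightarrow>
          ((\<lambda>h. gh h y) has_derivative (\<lambda>v. ghh h y *v v)) (at h within simplex_prod blk)"
    and gh_deriv_y: "\<And>h y. h \<in> simplex_prod blk \<Longrightarrow>
          ((\<lambda>y. gh h y) has_derivative (\<lambda>w. ghy h y *v w)) (at y)"
    and g_convex: "\<And>y. convex_on (simplex_prod blk) (\<lambda>h. g h y)"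
    and gh_lipschitz: "\<And>y. Lg-lipschitz_on (simplex_prod blk) (\<lambda>h. gh h y)"
    and gh_bound: "\<And>h y. h \<in> simplex_prod blk \<Longrightarrow> norm (gh h y) \<le> \<Omega>g"
    and ghh_bound: "\<And>h y. h \<in> simplex_prod blk \<Longrightarrow> spectral_norm (ghh h y) \<le> Lg"
    and ghy_bound: "\<And>h y. h \<in> simplex_prod blk \<Longrightarrow> spectral_norm (ghy h y) \<le> \<Lambda>g"
    and ghy_lipschitz_h: "\<And>h h' y. h \<in> simplex_prod blk \<Longrightarrow> h' \<in> simplex_prod blk \<Longrightarrow>
          spectral_norm (ghy h y - ghy h' y) \<le> \<tau>h * norm (h - h')"
    and ghy_lipschitz_y: "\<And>h y y'. h \<in> simplex_prod blk \<Longrightarrow>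
          spectral_norm (ghy h y - ghy h y') \<le> \<tau>y * norm (y - y')"
    and ghh_lipschitz_h: "\<And>h h' y. h \<in> simplex_prod blk \<Longrightarrow> h' \<in> simplex_prod blk \<Longrightarrow>
          spectral_norm (ghh h y - ghh h' y) \<le> \<rho>h * norm (h - h')"
    and ghh_lipschitz_y: "\<And>h y y'. h \<in> simplex_prod blk \<Longrightarrow>
          spectral_norm (ghh h y - ghh h y') \<le> \<rho>y * norm (y - y')"
begin

abbreviation H where "H \<equiv> simplex_prod blk"

lemma gh_norm_diff_le:
  assumes "h \<in> H" "h' \<in> H"
  shows "norm (gh h y - gh h' y) \<le> Lg * norm (h - h')"
  using lipschitz_onD[OF gh_lipschitz assms] by (simp add: dist_norm)

lemma gh_linearize_h:
  assumes "h \<in> H" "h' \<in> H"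
  shows "norm (gh h' y - gh h y - ghh h y *v (h' - h)) \<le> \<rho>h * (norm (h' - h))\<^sup>2"
  using assms pos norm_diff_mult_le[OF ghh_lipschitz_h]
  by (intro linearization_quadratic_error[OF convex_simplex_prod _ _ gh_deriv_h]) auto

lemma gh_linearize_y:
  assumes "h \<in> H"
  shows "norm (gh h y' - gh h y - ghy h y *v (y' - y)) \<le> \<tau>y * (norm (y' - y))\<^sup>2"
  using assms pos norm_diff_mult_le[OF ghy_lipschitz_y] gh_deriv_y
  by (intro linearization_quadratic_error[where S = UNIV and \<phi> = "\<lambda>y. gh h y"]) auto

lemma gh_norm_diff_y_le:
  assumes "h \<in> H"
  shows "norm (gh h y' - gh h y) \<le> \<Lambda>g * norm (y' - y)"
proof (rule differentiable_bound[where S = UNIV and f = "\<lambda>y. gh h y"])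
  show "onorm ((*v) (ghy h x)) \<le> \<Lambda>g" for x
    using ghy_bound[OF assms] by (simp add: spectral_norm_def)
qed (use gh_deriv_y[OF assms] in auto)

lemma gh_monotone:
  assumes "h \<in> H" "h' \<in> H"
  shows "0 \<le> (gh h y - gh h' y) \<bullet> (h - h')"
proof -
  have "g h y + gh h y \<bullet> (h' - h) \<le> g h' y" "g h' y + gh h' y \<bullet> (h - h') \<le> g h y"
    using convex_on_above_tangent_within[OF g_convex _ _ g_deriv] assms by auto
  then show ?thesis by (simp add: inner_diff_left inner_diff_right)
qed

text \<open>The Hessian is positive semidefinite on tangent vectors, at points with all entries positive.
  A negative value would contradict the monotonicity of \<open>gh\<close> on a short segment.\<close>

lemma ghh_psd:
  assumes h: "h \<in> H" "\<And>j. \<delta> \<le> h $ j" and \<delta>: "0 < \<delta>" and v: "v \<in> tangent blk"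
  shows "0 \<le> v \<bullet> (ghh h y *v v)"
proof (rule ccontr)
  define e where "e = - (v \<bullet> (ghh h y *v v))"
  assume "\<not> 0 \<le> v \<bullet> (ghh h y *v v)"
  then have e: "0 < e" by (simp add: e_def)
  then have nv: "0 < norm v" by (auto simp: e_def)
  \<comment> \<open>The first bound keeps \<open>h + t v\<close> in the product of simplices, the second keeps the Taylor
    remainder below \<open>t\<^sup>2 * e / 2\<close>.\<close>
  define t where "t = min (\<delta> / norm v) (e / (2 * \<rho>h * norm v ^ 3))"
  have t: "0 < t" using \<delta> nv e pos by (simp add: t_def)
  have "t * norm v \<le> \<delta> / norm v * norm v" unfolding t_def using nv by (intro mult_right_mono) auto
  then have tv: "norm (t *\<^sub>R v) \<le> \<delta>" using nv t by simp
  define h' where "h' = h + t *\<^sub>R v"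
  have h': "h' \<in> H" unfolding h'_def
    using simplex_prod_move_tangent[OF h tangent_scaleR[OF v] tv] .
  let ?r = "gh h' y - gh h y - ghh h y *v (t *\<^sub>R v)"
  have r: "norm ?r \<le> \<rho>h * (t * norm v)\<^sup>2"
    using gh_linearize_h[OF h(1) h', of y] t by (simp add: h'_def)
  have "0 \<le> (gh h' y - gh h y) \<bullet> (t *\<^sub>R v)"
    using gh_monotone[OF h' h(1), of y] by (simp add: h'_def)
  also have "\<dots> = ?r \<bullet> (t *\<^sub>R v) - t\<^sup>2 * e"
    by (simp add: e_def inner_diff_left inner_diff_right matrix_vector_mult_scaleR power2_eq_square
        inner_commute algebra_simps)
  also have "?r \<bullet> (t *\<^sub>R v) \<le> norm ?r * norm (t *\<^sub>R v)" by (rule norm_cauchy_schwarz)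
  also have "\<dots> \<le> \<rho>h * (t * norm v)\<^sup>2 * (t * norm v)" using r t pos by (intro mult_mono) auto
  also have "\<dots> = t\<^sup>2 * (t * (\<rho>h * norm v ^ 3))" by (simp add: power2_eq_square power3_eq_cube)
  also have "t * (\<rho>h * norm v ^ 3) \<le> e / (2 * \<rho>h * norm v ^ 3) * (\<rho>h * norm v ^ 3)"
    unfolding t_def using pos nv by (intro mult_right_mono) auto
  also have "\<dots> = e / 2" using pos nv by simp
  finally have "0 \<le> t\<^sup>2 * (e / 2) - t\<^sup>2 * e" using t by (simp add: mult_left_mono)
  moreover have "t\<^sup>2 * e > 0" using t e by simp
  ultimately show False by linarith
qed

text \<open>A first-order stationary point of the regularized problem in the relative interior.\<close>

definition stationary :: "real^'u \<Rightarrow> real^'n \<Rightarrow> bool" where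
  "stationary y h \<longleftrightarrow> h \<in> H \<and> (\<forall>j. 0 < h $ j) \<and> g_reg_grad gh \<eta> h y \<in> block_const blk"

text \<open>Stationarity says that \<open>h\<close> is the blockwise softmax of \<open>- gh h y / \<eta>\<close>, so Brouwer's fixed
  point theorem yields a stationary point without any boundary analysis of the entropy.\<close>

lemma stationary_exists: "\<exists>h. stationary y h"
proof -
  let ?one = "(\<chi> j. 1) :: real^'n"
  define T where "T h = exp_step blk ?one ((1 / \<eta>) *\<^sub>R gh h y)" for h
  have T: "T h \<in> H" "0 < T h $ j" for h j
    unfolding T_def using exp_step_simplex[OF surj, of ?one] exp_step_pos[of ?one] by auto
  have "continuous_on H (\<lambda>h. gh h y)" using gh_lipschitz by (rule lipschitz_on_continuous_on)
  then have "continuous_on H (\<lambda>h. exp (- ((1 / \<eta>) *\<^sub>R gh h y) $ j))" for j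
    by (intro continuous_intros)
  moreover have "(\<Sum>l | blk l = blk j. exp (- ((1 / \<eta>) *\<^sub>R gh h y) $ l)) \<noteq> 0" for j h
    using exp_step_normalizer_pos[of ?one "(1 / \<eta>) *\<^sub>R gh h y" blk j] by simp
  ultimately have cont: "continuous_on H T"
    unfolding T_def exp_step_def
    by (intro continuous_on_vec_lambda) (simp, intro continuous_on_divide continuous_on_sum ballI, auto)
  obtain h where h: "h \<in> H" "T h = h"
    using brouwer[OF compact_simplex_prod convex_simplex_prod simplex_prod_nonempty[OF surj] cont] T(1)
    by blast
  define Z where "Z i = (\<Sum>l | blk l = i. exp (- (((1 / \<eta>) *\<^sub>R gh h y) $ l)))" for i
  have ln: "ln (h $ j) = - (gh h y $ j) / \<eta> - ln (Z (blk j))" for j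
    using ln_exp_step[of ?one blk "(1 / \<eta>) *\<^sub>R gh h y" j] h(2) by (simp add: T_def Z_def)
  have "g_reg_grad gh \<eta> h y $ j = - \<eta> * ln (Z (blk j))" for j
    using eta by (simp add: g_reg_grad_eq ln algebra_simps)
  then have "g_reg_grad gh \<eta> h y \<in> block_const blk" by (simp add: block_const_def)
  then show ?thesis unfolding stationary_def using h T(2)[of h] by auto
qed

text \<open>By convexity of \<open>g\<close>, a stationary point is the unique minimizer over the whole product of
  simplices, boundary included.\<close>

lemma stationary_quadratic_growth:
  assumes st: "stationary y h" and a: "a \<in> H"
  shows "g_reg g \<eta> h y + \<eta> / 4 * (norm (a - h))\<^sup>2 \<le> g_reg g \<eta> a y"
proof -
  have h: "h \<in> H" "\<And>j. 0 < h $ j" using st by (auto simp: stationary_def)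
  have "g_reg_grad gh \<eta> h y \<in> block_const blk" using st by (simp add: stationary_def)
  then have "g_reg_grad gh \<eta> h y \<bullet> (a - h) = 0"
    using tangent_block_const_inner[OF simplex_prod_diff_tangent[OF a h(1)]]
    by (metis inner_commute)
  then have "gh h y \<bullet> (a - h) = - \<eta> * (ln_vec h \<bullet> (a - h))"
    by (simp add: g_reg_grad_eq inner_add_left)
  moreover have "g h y + gh h y \<bullet> (a - h) \<le> g a y"
    using convex_on_above_tangent_within[OF g_convex h(1) a g_deriv[OF h(1)]] .
  moreover have "\<eta> * ((norm (a - h))\<^sup>2 / 4) \<le> \<eta> * kl a h"
    using kl_ge_norm_square[OF a h] eta by (intro mult_left_mono) auto
  ultimately show ?thesis
    unfolding g_reg_def entropy_bregman[OF a h(1)] by (simp add: algebra_simps)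
qed

lemma h_star_stationary: "stationary y (h_star blk g \<eta> y)"
proof -
  obtain h where st: "stationary y h" using stationary_exists by blast
  have "h_star blk g \<eta> y = h" unfolding h_star_def
  proof (rule the_equality)
    show "is_arg_min (\<lambda>h. g_reg g \<eta> h y) (\<lambda>h. h \<in> H) h"
      unfolding is_arg_min_def
    proof (intro conjI notI)
      show "h \<in> H" using st by (simp add: stationary_def)
      assume "\<exists>a. a \<in> H \<and> g_reg g \<eta> a y < g_reg g \<eta> h y"
      then obtain a where a: "a \<in> H" "g_reg g \<eta> a y < g_reg g \<eta> h y" by blast
      moreover have "0 \<le> \<eta> / 4 * (norm (a - h))\<^sup>2" using eta by simp
      ultimately show False using stationary_quadratic_growth[OF st a(1)] by linarith
    qed
    fix a assume "is_arg_min (\<lambda>h. g_reg g \<eta> h y) (\<lambda>h. h \<in> H) a"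
    then have a: "a \<in> H" "g_reg g \<eta> a y \<le> g_reg g \<eta> h y"
      using st by (auto simp: is_arg_min_def stationary_def not_less)
    then have "\<eta> / 4 * (norm (a - h))\<^sup>2 \<le> 0"
      using stationary_quadratic_growth[OF st a(1)] by linarith
    then show "a = h" using eta by (simp add: mult_le_0_iff)
  qed
  then show ?thesis using st by simp
qed

abbreviation hs where "hs \<equiv> h_star blk g \<eta>"

lemma hs_in_H: "hs y \<in> H" and hs_pos: "0 < hs y $ j"
  and hs_grad: "g_reg_grad gh \<eta> (hs y) y \<in> block_const blk"
  using h_star_stationary[of y] by (auto simp: stationary_def)

section \<open>The invariant region\<close>

text \<open>The ratio \<open>Q\<close> is large enough for the balanced region to contain the admissible starting
  points and the solutions, and to be invariant under the inner iteration. The number \<open>\<delta>\<close> is a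
  lower bound for all entries of its points.\<close>

definition "Q = 1 / nu_min blk \<eta> \<Omega>g"

definition "\<delta> = 1 / (Q * real CARD('n))"

lemma ln_Q_ge: "2 * \<Omega>g / \<eta> \<le> ln Q" and Q_pos: "0 < Q" and Q_ge_1: "1 \<le> Q"
proof -
  have "block_dim blk i \<ge> 1" for i
  proof -
    obtain j where "blk j = i" using surj by (metis surjD)
    then have "{j. blk j = i} \<noteq> {}" by blast
    then show ?thesis unfolding block_dim_def by (simp add: Suc_le_eq card_gt_0_iff)
  qed
  moreover have "max_block_dim blk \<in> range (block_dim blk)"
    unfolding max_block_dim_def by (intro Max_in) auto
  ultimately have m: "1 \<le> max_block_dim blk" by auto
  have Qeq: "Q = real (max_block_dim blk) * exp (2 * \<Omega>g / \<eta>)"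
    unfolding Q_def nu_min_def by (simp add: exp_minus field_simps)
  show Q: "0 < Q" using m unfolding Qeq by simp
  have "exp (2 * \<Omega>g / \<eta>) \<le> Q"
    unfolding Qeq using m mult_right_mono[of 1 "real (max_block_dim blk)" "exp (2 * \<Omega>g / \<eta>)"] by simp
  then show *: "2 * \<Omega>g / \<eta> \<le> ln Q" using Q by (simp add: ln_ge_iff)
  have "0 \<le> 2 * \<Omega>g / \<eta>" using pos eta by simp
  with * have "0 \<le> ln Q" by linarith
  then show "1 \<le> Q" using Q by simp
qed

lemma delta_pos: "0 < \<delta>" and delta_le_1: "\<delta> \<le> 1"
proof -
  have "1 * 1 \<le> Q * real CARD('n)"
    using Q_ge_1 by (intro mult_mono) (auto simp: Suc_le_eq)
  then show "0 < \<delta>" "\<delta> \<le> 1" using Q_pos by (auto simp: \<delta>_def)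
qed

lemma balanced_ge_delta: "h \<in> balanced blk Q \<Longrightarrow> \<delta> \<le> h $ j"
  unfolding \<delta>_def by (rule balanced_ge[OF _ Q_pos])

lemma trunc_subset_balanced: "trunc_simplex_prod blk \<eta> \<Omega>g \<subseteq> balanced blk Q"
  unfolding Q_def using Q_pos by (intro trunc_simplex_prod_balanced) (simp add: Q_def)

lemma gh_component_diff_le:
  assumes "h \<in> H"
  shows "gh h y $ j - gh h y $ l \<le> 2 * \<Omega>g"
  using component_le_norm_cart[of "gh h y" j] component_le_norm_cart[of "gh h y" l]
    gh_bound[OF assms, of y] by linarith

lemma hs_balanced: "hs y \<in> balanced blk Q"
proof -
  have "ln (hs y $ j) - ln (hs y $ l) \<le> ln Q" if jl: "blk j = blk l" for j l
  proof -
    have "g_reg_grad gh \<eta> (hs y) y $ j = g_reg_grad gh \<eta> (hs y) y $ l"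
      using hs_grad[of y] jl unfolding block_const_def by blast
    then have "\<eta> * (ln (hs y $ j) - ln (hs y $ l)) \<le> 2 * \<Omega>g"
      using gh_component_diff_le[OF hs_in_H, of y y l j]
      by (simp add: g_reg_grad_eq right_diff_distrib)
    then have "ln (hs y $ j) - ln (hs y $ l) \<le> 2 * \<Omega>g / \<eta>"
      using eta by (simp add: pos_le_divide_eq mult.commute)
    then show ?thesis using ln_Q_ge by linarith
  qed
  then show ?thesis using hs_in_H hs_pos by (simp add: balanced_def)
qed

text \<open>In logarithmic coordinates an update averages \<open>ln h\<close> with \<open>- gh h y / \<eta>\<close>, with weights
  \<open>1 - \<alpha> * \<eta>\<close> and \<open>\<alpha> * \<eta>\<close>.\<close>

lemma md_step_balanced:
  assumes h: "h \<in> balanced blk Q" and \<alpha>: "0 \<le> \<alpha>" "\<alpha> * \<eta> \<le> 1"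
  shows "md_step blk gh \<eta> \<alpha> y h \<in> balanced blk Q"
proof -
  have hH: "h \<in> H" "\<And>j. 0 < h $ j" using h by (auto simp: balanced_def)
  let ?h' = "md_step blk gh \<eta> \<alpha> y h"
  have "ln (?h' $ j) - ln (?h' $ l) \<le> ln Q" if jl: "blk j = blk l" for j l
  proof -
    have "ln (?h' $ j) - ln (?h' $ l)
        = (1 - \<alpha> * \<eta>) * (ln (h $ j) - ln (h $ l)) + \<alpha> * (gh h y $ l - gh h y $ j)"
      unfolding md_step_eq_exp_step ln_exp_step[OF hH(2)] jl
      by (simp add: g_reg_grad_eq algebra_simps)
    also have "(1 - \<alpha> * \<eta>) * (ln (h $ j) - ln (h $ l)) \<le> (1 - \<alpha> * \<eta>) * ln Q"
      using h jl \<alpha> by (intro mult_left_mono) (auto simp: balanced_def)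
    also have "\<alpha> * (gh h y $ l - gh h y $ j) \<le> \<alpha> * (\<eta> * (2 * \<Omega>g / \<eta>))"
      using gh_component_diff_le[OF hH(1)] \<alpha> eta by (intro mult_left_mono) auto
    also have "\<dots> \<le> \<alpha> * (\<eta> * ln Q)"
      using ln_Q_ge \<alpha> eta by (intro mult_left_mono) auto
    finally show ?thesis by (simp add: algebra_simps)
  qed
  then show ?thesis
    unfolding balanced_def md_step_eq_exp_step
    using exp_step_simplex[OF surj hH(2)] exp_step_pos[OF hH(2), where blk = blk] by simp
qed

lemma md_iter_balanced:
  assumes "h \<in> balanced blk Q" "0 \<le> \<alpha>" "\<alpha> * \<eta> \<le> 1"
  shows "md_iter blk gh \<eta> \<alpha> y h t \<in> balanced blk Q"
  using assms by (induction t) (auto intro: md_step_balanced)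

section \<open>Linear convergence of the inner iteration\<close>

text \<open>A Lipschitz constant of the regularized gradient on the balanced region.\<close>

definition "L\<^sub>\<Delta> = Lg + \<eta> / \<delta>"

text \<open>The admissible inner step sizes. The bound on \<open>\<alpha> * \<eta>\<close> makes the balanced region invariant,
  the two bounds with \<open>L\<^sub>\<Delta>\<close> give the contraction of the divergence, and the last one gives the
  contraction of the differentiated iteration; \<open>\<alpha> \<le> 1\<close> is a normalization.\<close>

definition small_step :: "real \<Rightarrow> bool" where
  "small_step \<alpha> \<longleftrightarrow> 0 < \<alpha> \<and> \<alpha> \<le> 1 \<and> \<alpha> * \<eta> \<le> 1 \<and> \<alpha> * (L\<^sub>\<Delta> * real CARD('n)) \<le> 1/2
     \<and> \<alpha> * (16 * L\<^sub>\<Delta>\<^sup>2) \<le> \<eta> \<and> \<alpha> * (\<eta>\<^sup>2 + Lg\<^sup>2) \<le> \<eta>"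

lemma L\<^sub>\<Delta>_pos: "0 < L\<^sub>\<Delta>"
  unfolding L\<^sub>\<Delta>_def using pos eta delta_pos by (simp add: add_pos_pos)

lemma small_step_exists: "\<exists>\<alpha>max > 0. \<forall>\<alpha>. 0 < \<alpha> \<and> \<alpha> \<le> \<alpha>max \<longrightarrow> small_step \<alpha>"
proof -
  define m where "m = Min {1, 1 / \<eta>, 1 / (2 * (L\<^sub>\<Delta> * real CARD('n))), \<eta> / (16 * L\<^sub>\<Delta>\<^sup>2), \<eta> / (\<eta>\<^sup>2 + Lg\<^sup>2)}"
  have p: "0 < L\<^sub>\<Delta> * real CARD('n)" "0 < 16 * L\<^sub>\<Delta>\<^sup>2" "0 < \<eta>\<^sup>2 + Lg\<^sup>2"
    using L\<^sub>\<Delta>_pos eta by (auto simp: add_pos_nonneg)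
  have "m > 0" unfolding m_def using p eta by simp
  moreover have "small_step \<alpha>" if "0 < \<alpha>" "\<alpha> \<le> m" for \<alpha>
    using that p eta unfolding small_step_def m_def by (simp add: pos_le_divide_eq) 
  ultimately show ?thesis by blast
qed

lemma g_reg_grad_norm_diff_le:
  assumes "h \<in> balanced blk Q" "h' \<in> balanced blk Q"
  shows "norm (g_reg_grad gh \<eta> h y - g_reg_grad gh \<eta> h' y) \<le> L\<^sub>\<Delta> * norm (h - h')"
proof -
  have "norm (ln_vec h - ln_vec h') \<le> (1 / \<delta>) * norm (h - h')"
    using ln_Lipschitz[OF delta_pos] balanced_ge_delta[OF assms(1)] balanced_ge_delta[OF assms(2)]
      delta_pos by (intro norm_le_componentwise_mult) auto
  then have "\<eta> * norm (ln_vec h - ln_vec h') \<le> \<eta> * ((1 / \<delta>) * norm (h - h'))"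
    using eta by (intro mult_left_mono) auto
  moreover have "norm (gh h y - gh h' y) \<le> Lg * norm (h - h')"
    using assms by (intro gh_norm_diff_le) (auto simp: balanced_def)
  moreover have "g_reg_grad gh \<eta> h y - g_reg_grad gh \<eta> h' y
      = (gh h y - gh h' y) + \<eta> *\<^sub>R (ln_vec h - ln_vec h')"
    by (simp add: g_reg_grad_eq algebra_simps)
  moreover have "norm ((gh h y - gh h' y) + \<eta> *\<^sub>R (ln_vec h - ln_vec h'))
      \<le> norm (gh h y - gh h' y) + \<eta> * norm (ln_vec h - ln_vec h')"
    using norm_triangle_ineq[of "gh h y - gh h' y" "\<eta> *\<^sub>R (ln_vec h - ln_vec h')"] eta by simp
  ultimately show ?thesis unfolding L\<^sub>\<Delta>_def by (simp add: distrib_right)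
qed

text \<open>Since the gradient at \<open>hs y\<close> is constant on blocks, it may be subtracted from the exponents.
  The inner product of the remaining difference with \<open>h - hs y\<close> is at least
  \<open>\<eta> * (kl (hs y) h + kl h (hs y))\<close> because \<open>gh\<close> is monotone.\<close>

lemma kl_md_step_le:
  assumes h: "h \<in> balanced blk Q" and \<alpha>: "small_step \<alpha>"
  shows "kl (hs y) (md_step blk gh \<eta> \<alpha> y h) \<le> (1 - \<alpha> * \<eta> / 2) * kl (hs y) h"
proof -
  have hH: "h \<in> H" "\<And>j. 0 < h $ j" using h by (auto simp: balanced_def)
  have a: "0 < \<alpha>" "\<alpha> * (L\<^sub>\<Delta> * real CARD('n)) \<le> 1/2" "\<alpha> * (16 * L\<^sub>\<Delta>\<^sup>2) \<le> \<eta>"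
    using \<alpha> by (auto simp: small_step_def)
  define \<Delta> where "\<Delta> = g_reg_grad gh \<eta> h y - g_reg_grad gh \<eta> (hs y) y"
  have \<Delta>: "norm \<Delta> \<le> L\<^sub>\<Delta> * norm (h - hs y)"
    unfolding \<Delta>_def using g_reg_grad_norm_diff_le[OF h hs_balanced] .
  have step: "md_step blk gh \<eta> \<alpha> y h = exp_step blk h (\<alpha> *\<^sub>R \<Delta>)"
    unfolding md_step_eq_exp_step \<Delta>_def scaleR_diff_right
    by (simp add: exp_step_diff_block_const block_const_scaleR hs_grad)
  have small: "\<bar>(\<alpha> *\<^sub>R \<Delta>) $ j\<bar> \<le> 1/2" for j
  proof -
    have "\<bar>(\<alpha> *\<^sub>R \<Delta>) $ j\<bar> \<le> \<alpha> * norm \<Delta>"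
      using component_le_norm_cart[of \<Delta> j] a by (simp add: abs_mult)
    also have "\<dots> \<le> \<alpha> * (L\<^sub>\<Delta> * real CARD('n))"
    proof (intro mult_left_mono)
      show "norm \<Delta> \<le> L\<^sub>\<Delta> * real CARD('n)"
        using \<Delta> mult_left_mono[OF simplex_prod_norm_diff_le[OF hH(1) hs_in_H[of y]], of L\<^sub>\<Delta>] L\<^sub>\<Delta>_pos
        by linarith
    qed (use a in auto)
    finally show ?thesis using a by linarith
  qed
  have k: "kl (hs y) (exp_step blk h (\<alpha> *\<^sub>R \<Delta>))
      \<le> kl (hs y) h - \<alpha> * ((h - hs y) \<bullet> \<Delta>) + 2 * (\<alpha> * norm \<Delta>)\<^sup>2"
    using kl_exp_step_le[OF hs_in_H hH small] a by (simp add: power_mult_distrib)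
  have sq: "(norm (h - hs y))\<^sup>2 \<le> 4 * kl (hs y) h"
    using kl_ge_norm_square[OF hs_in_H hH, of y] by (simp add: norm_minus_commute)
  have kl0: "0 \<le> kl (hs y) h" using kl_nonneg[OF hs_in_H hH] .
  have "\<eta> * kl (hs y) h \<le> \<eta> * (kl h (hs y) + kl (hs y) h)"
    using kl_nonneg[OF hH(1) hs_in_H hs_pos] eta by (intro mult_left_mono) auto
  also have "\<dots> = \<eta> * ((ln_vec h - ln_vec (hs y)) \<bullet> (h - hs y))" by (simp add: kl_symmetrized)
  also have "\<dots> \<le> (h - hs y) \<bullet> \<Delta>"
    using gh_monotone[OF hH(1) hs_in_H, of y y]
    by (simp add: \<Delta>_def g_reg_grad_eq inner_diff_left inner_diff_right inner_add_left
        inner_add_right inner_commute algebra_simps)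
  finally have "\<alpha> * (\<eta> * kl (hs y) h) \<le> \<alpha> * ((h - hs y) \<bullet> \<Delta>)"
    using a by (intro mult_left_mono) auto
  moreover have "2 * (\<alpha> * norm \<Delta>)\<^sup>2 \<le> \<alpha> * \<eta> / 2 * kl (hs y) h"
  proof -
    have "(\<alpha> * norm \<Delta>)\<^sup>2 \<le> (\<alpha> * (L\<^sub>\<Delta> * norm (h - hs y)))\<^sup>2"
      using \<Delta> a by (intro power_mono mult_left_mono) auto
    also have "\<dots> = \<alpha>\<^sup>2 * L\<^sub>\<Delta>\<^sup>2 * (norm (h - hs y))\<^sup>2" by (simp add: power_mult_distrib)
    also have "\<dots> \<le> \<alpha>\<^sup>2 * L\<^sub>\<Delta>\<^sup>2 * (4 * kl (hs y) h)" using sq by (intro mult_left_mono) auto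
    finally have "2 * (\<alpha> * norm \<Delta>)\<^sup>2 \<le> \<alpha> / 2 * (\<alpha> * (16 * L\<^sub>\<Delta>\<^sup>2)) * kl (hs y) h"
      by (simp add: power2_eq_square algebra_simps)
    also have "\<dots> \<le> \<alpha> / 2 * \<eta> * kl (hs y) h"
      using a kl0 by (intro mult_right_mono mult_left_mono) auto
    finally show ?thesis by simp
  qed
  ultimately show ?thesis using k unfolding step by (simp add: algebra_simps)
qed

text \<open>The prefactor of the linear convergence, from a bound on the initial divergence that is uniform
  over the balanced region.\<close>

definition "C0 = 2 * sqrt (real CARD('n) * ln (1 / \<delta>))"

lemma C0_nonneg: "0 \<le> C0"
  unfolding C0_def using delta_pos delta_le_1 by simp

lemma md_iter_convergence:
  assumes h: "h \<in> balanced blk Q" and \<alpha>: "small_step \<alpha>"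
  shows "norm (md_iter blk gh \<eta> \<alpha> y h t - hs y) \<le> C0 * (1 - \<alpha> * \<eta> / 4) ^ t"
proof -
  let ?h = "md_iter blk gh \<eta> \<alpha> y h" and ?q = "1 - \<alpha> * \<eta> / 4"
  have a: "0 < \<alpha>" "\<alpha> * \<eta> \<le> 1" using \<alpha> by (auto simp: small_step_def)
  have bal: "?h t \<in> balanced blk Q" for t using md_iter_balanced[OF h] a by simp
  have H: "?h t \<in> H" "0 < ?h t $ j" for t j using bal[of t] by (auto simp: balanced_def)
  have q: "0 \<le> ?q" using a by simp
  have "kl (hs y) (?h t) \<le> (?q\<^sup>2) ^ t * (real CARD('n) * ln (1 / \<delta>))" for t
  proof (induction t)
    case 0
    have "kl (hs y) h \<le> (\<Sum>j\<in>(UNIV::'n set). ln (1 / \<delta>))"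
      unfolding kl_def
    proof (rule sum_mono)
      fix j
      have h0: "0 < h $ j" "\<delta> \<le> h $ j" using H(2)[of 0] balanced_ge_delta[OF h] by auto
      have "ln (hs y $ j) \<le> 0" using hs_pos simplex_prod_le_1[OF hs_in_H] by simp
      moreover have "ln \<delta> \<le> ln (h $ j)" using h0 delta_pos by simp
      ultimately have "ln (hs y $ j) - ln (h $ j) \<le> ln (1 / \<delta>)"
        using delta_pos by (simp add: ln_div)
      moreover have "0 \<le> ln (1 / \<delta>)" using delta_pos delta_le_1 by simp
      ultimately show "hs y $ j * (ln (hs y $ j) - ln (h $ j)) \<le> ln (1 / \<delta>)"
        using hs_pos[of y j] simplex_prod_le_1[OF hs_in_H, of y j]
          mult_left_mono[of "ln (hs y $ j) - ln (h $ j)" "ln (1 / \<delta>)" "hs y $ j"]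
          mult_right_mono[of "hs y $ j" 1 "ln (1 / \<delta>)"] by linarith
    qed
    then show ?case by simp
  next
    case (Suc t)
    have "kl (hs y) (?h (Suc t)) \<le> (1 - \<alpha> * \<eta> / 2) * kl (hs y) (?h t)"
      using kl_md_step_le[OF bal \<alpha>] by simp
    also have "\<dots> \<le> ?q\<^sup>2 * kl (hs y) (?h t)"
      using kl_nonneg[OF hs_in_H H] a eta
      by (intro mult_right_mono) (auto simp: power2_eq_square algebra_simps)
    also have "\<dots> \<le> ?q\<^sup>2 * ((?q\<^sup>2) ^ t * (real CARD('n) * ln (1 / \<delta>)))"
      using Suc by (intro mult_left_mono) auto
    finally show ?case by (simp add: mult_ac)
  qed
  from this[of t] have "(norm (?h t - hs y))\<^sup>2 \<le> 4 * ((?q\<^sup>2) ^ t * (real CARD('n) * ln (1 / \<delta>)))"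
    using kl_ge_norm_square[OF hs_in_H H, of y t] by (simp add: norm_minus_commute)
  also have "\<dots> = (C0 * ?q ^ t)\<^sup>2"
  proof -
    have "0 \<le> ln (1 / \<delta>)" using delta_pos delta_le_1 by simp
    then have "C0\<^sup>2 = 4 * (real CARD('n) * ln (1 / \<delta>))" by (simp add: C0_def power_mult_distrib)
    moreover have "(?q\<^sup>2) ^ t = (?q ^ t)\<^sup>2"
      unfolding power_mult[symmetric] mult.commute[of t 2] ..
    ultimately show ?thesis unfolding power_mult_distrib by simp
  qed
  finally show ?thesis
    by (rule power2_le_imp_le) (intro mult_nonneg_nonneg C0_nonneg zero_le_power q)
qed

section \<open>Sensitivity of the lower-level solution\<close>

lemma balancedD:
  assumes "h \<in> balanced blk Q"
  shows "h \<in> H" "0 < h $ j"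
  using assms by (auto simp: balanced_def)

text \<open>The linearized stationarity condition, tested against \<open>u\<close> itself. It yields the
  bound, the differentiability statement and the Lipschitz continuity of the Jacobian below.\<close>

lemma linearized_system_bound:
  assumes h: "h \<in> balanced blk Q" and u: "u \<in> tangent blk"
    and eq: "\<eta> *\<^sub>R entropy_hess h u + ghh h y *v u + e \<in> block_const blk"
  shows "norm u \<le> norm e / \<eta>"
proof -
  note hH = balancedD[OF h]
  have "0 = u \<bullet> (\<eta> *\<^sub>R entropy_hess h u + ghh h y *v u + e)"
    using tangent_block_const_inner[OF u eq] by simp
  also have "\<dots> = \<eta> * (u \<bullet> entropy_hess h u) + u \<bullet> (ghh h y *v u) + u \<bullet> e"
    by (simp add: inner_add_right)
  finally have *: "0 = \<eta> * (u \<bullet> entropy_hess h u) + u \<bullet> (ghh h y *v u) + u \<bullet> e" .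
  have "\<eta> * (norm u)\<^sup>2 \<le> \<eta> * (u \<bullet> entropy_hess h u)"
    using inner_entropy_hess_ge[OF hH] eta by (intro mult_left_mono) auto
  moreover have "0 \<le> u \<bullet> (ghh h y *v u)"
    by (rule ghh_psd[OF hH(1) balanced_ge_delta[OF h] delta_pos u])
  moreover have "- (u \<bullet> e) \<le> norm u * norm e"
    using Cauchy_Schwarz_ineq2[of u e] by linarith
  ultimately have "norm u * (\<eta> * norm u) \<le> norm u * norm e"
    using * by (simp add: power2_eq_square mult_ac)
  then have "\<eta> * norm u \<le> norm e"
    by (cases "u = 0") auto
  then show ?thesis using eta by (simp add: pos_le_divide_eq mult.commute)
qed

text \<open>The matrix \<open>R\<close> solves the linearized stationarity condition at the solution: its columns are
  tangent, and the condition holds up to a normal vector.\<close>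

definition is_sensitivity :: "real^'u \<Rightarrow> real^'u^'n \<Rightarrow> bool" where
  "is_sensitivity y R \<longleftrightarrow> (\<forall>w. R *v w \<in> tangent blk \<and>
     \<eta> *\<^sub>R entropy_hess (hs y) (R *v w) + ghh (hs y) y *v (R *v w) + ghy (hs y) y *v w \<in> block_const blk)"

text \<open>With \<open>B = B_mat blk (hs y)\<close>, the solution is \<open>- B (\<eta> I + ghh B)\<^sup>-\<^sup>1 ghy\<close>.\<close>

lemma sensitivity_exists: "\<exists>R. is_sensitivity y R"
proof -
  let ?h = "hs y" let ?B = "B_mat blk ?h" let ?G = "ghh ?h y" let ?Y = "ghy ?h y"
  define A where "A = \<eta> *\<^sub>R mat 1 + ?G ** ?B"
  have A: "A *v s = \<eta> *\<^sub>R s + ?G *v (?B *v s)" for s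
    by (simp add: A_def matrix_vector_mult_add_rdistrib matrix_vector_mul_assoc
        scaleR_matrix_vector_assoc[symmetric])
  have key: "\<eta> *\<^sub>R entropy_hess ?h (?B *v s) + ?G *v (?B *v s) - A *v s \<in> block_const blk" for s
  proof -
    have "\<eta> *\<^sub>R entropy_hess ?h (?B *v s) + ?G *v (?B *v s) - A *v s
        = \<eta> *\<^sub>R (entropy_hess ?h (?B *v s) - s)"
      by (simp add: A scaleR_diff_right)
    then show ?thesis using block_const_scaleR[OF entropy_hess_B_mat[OF hs_pos]] by simp
  qed
  have "s = 0" if s: "A *v s = 0" for s
  proof -
    have "norm (?B *v s) \<le> norm (0::real^'n) / \<eta>"
      using key[of s] s
      by (intro linearized_system_bound[OF hs_balanced B_mat_tangent[OF hs_in_H], of y y]) simp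
    then have "?B *v s = 0" by simp
    then show ?thesis using s eta by (simp add: A)
  qed
  then have "inj ((*v) A)"
    by (intro injI) (metis matrix_vector_mult_diff_distrib right_minus_eq)
  then obtain A' where "A' ** A = mat 1" using matrix_left_invertible_injective[of A] by blast
  then have A': "A ** A' = mat 1" by (simp add: matrix_left_right_inverse)
  define R where "R = ?B ** (A' ** (0 - ?Y))"
  have "is_sensitivity y R" unfolding is_sensitivity_def
  proof (intro allI conjI)
    fix w
    define s where "s = A' *v ((0 - ?Y) *v w)"
    have R: "R *v w = ?B *v s" by (simp add: R_def s_def flip: matrix_vector_mul_assoc)
    have "A *v (A' *v z) = z" for z by (simp add: matrix_vector_mul_assoc A')
    then have As: "A *v s = - (?Y *v w)"
      unfolding s_def by (simp add: matrix_vector_mult_diff_rdistrib del: diff_0)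
    show "R *v w \<in> tangent blk" unfolding R by (rule B_mat_tangent[OF hs_in_H])
    show "\<eta> *\<^sub>R entropy_hess ?h (R *v w) + ?G *v (R *v w) + ?Y *v w \<in> block_const blk"
      using key[of s] unfolding R As by simp
  qed
  then show ?thesis by blast
qed

text \<open>The Jacobian of the solution map; that it is the derivative is shown below.\<close>

definition Rs :: "real^'u \<Rightarrow> real^'u^'n" where
  "Rs y = (SOME R. is_sensitivity y R)"

lemma Rs_tangent: "Rs y *v w \<in> tangent blk"
  and Rs_system: "\<eta> *\<^sub>R entropy_hess (hs y) (Rs y *v w) + ghh (hs y) y *v (Rs y *v w)
      + ghy (hs y) y *v w \<in> block_const blk"
  using someI_ex[OF sensitivity_exists[of y]] unfolding Rs_def is_sensitivity_def by auto

text \<open>A common bound for the sensitivity and for the Lipschitz constant of the solution map.\<close>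

definition "\<kappa> = \<Lambda>g / \<eta>"

lemma kappa_pos: "0 < \<kappa>"
  unfolding \<kappa>_def using pos eta by simp

lemma Rs_norm_le: "norm (Rs y *v w) \<le> \<kappa> * norm w"
proof -
  have "norm (Rs y *v w) \<le> norm (ghy (hs y) y *v w) / \<eta>"
    using linearized_system_bound[OF hs_balanced Rs_tangent Rs_system] .
  also have "\<dots> \<le> \<Lambda>g * norm w / \<eta>"
    using norm_mult_spectral_norm_le[OF ghy_bound[OF hs_in_H]] eta by (intro divide_right_mono) auto
  finally show ?thesis by (simp add: \<kappa>_def)
qed

text \<open>The difference of the gradients at two solutions is normal, hence orthogonal to the difference
  of the solutions; the strong monotonicity of the logarithm does the rest.\<close>

lemma hs_norm_diff_le: "norm (hs y' - hs y) \<le> \<kappa> * norm (y' - y)"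
proof -
  let ?u = "hs y' - hs y" let ?c = "g_reg_grad gh \<eta> (hs y') y' - g_reg_grad gh \<eta> (hs y) y"
  have "0 = ?c \<bullet> ?u"
    using tangent_block_const_inner[OF simplex_prod_diff_tangent block_const_diff, OF hs_in_H hs_in_H hs_grad hs_grad]
    by (metis inner_commute)
  also have "?c = (gh (hs y') y' - gh (hs y) y') + (gh (hs y) y' - gh (hs y) y)
      + \<eta> *\<^sub>R (ln_vec (hs y') - ln_vec (hs y))"
    by (simp add: g_reg_grad_eq algebra_simps)
  also have "\<dots> \<bullet> ?u = (gh (hs y') y' - gh (hs y) y') \<bullet> ?u + (gh (hs y) y' - gh (hs y) y) \<bullet> ?u
      + \<eta> * ((ln_vec (hs y') - ln_vec (hs y)) \<bullet> ?u)"
    by (simp only: inner_add_left inner_scaleR_left)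
  finally have 0: "0 = \<dots>" .
  have 1: "0 \<le> (gh (hs y') y' - gh (hs y) y') \<bullet> ?u" by (rule gh_monotone[OF hs_in_H hs_in_H])
  have 2: "\<eta> * (norm ?u)\<^sup>2 \<le> \<eta> * ((ln_vec (hs y') - ln_vec (hs y)) \<bullet> ?u)"
    using ln_vec_strongly_monotone[OF hs_in_H hs_pos hs_in_H hs_pos] eta by (intro mult_left_mono) auto
  have "- ((gh (hs y) y' - gh (hs y) y) \<bullet> ?u) \<le> norm (gh (hs y) y' - gh (hs y) y) * norm ?u"
    using Cauchy_Schwarz_ineq2[of "gh (hs y) y' - gh (hs y) y" ?u] by linarith
  also have "\<dots> \<le> \<Lambda>g * norm (y' - y) * norm ?u"
    using gh_norm_diff_y_le[OF hs_in_H] by (intro mult_right_mono) auto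
  finally have "\<eta> * (norm ?u)\<^sup>2 \<le> \<Lambda>g * norm (y' - y) * norm ?u" using 0 1 2 by linarith
  then have "norm ?u * (\<eta> * norm ?u) \<le> norm ?u * (\<Lambda>g * norm (y' - y))"
    by (simp add: power2_eq_square mult_ac)
  then have "\<eta> * norm ?u \<le> \<Lambda>g * norm (y' - y)"
  proof (cases "norm ?u = 0")
    case True
    then show ?thesis using pos by simp
  next
    case False
    then have "0 < norm ?u" by simp
    then show ?thesis using \<open>norm ?u * _ \<le> _\<close> mult_le_cancel_left_pos by blast
  qed
  then show ?thesis unfolding \<kappa>_def using eta by (simp add: pos_le_divide_eq mult.commute)
qed

lemma ln_vec_linearize:
  assumes "h \<in> balanced blk Q" "h' \<in> balanced blk Q"
  shows "norm (ln_vec h' - ln_vec h - entropy_hess h (h' - h))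
    \<le> real CARD('n) / \<delta>\<^sup>2 * (norm (h' - h))\<^sup>2"
proof -
  have "\<bar>(ln_vec h' - ln_vec h - entropy_hess h (h' - h)) $ j\<bar> \<le> (norm (h' - h))\<^sup>2 / \<delta>\<^sup>2" for j
  proof -
    have "\<bar>(ln_vec h' - ln_vec h - entropy_hess h (h' - h)) $ j\<bar> \<le> (h' $ j - h $ j)\<^sup>2 / \<delta>\<^sup>2"
      using ln_second_order[OF delta_pos balanced_ge_delta[OF assms(1)] balanced_ge_delta[OF assms(2)]]
      by simp
    also have "(h' $ j - h $ j)\<^sup>2 \<le> (norm (h' - h))\<^sup>2"
      using component_le_norm_cart[of "h' - h" j] by (simp add: abs_le_square_iff[symmetric])
    finally show ?thesis by (simp add: divide_right_mono)
  qed
  from norm_le_card_times[OF this] show ?thesis by simp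
qed

definition "C\<^sub>1 = (\<eta> * (real CARD('n) / \<delta>\<^sup>2 * \<kappa>\<^sup>2) + \<tau>y + \<tau>h * \<kappa> + \<rho>h * \<kappa>\<^sup>2) / \<eta>"

text \<open>Subtracting the linearized system from the difference of the two stationarity conditions
  leaves the linearized system for the error, whose right-hand side is quadratically small.\<close>

lemma hs_linearize:
  "norm (hs y' - hs y - Rs y *v (y' - y)) \<le> C\<^sub>1 * (norm (y' - y))\<^sup>2"
proof -
  define h h' w \<Delta> v where "h = hs y" and "h' = hs y'" and "w = y' - y" and "\<Delta> = h' - h"
    and "v = Rs y *v w"
  note defs = h_def h'_def w_def \<Delta>_def v_def
  have b: "h \<in> balanced blk Q" "h' \<in> balanced blk Q" by (auto simp: defs hs_balanced)
  have H: "h \<in> H" "h' \<in> H" by (auto simp: defs hs_in_H)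
  have \<Delta>: "norm \<Delta> \<le> \<kappa> * norm w" using hs_norm_diff_le by (simp add: defs)
  have \<Delta>2: "(norm \<Delta>)\<^sup>2 \<le> \<kappa>\<^sup>2 * (norm w)\<^sup>2"
    using power_mono[OF \<Delta>, of 2] by (simp add: power_mult_distrib)
  define e1 e2 e3 e4 where "e1 = ln_vec h' - ln_vec h - entropy_hess h \<Delta>"
    and "e2 = gh h' y' - gh h' y - ghy h' y *v w"
    and "e3 = ghy h' y *v w - ghy h y *v w"
    and "e4 = gh h' y - gh h y - ghh h y *v \<Delta>"
  define e where "e = \<eta> *\<^sub>R e1 + e2 + e3 + e4"
  have "(g_reg_grad gh \<eta> h' y' - g_reg_grad gh \<eta> h y)
      - (\<eta> *\<^sub>R entropy_hess h v + ghh h y *v v + ghy h y *v w) \<in> block_const blk"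
    unfolding defs by (intro block_const_diff hs_grad Rs_system)
  also have "(g_reg_grad gh \<eta> h' y' - g_reg_grad gh \<eta> h y)
      - (\<eta> *\<^sub>R entropy_hess h v + ghh h y *v v + ghy h y *v w)
      = \<eta> *\<^sub>R entropy_hess h (\<Delta> - v) + ghh h y *v (\<Delta> - v) + e"
    unfolding e_def e1_def e2_def e3_def e4_def g_reg_grad_eq entropy_hess_diff
      matrix_vector_mult_diff_distrib
    by (simp add: algebra_simps)
  finally have "norm (\<Delta> - v) \<le> norm e / \<eta>"
    using Rs_tangent simplex_prod_diff_tangent[OF hs_in_H hs_in_H]
    by (intro linearized_system_bound[OF b(1), of _ y]) (auto simp: defs)
  also have "norm e \<le> \<eta> * norm e1 + norm e2 + norm e3 + norm e4"
    unfolding e_def using norm_triangle_ineq[of "\<eta> *\<^sub>R e1" e2]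
      norm_triangle_ineq[of "\<eta> *\<^sub>R e1 + e2" e3] norm_triangle_ineq[of "\<eta> *\<^sub>R e1 + e2 + e3" e4] eta
    by simp
  also have "\<dots> \<le> \<eta> * (real CARD('n) / \<delta>\<^sup>2 * (\<kappa>\<^sup>2 * (norm w)\<^sup>2)) + \<tau>y * (norm w)\<^sup>2
      + \<tau>h * (\<kappa> * norm w) * norm w + \<rho>h * (\<kappa>\<^sup>2 * (norm w)\<^sup>2)"
  proof (intro add_mono mult_left_mono)
    have "norm e1 \<le> real CARD('n) / \<delta>\<^sup>2 * (norm \<Delta>)\<^sup>2"
      unfolding e1_def \<Delta>_def by (rule ln_vec_linearize[OF b])
    also have "\<dots> \<le> real CARD('n) / \<delta>\<^sup>2 * (\<kappa>\<^sup>2 * (norm w)\<^sup>2)"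
      using \<Delta>2 by (intro mult_left_mono) auto
    finally show "norm e1 \<le> real CARD('n) / \<delta>\<^sup>2 * (\<kappa>\<^sup>2 * (norm w)\<^sup>2)" .
    show "norm e2 \<le> \<tau>y * (norm w)\<^sup>2" unfolding e2_def w_def by (rule gh_linearize_y[OF H(2)])
    have "norm e3 \<le> \<tau>h * norm \<Delta> * norm w"
      unfolding e3_def \<Delta>_def by (rule norm_diff_mult_le[OF ghy_lipschitz_h[OF H(2,1)]])
    also have "\<dots> \<le> \<tau>h * (\<kappa> * norm w) * norm w"
      using \<Delta> pos by (intro mult_right_mono mult_left_mono) auto
    finally show "norm e3 \<le> \<tau>h * (\<kappa> * norm w) * norm w" .
    have "norm e4 \<le> \<rho>h * (norm \<Delta>)\<^sup>2" unfolding e4_def \<Delta>_def by (rule gh_linearize_h[OF H])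
    also have "\<dots> \<le> \<rho>h * (\<kappa>\<^sup>2 * (norm w)\<^sup>2)" using \<Delta>2 pos by (intro mult_left_mono) auto
    finally show "norm e4 \<le> \<rho>h * (\<kappa>\<^sup>2 * (norm w)\<^sup>2)" .
  qed (use eta in auto)
  also have "\<dots> = (\<eta> * (real CARD('n) / \<delta>\<^sup>2 * \<kappa>\<^sup>2) + \<tau>y + \<tau>h * \<kappa> + \<rho>h * \<kappa>\<^sup>2) * (norm w)\<^sup>2"
    by (simp add: algebra_simps power2_eq_square)
  finally show ?thesis using eta unfolding C\<^sub>1_def defs by (simp add: divide_right_mono)
qed

lemma hs_has_derivative: "(hs has_derivative (*v) (Rs y)) (at y)"
  by (rule has_derivative_if_quadratic_error[OF matrix_vector_mul_bounded_linear hs_linearize])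

lemma R_star_eq: "R_star blk UNIV g \<eta> y = Rs y"
  unfolding R_star_def jacobian_def frechet_derivative_at[OF hs_has_derivative, symmetric]
  by (rule matrix_of_matrix_vector_mul)

text \<open>A Lipschitz constant of the Jacobian of the solution map.\<close>

definition "C\<^sub>2 = (\<eta> * (\<kappa> / \<delta>\<^sup>2 * \<kappa>) + (\<rho>h * \<kappa> + \<rho>y) * \<kappa> + (\<tau>h * \<kappa> + \<tau>y)) / \<eta>"

lemma C\<^sub>2_nonneg: "0 \<le> C\<^sub>2"
  unfolding C\<^sub>2_def using pos eta kappa_pos delta_pos by (intro divide_nonneg_pos add_nonneg_nonneg mult_nonneg_nonneg) auto

text \<open>The difference of two linearized systems is again a linearized system, whose right-hand side
  is controlled by the Lipschitz continuity of the second derivatives.\<close>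

lemma Rs_lipschitz:
  "norm (Rs y *v w - Rs y' *v w) \<le> C\<^sub>2 * norm (y - y') * norm w"
proof -
  define h h' d \<Delta> r r' where "h = hs y" and "h' = hs y'" and "d = norm (y - y')"
    and "\<Delta> = norm (h - h')" and "r = Rs y *v w" and "r' = Rs y' *v w"
  note defs = h_def h'_def d_def \<Delta>_def r_def r'_def
  have b: "h \<in> balanced blk Q" "h' \<in> balanced blk Q" by (auto simp: defs hs_balanced)
  have H: "h \<in> H" "h' \<in> H" by (auto simp: defs hs_in_H)
  have \<Delta>: "\<Delta> \<le> \<kappa> * d" using hs_norm_diff_le[of y y'] by (simp add: defs)
  have r': "norm r' \<le> \<kappa> * norm w" unfolding defs by (rule Rs_norm_le)
  have nn: "0 \<le> d" "0 \<le> \<Delta>" by (auto simp: defs)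
  define e1 e2 e3 where "e1 = entropy_hess h r' - entropy_hess h' r'"
    and "e2 = ghh h y *v r' - ghh h' y' *v r'" and "e3 = ghy h y *v w - ghy h' y' *v w"
  have "(\<eta> *\<^sub>R entropy_hess h r + ghh h y *v r + ghy h y *v w)
      - (\<eta> *\<^sub>R entropy_hess h' r' + ghh h' y' *v r' + ghy h' y' *v w) \<in> block_const blk"
    unfolding defs by (intro block_const_diff Rs_system)
  also have "(\<eta> *\<^sub>R entropy_hess h r + ghh h y *v r + ghy h y *v w)
      - (\<eta> *\<^sub>R entropy_hess h' r' + ghh h' y' *v r' + ghy h' y' *v w)
      = \<eta> *\<^sub>R entropy_hess h (r - r') + ghh h y *v (r - r') + (\<eta> *\<^sub>R e1 + e2 + e3)"
    unfolding e1_def e2_def e3_def entropy_hess_diff matrix_vector_mult_diff_distrib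
    by (simp add: algebra_simps)
  finally have "norm (r - r') \<le> norm (\<eta> *\<^sub>R e1 + e2 + e3) / \<eta>"
    using Rs_tangent by (intro linearized_system_bound[OF b(1), of _ y]) (auto simp: defs)
  also have "norm (\<eta> *\<^sub>R e1 + e2 + e3) \<le> \<eta> * norm e1 + norm e2 + norm e3"
    using norm_triangle_ineq[of "\<eta> *\<^sub>R e1" e2] norm_triangle_ineq[of "\<eta> *\<^sub>R e1 + e2" e3] eta by simp
  also have "\<dots> \<le> \<eta> * (\<kappa> * d * (\<kappa> * norm w) / \<delta>\<^sup>2) + (\<rho>h * (\<kappa> * d) + \<rho>y * d) * (\<kappa> * norm w)
      + (\<tau>h * (\<kappa> * d) + \<tau>y * d) * norm w"
  proof (intro add_mono mult_left_mono)
    have "norm e1 \<le> \<Delta> * norm r' / \<delta>\<^sup>2" unfolding e1_def \<Delta>_def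
      by (rule norm_entropy_hess_diff_le[OF delta_pos balanced_ge_delta[OF b(1)] balanced_ge_delta[OF b(2)]])
    also have "\<dots> \<le> \<kappa> * d * (\<kappa> * norm w) / \<delta>\<^sup>2"
      using \<Delta> r' nn kappa_pos by (intro divide_right_mono mult_mono) auto
    finally show "norm e1 \<le> \<kappa> * d * (\<kappa> * norm w) / \<delta>\<^sup>2" .
    have "norm e2 \<le> norm (ghh h y *v r' - ghh h' y *v r') + norm (ghh h' y *v r' - ghh h' y' *v r')"
      unfolding e2_def using norm_triangle_ineq[of "ghh h y *v r' - ghh h' y *v r'" "ghh h' y *v r' - ghh h' y' *v r'"]
      by simp
    also have "\<dots> \<le> \<rho>h * \<Delta> * norm r' + \<rho>y * d * norm r'" unfolding defs
      by (intro add_mono norm_diff_mult_le ghh_lipschitz_h ghh_lipschitz_y hs_in_H)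
    also have "\<dots> = (\<rho>h * \<Delta> + \<rho>y * d) * norm r'" by (simp add: distrib_right)
    also have "\<dots> \<le> (\<rho>h * (\<kappa> * d) + \<rho>y * d) * (\<kappa> * norm w)"
      using \<Delta> r' nn kappa_pos pos by (intro mult_mono add_mono mult_left_mono) auto
    finally show "norm e2 \<le> (\<rho>h * (\<kappa> * d) + \<rho>y * d) * (\<kappa> * norm w)" .
    have "norm e3 \<le> norm (ghy h y *v w - ghy h' y *v w) + norm (ghy h' y *v w - ghy h' y' *v w)"
      unfolding e3_def using norm_triangle_ineq[of "ghy h y *v w - ghy h' y *v w" "ghy h' y *v w - ghy h' y' *v w"]
      by simp
    also have "\<dots> \<le> \<tau>h * \<Delta> * norm w + \<tau>y * d * norm w" unfolding defs
      by (intro add_mono norm_diff_mult_le ghy_lipschitz_h ghy_lipschitz_y hs_in_H)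
    also have "\<dots> = (\<tau>h * \<Delta> + \<tau>y * d) * norm w" by (simp add: distrib_right)
    also have "\<dots> \<le> (\<tau>h * (\<kappa> * d) + \<tau>y * d) * norm w"
      using \<Delta> pos by (intro mult_right_mono add_mono mult_left_mono) auto
    finally show "norm e3 \<le> (\<tau>h * (\<kappa> * d) + \<tau>y * d) * norm w" .
  qed (use eta in auto)
  also have "\<dots> = (\<eta> * (\<kappa> / \<delta>\<^sup>2 * \<kappa>) + (\<rho>h * \<kappa> + \<rho>y) * \<kappa> + (\<tau>h * \<kappa> + \<tau>y)) * d * norm w"
    by (simp add: algebra_simps)
  finally show ?thesis using eta unfolding C\<^sub>2_def defs by (simp add: divide_right_mono)
qed

section \<open>Linear convergence of the differentiated iteration\<close>

text \<open>The differentiated update, applied to one direction \<open>w\<close>: here \<open>r\<close> stands for the image of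
  \<open>w\<close> under the current Jacobian, and \<open>h\<close>, \<open>h'\<close> for the current and the next inner iterate.\<close>

definition jac_step :: "real \<Rightarrow> real^'u \<Rightarrow> real^'u \<Rightarrow> real^'n \<Rightarrow> real^'n \<Rightarrow> real^'n \<Rightarrow> real^'n" where
  "jac_step \<alpha> y w h h' r = B_mat blk h' *v
     ((1 - \<eta> * \<alpha>) *\<^sub>R entropy_hess h r - \<alpha> *\<^sub>R (ghh h y *v r + ghy h y *v w))"

lemma R_iter_Suc_mult:
  "R_iter blk gh ghh ghy \<eta> \<alpha> y h (Suc t) *v w
    = jac_step \<alpha> y w (md_iter blk gh \<eta> \<alpha> y h t) (md_iter blk gh \<eta> \<alpha> y h (Suc t))
        (R_iter blk gh ghh ghy \<eta> \<alpha> y h t *v w)"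
  unfolding jac_step_def R_iter.simps M_mat_def U_mat_def entropy_hess_def
  by (simp add: matrix_vector_mult_add_rdistrib matrix_vector_mult_diff_rdistrib
      matrix_vector_mul_assoc[symmetric] scaleR_matrix_vector_assoc[symmetric]
      matrix_vector_mult_diff_distrib matrix_vector_mult_scaleR scaleR_add_right
      matrix_vector_right_distrib del: md_iter.simps)

lemma R_iter_tangent:
  assumes "h \<in> balanced blk Q" "0 \<le> \<alpha>" "\<alpha> * \<eta> \<le> 1"
  shows "R_iter blk gh ghh ghy \<eta> \<alpha> y h t *v w \<in> tangent blk"
proof (cases t)
  case (Suc t')
  show ?thesis unfolding Suc R_iter_Suc_mult jac_step_def
    by (rule B_mat_tangent[OF balancedD(1)[OF md_iter_balanced[OF assms]]])
qed simp

lemma jac_step_fixed_point: "jac_step \<alpha> y w (hs y) (hs y) (Rs y *v w) = Rs y *v w"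
proof -
  let ?r = "Rs y *v w" let ?D = "entropy_hess (hs y)"
  let ?c = "\<eta> *\<^sub>R ?D ?r + ghh (hs y) y *v ?r + ghy (hs y) y *v w"
  have "(1 - \<eta> * \<alpha>) *\<^sub>R ?D ?r - \<alpha> *\<^sub>R (ghh (hs y) y *v ?r + ghy (hs y) y *v w) = ?D ?r - \<alpha> *\<^sub>R ?c"
    by (simp add: algebra_simps)
  then show ?thesis
    unfolding jac_step_def
    by (simp add: matrix_vector_mult_diff_distrib matrix_vector_mult_scaleR
        B_mat_block_const[OF hs_in_H Rs_system] B_mat_entropy_hess[OF hs_pos Rs_tangent])
qed

text \<open>At the exact solution the differentiated update is affine with fixed point \<open>Rs y *v w\<close>; its
  linear part is a gradient step for the Hessian, and a contraction in the entropy metric.\<close>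

lemma jac_step_contraction:
  assumes \<alpha>: "small_step \<alpha>" and r: "r \<in> tangent blk"
  shows "entropy_norm (hs y) (jac_step \<alpha> y w (hs y) (hs y) r - Rs y *v w)
    \<le> (1 - \<alpha> * \<eta> / 4) * entropy_norm (hs y) (r - Rs y *v w)"
proof -
  have a: "0 < \<alpha>" "\<alpha> * \<eta> \<le> 1" "\<alpha> * (\<eta>\<^sup>2 + Lg\<^sup>2) \<le> \<eta>"
    using \<alpha> by (auto simp: small_step_def)
  define u where "u = r - Rs y *v w"
  have u: "u \<in> tangent blk" unfolding u_def by (intro tangent_diff r Rs_tangent)
  let ?x = "ghh (hs y) y *v u"
  have "jac_step \<alpha> y w (hs y) (hs y) r - Rs y *v w
      = jac_step \<alpha> y w (hs y) (hs y) r - jac_step \<alpha> y w (hs y) (hs y) (Rs y *v w)"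
    by (simp only: jac_step_fixed_point)
  also have "\<dots> = B_mat blk (hs y) *v ((1 - \<eta> * \<alpha>) *\<^sub>R entropy_hess (hs y) u - \<alpha> *\<^sub>R ?x)"
    unfolding jac_step_def matrix_vector_mult_diff_distrib[symmetric] u_def entropy_hess_diff
    by (simp add: matrix_vector_mult_diff_distrib algebra_simps)
  also have "\<dots> = (1 - \<eta> * \<alpha>) *\<^sub>R u - \<alpha> *\<^sub>R (B_mat blk (hs y) *v ?x)"
    by (simp add: matrix_vector_mult_diff_distrib matrix_vector_mult_scaleR
        B_mat_entropy_hess[OF hs_pos u])
  finally have eq: "jac_step \<alpha> y w (hs y) (hs y) r - Rs y *v w
      = (1 - \<eta> * \<alpha>) *\<^sub>R u - \<alpha> *\<^sub>R (B_mat blk (hs y) *v ?x)" .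
  have "(entropy_norm (hs y) ((1 - \<eta> * \<alpha>) *\<^sub>R u - \<alpha> *\<^sub>R (B_mat blk (hs y) *v ?x)))\<^sup>2
      \<le> ((1 - \<eta> * \<alpha>)\<^sup>2 + \<alpha>\<^sup>2 * Lg\<^sup>2) * (entropy_norm (hs y) u)\<^sup>2"
  proof (rule entropy_norm_gradient_step[OF hs_in_H hs_pos u])
    show "0 \<le> u \<bullet> ?x"
      by (rule ghh_psd[OF hs_in_H balanced_ge_delta[OF hs_balanced] delta_pos u])
    show "norm ?x \<le> Lg * norm u" by (rule norm_mult_spectral_norm_le[OF ghh_bound[OF hs_in_H]])
  qed (use a in \<open>auto simp: mult.commute\<close>)
  also have "(1 - \<eta> * \<alpha>)\<^sup>2 + \<alpha>\<^sup>2 * Lg\<^sup>2 \<le> (1 - \<alpha> * \<eta> / 4)\<^sup>2"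
  proof -
    have "\<alpha> * (\<alpha> * (\<eta>\<^sup>2 + Lg\<^sup>2)) \<le> \<alpha> * \<eta>" using a by (intro mult_left_mono) auto
    then have "(1 - \<eta> * \<alpha>)\<^sup>2 + \<alpha>\<^sup>2 * Lg\<^sup>2 \<le> 1 - \<alpha> * \<eta>"
      by (simp add: power2_eq_square algebra_simps)
    also have "\<dots> \<le> (1 - \<alpha> * \<eta> / 4)\<^sup>2"
    proof -
      have "0 \<le> (\<alpha> * \<eta> / 4)\<^sup>2" "0 < \<alpha> * \<eta>" using a eta by auto
      moreover have "(1 - \<alpha> * \<eta> / 4)\<^sup>2 = 1 - \<alpha> * \<eta> / 2 + (\<alpha> * \<eta> / 4)\<^sup>2"
        unfolding power2_diff by simp
      ultimately show ?thesis by linarith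
    qed
    finally show ?thesis .
  qed
  then have "((1 - \<eta> * \<alpha>)\<^sup>2 + \<alpha>\<^sup>2 * Lg\<^sup>2) * (entropy_norm (hs y) u)\<^sup>2
      \<le> (1 - \<alpha> * \<eta> / 4)\<^sup>2 * (entropy_norm (hs y) u)\<^sup>2" by (intro mult_right_mono) auto
  finally have "(entropy_norm (hs y) ((1 - \<eta> * \<alpha>) *\<^sub>R u - \<alpha> *\<^sub>R (B_mat blk (hs y) *v ?x)))\<^sup>2
      \<le> ((1 - \<alpha> * \<eta> / 4) * entropy_norm (hs y) u)\<^sup>2" by (simp add: power_mult_distrib)
  then have "entropy_norm (hs y) ((1 - \<eta> * \<alpha>) *\<^sub>R u - \<alpha> *\<^sub>R (B_mat blk (hs y) *v ?x))
      \<le> (1 - \<alpha> * \<eta> / 4) * entropy_norm (hs y) u"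
    by (rule power2_le_imp_le) (use a in simp)
  then show ?thesis unfolding eq u_def .
qed

definition "C\<^sub>3 = real CARD('n) * (2 * real CARD('n) + 1) * (1 / \<delta> + Lg + \<Lambda>g) + (1 / \<delta>\<^sup>2 + \<rho>h + \<tau>h)"

lemma C\<^sub>3_nonneg: "0 \<le> C\<^sub>3"
  unfolding C\<^sub>3_def using pos delta_pos by (intro add_nonneg_nonneg mult_nonneg_nonneg) auto

text \<open>Along the inner iteration the differentiated update is taken at points near, but not at, the
  exact solution.\<close>

lemma jac_step_perturbation:
  assumes h: "h \<in> balanced blk Q" "h' \<in> balanced blk Q"
    and \<epsilon>: "norm (h - hs y) \<le> \<epsilon>" "norm (h' - hs y) \<le> \<epsilon>"
    and \<alpha>: "0 \<le> \<alpha>" "\<alpha> \<le> 1" "\<alpha> * \<eta> \<le> 1"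
  shows "norm (jac_step \<alpha> y w h h' r - jac_step \<alpha> y w (hs y) (hs y) r) \<le> C\<^sub>3 * \<epsilon> * (norm r + norm w)"
proof -
  let ?D = entropy_hess and ?s = "hs y" and ?m = "norm r + norm w"
  have \<epsilon>0: "0 \<le> \<epsilon>" using \<epsilon>(1) norm_ge_zero order_trans by blast
  define x where "x h = (1 - \<eta> * \<alpha>) *\<^sub>R ?D h r - \<alpha> *\<^sub>R (ghh h y *v r + ghy h y *v w)" for h
  have one: "norm ((1 - \<eta> * \<alpha>) *\<^sub>R p - \<alpha> *\<^sub>R (a + b)) \<le> norm p + norm a + norm b" for p a b :: "real^'n"
  proof -
    have "norm ((1 - \<eta> * \<alpha>) *\<^sub>R p - \<alpha> *\<^sub>R (a + b)) \<le> norm ((1 - \<eta> * \<alpha>) *\<^sub>R p) + norm (\<alpha> *\<^sub>R (a + b))"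
      by (rule norm_triangle_ineq4)
    also have "\<dots> \<le> 1 * norm p + 1 * norm (a + b)"
      unfolding norm_scaleR using \<alpha> eta
      by (intro add_mono mult_right_mono) (auto simp: mult.commute)
    also have "\<dots> \<le> norm p + norm a + norm b" using norm_triangle_ineq[of a b] by simp
    finally show ?thesis .
  qed
  have "norm (x h) \<le> norm (?D h r) + norm (ghh h y *v r) + norm (ghy h y *v w)"
    unfolding x_def by (rule one)
  also have "\<dots> \<le> norm r / \<delta> + Lg * norm r + \<Lambda>g * norm w"
    using balancedD(1)[OF h(1)]
    by (intro add_mono norm_entropy_hess_le[OF delta_pos balanced_ge_delta[OF h(1)]]
        norm_mult_spectral_norm_le ghh_bound ghy_bound) auto
  also have "\<dots> \<le> (1 / \<delta>) * ?m + Lg * ?m + \<Lambda>g * ?m"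
    using pos delta_pos by (intro add_mono mult_left_mono) (auto simp: divide_right_mono)
  also have "\<dots> = (1 / \<delta> + Lg + \<Lambda>g) * ?m" by (simp only: distrib_right)
  finally have nx: "norm (x h) \<le> (1 / \<delta> + Lg + \<Lambda>g) * ?m" .
  have "x h - x ?s = (1 - \<eta> * \<alpha>) *\<^sub>R (?D h r - ?D ?s r)
      - \<alpha> *\<^sub>R ((ghh h y *v r - ghh ?s y *v r) + (ghy h y *v w - ghy ?s y *v w))"
    unfolding x_def by (simp add: algebra_simps)
  then have "norm (x h - x ?s) \<le> norm (?D h r - ?D ?s r) + norm (ghh h y *v r - ghh ?s y *v r)
      + norm (ghy h y *v w - ghy ?s y *v w)" using one by simp
  also have "\<dots> \<le> norm (h - ?s) * norm r / \<delta>\<^sup>2 + \<rho>h * norm (h - ?s) * norm r + \<tau>h * norm (h - ?s) * norm w"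
    using balancedD(1)[OF h(1)] hs_in_H
    by (intro add_mono norm_diff_mult_le ghh_lipschitz_h ghy_lipschitz_h
        norm_entropy_hess_diff_le[OF delta_pos balanced_ge_delta[OF h(1)] balanced_ge_delta[OF hs_balanced]]) auto
  also have "\<dots> \<le> \<epsilon> * ?m / \<delta>\<^sup>2 + \<rho>h * \<epsilon> * ?m + \<tau>h * \<epsilon> * ?m"
    using \<epsilon>(1) \<epsilon>0 pos by (intro add_mono divide_right_mono mult_mono) auto
  also have "\<dots> = (1 / \<delta>\<^sup>2 + \<rho>h + \<tau>h) * \<epsilon> * ?m" by (simp add: algebra_simps)
  finally have dx: "norm (x h - x ?s) \<le> (1 / \<delta>\<^sup>2 + \<rho>h + \<tau>h) * \<epsilon> * ?m" .
  have "norm (B_mat blk h' *v x h - B_mat blk ?s *v x h)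
      \<le> real CARD('n) * (2 * real CARD('n) + 1) * norm (h' - ?s) * norm (x h)"
    by (rule norm_B_mat_diff_le[OF balancedD(1)[OF h(2)] hs_in_H])
  also have "\<dots> \<le> real CARD('n) * (2 * real CARD('n) + 1) * \<epsilon> * ((1 / \<delta> + Lg + \<Lambda>g) * ?m)"
    using \<epsilon>(2) nx \<epsilon>0 by (intro mult_mono) auto
  finally have 1: "norm (B_mat blk h' *v x h - B_mat blk ?s *v x h)
      \<le> real CARD('n) * (2 * real CARD('n) + 1) * \<epsilon> * ((1 / \<delta> + Lg + \<Lambda>g) * ?m)" .
  have "norm (B_mat blk ?s *v (x h - x ?s)) \<le> norm (x h - x ?s)"
    using norm_le_entropy_norm[OF hs_in_H hs_pos] norm_B_mat_le[OF hs_in_H hs_pos] order_trans by blast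
  with dx have 2: "norm (B_mat blk ?s *v (x h - x ?s)) \<le> (1 / \<delta>\<^sup>2 + \<rho>h + \<tau>h) * \<epsilon> * ?m" by linarith
  have "jac_step \<alpha> y w h h' r - jac_step \<alpha> y w ?s ?s r
      = (B_mat blk h' *v x h - B_mat blk ?s *v x h) + B_mat blk ?s *v (x h - x ?s)"
    unfolding jac_step_def x_def[symmetric] by (simp add: matrix_vector_mult_diff_distrib)
  then have "norm (jac_step \<alpha> y w h h' r - jac_step \<alpha> y w ?s ?s r)
      \<le> norm (B_mat blk h' *v x h - B_mat blk ?s *v x h) + norm (B_mat blk ?s *v (x h - x ?s))"
    using norm_triangle_ineq by metis
  also have "\<dots> \<le> real CARD('n) * (2 * real CARD('n) + 1) * \<epsilon> * ((1 / \<delta> + Lg + \<Lambda>g) * ?m)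
      + (1 / \<delta>\<^sup>2 + \<rho>h + \<tau>h) * \<epsilon> * ?m" by (rule add_mono[OF 1 2])
  also have "\<dots> = C\<^sub>3 * \<epsilon> * ?m"
  proof -
    have "a * \<epsilon> * (b * m) + c * \<epsilon> * m = (a * b + c) * \<epsilon> * m" for a b c m :: real
      by (simp add: algebra_simps)
    then show ?thesis unfolding C\<^sub>3_def by blast
  qed
  finally show ?thesis .
qed

text \<open>The entropy-metric distance between the images of a direction under the current and the exact
  Jacobian is a perturbed contraction, because the inner iterates converge linearly. All constants
  are uniform in the starting point and in \<open>y\<close>.\<close>

lemma inner_loop_convergence:
  assumes \<alpha>: "small_step \<alpha>"
  obtains C p where "0 \<le> C" "0 < p" "p < 1"
    "\<And>h y t. h \<in> balanced blk Q \<Longrightarrow> norm (md_iter blk gh \<eta> \<alpha> y h t - hs y) \<le> C * p ^ t"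
    "\<And>h y t w. h \<in> balanced blk Q \<Longrightarrow>
       norm (R_iter blk gh ghh ghy \<eta> \<alpha> y h t *v w - Rs y *v w) \<le> C * p ^ t * norm w"
proof -
  have a: "0 < \<alpha>" "\<alpha> \<le> 1" "\<alpha> * \<eta> \<le> 1" using \<alpha> by (auto simp: small_step_def)
  define q where "q = 1 - \<alpha> * \<eta> / 4"
  have "0 < \<alpha> * \<eta>" using a eta by simp
  then have q: "0 < q" "q < 1" using a by (auto simp: q_def)
  define c where "c = C\<^sub>3 * C0 * (1 + \<kappa>) / sqrt \<delta>"
  have c: "0 \<le> c" unfolding c_def using C\<^sub>3_nonneg C0_nonneg kappa_pos delta_pos by simp
  have A: "0 \<le> \<kappa> / sqrt \<delta>" using kappa_pos delta_pos by simp
  obtain C where C: "0 \<le> C"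
    and rec: "\<And>a t. \<lbrakk>a 0 \<le> \<kappa> / sqrt \<delta>; \<And>t. 0 \<le> a t; \<And>t. a (Suc t) \<le> q * a t + c * q ^ t * (a t + 1)\<rbrakk>
        \<Longrightarrow> a t \<le> C * ((1 + q) / 2) ^ t"
    using perturbed_contraction_geometric[OF q c A] by blast
  define p where "p = (1 + q) / 2"
  have p: "0 < p" "p < 1" "q \<le> p" using q by (auto simp: p_def)
  have unit: "norm (R_iter blk gh ghh ghy \<eta> \<alpha> y h t *v w - Rs y *v w) \<le> C * p ^ t"
    if h: "h \<in> balanced blk Q" and w: "norm w \<le> 1" for h y t w
  proof -
    define r where "r t = R_iter blk gh ghh ghy \<eta> \<alpha> y h t *v w" for t
    define a' where "a' t = entropy_norm (hs y) (r t - Rs y *v w)" for t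
    have sd: "entropy_norm (hs y) v \<le> norm v / sqrt \<delta>" for v
      by (rule entropy_norm_le[OF delta_pos balanced_ge_delta[OF hs_balanced]])
    have ne: "norm v \<le> entropy_norm (hs y) v" for v
      by (rule norm_le_entropy_norm[OF hs_in_H hs_pos])
    have Rw: "norm (Rs y *v w) \<le> \<kappa>"
      using Rs_norm_le[of y w] mult_left_mono[OF w, of \<kappa>] kappa_pos by linarith
    have "a' t \<le> C * ((1 + q) / 2) ^ t"
    proof (rule rec)
      have "a' 0 = entropy_norm (hs y) (Rs y *v w)"
        using entropy_norm_minus[of "hs y" "Rs y *v w"] by (simp add: a'_def r_def)
      also have "\<dots> \<le> \<kappa> / sqrt \<delta>"
        using sd[of "Rs y *v w"] divide_right_mono[OF Rw, of "sqrt \<delta>"] delta_pos by simp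
      finally show "a' 0 \<le> \<kappa> / sqrt \<delta>" .
      show "0 \<le> a' t" for t by (simp add: a'_def)
      fix t
      let ?ht = "md_iter blk gh \<eta> \<alpha> y h t" and ?ht' = "md_iter blk gh \<eta> \<alpha> y h (Suc t)"
      let ?\<Phi> = "jac_step \<alpha> y w (hs y) (hs y) (r t)"
      have rS: "r (Suc t) = jac_step \<alpha> y w ?ht ?ht' (r t)" unfolding r_def by (rule R_iter_Suc_mult)
      have bal: "?ht \<in> balanced blk Q" "?ht' \<in> balanced blk Q"
        using md_iter_balanced[OF h] a by (auto simp del: md_iter.simps)
      have e1: "norm (?ht - hs y) \<le> C0 * q ^ t"
        unfolding q_def by (rule md_iter_convergence[OF h \<alpha>])
      have "norm (?ht' - hs y) \<le> C0 * q ^ Suc t"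
        unfolding q_def by (rule md_iter_convergence[OF h \<alpha>])
      also have "\<dots> \<le> C0 * q ^ t" using C0_nonneg q by (intro mult_left_mono power_decreasing) auto
      finally have e2: "norm (?ht' - hs y) \<le> C0 * q ^ t" .
      have rt: "norm (r t) + norm w \<le> (1 + \<kappa>) * (a' t + 1)"
      proof -
        have "norm (r t) \<le> norm (r t - Rs y *v w) + norm (Rs y *v w)"
          using norm_triangle_ineq[of "r t - Rs y *v w" "Rs y *v w"] by simp
        also have "\<dots> \<le> a' t + \<kappa>" unfolding a'_def using ne Rw by (intro add_mono) auto
        finally have "norm (r t) + norm w \<le> a' t + \<kappa> + 1" using w by linarith
        moreover have "0 \<le> \<kappa> * a' t" using kappa_pos by (simp add: a'_def)
        ultimately show ?thesis by (simp add: algebra_simps)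
      qed
      have "norm (r (Suc t) - ?\<Phi>) \<le> C\<^sub>3 * (C0 * q ^ t) * (norm (r t) + norm w)"
        unfolding rS using a by (intro jac_step_perturbation[OF bal e1 e2]) auto
      also have "\<dots> \<le> C\<^sub>3 * (C0 * q ^ t) * ((1 + \<kappa>) * (a' t + 1))"
        using rt C\<^sub>3_nonneg C0_nonneg q by (intro mult_left_mono) auto
      finally have "norm (r (Suc t) - ?\<Phi>) / sqrt \<delta> \<le> C\<^sub>3 * (C0 * q ^ t) * ((1 + \<kappa>) * (a' t + 1)) / sqrt \<delta>"
        using delta_pos by (intro divide_right_mono) auto
      also have "\<dots> = c * q ^ t * (a' t + 1)" by (simp add: c_def)
      finally have pert: "entropy_norm (hs y) (r (Suc t) - ?\<Phi>) \<le> c * q ^ t * (a' t + 1)"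
        using sd order_trans by blast
      have "a' (Suc t) = entropy_norm (hs y) ((?\<Phi> - Rs y *v w) + (r (Suc t) - ?\<Phi>))"
        by (simp add: a'_def)
      also have "\<dots> \<le> entropy_norm (hs y) (?\<Phi> - Rs y *v w) + entropy_norm (hs y) (r (Suc t) - ?\<Phi>)"
        by (rule entropy_norm_triangle)
      also have "\<dots> \<le> q * a' t + c * q ^ t * (a' t + 1)"
      proof (rule add_mono[OF _ pert])
        have "r t \<in> tangent blk" unfolding r_def using a by (intro R_iter_tangent[OF h]) auto
        then show "entropy_norm (hs y) (?\<Phi> - Rs y *v w) \<le> q * a' t"
          unfolding a'_def q_def by (rule jac_step_contraction[OF \<alpha>])
      qed
      finally show "a' (Suc t) \<le> q * a' t + c * q ^ t * (a' t + 1)" .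
    qed
    then show ?thesis using ne[of "r t - Rs y *v w"] unfolding a'_def r_def p_def by linarith
  qed
  show ?thesis
  proof
    show "0 \<le> C + C0" using C C0_nonneg by simp
    show "0 < p" "p < 1" using p by auto
    show "norm (md_iter blk gh \<eta> \<alpha> y h t - hs y) \<le> (C + C0) * p ^ t"
      if h: "h \<in> balanced blk Q" for h y t
    proof -
      have "norm (md_iter blk gh \<eta> \<alpha> y h t - hs y) \<le> C0 * q ^ t"
        unfolding q_def by (rule md_iter_convergence[OF h \<alpha>])
      also have "\<dots> \<le> (C + C0) * p ^ t"
        using C C0_nonneg p q by (intro mult_mono power_mono) auto
      finally show ?thesis .
    qed
    show "norm (R_iter blk gh ghh ghy \<eta> \<alpha> y h t *v w - Rs y *v w) \<le> (C + C0) * p ^ t * norm w"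
      if h: "h \<in> balanced blk Q" for h y t w
    proof (cases "w = 0")
      case False
      define v where "v = (1 / norm w) *\<^sub>R w"
      have v: "norm v \<le> 1" "w = norm w *\<^sub>R v" using False by (auto simp: v_def)
      let ?R = "R_iter blk gh ghh ghy \<eta> \<alpha> y h t"
      have "norm (?R *v w - Rs y *v w) = norm w * norm (?R *v v - Rs y *v v)"
        by (subst (1 2) v(2)) (simp add: matrix_vector_mult_scaleR flip: scaleR_diff_right)
      also have "\<dots> \<le> norm w * (C * p ^ t)" using unit[OF h v(1)] by (intro mult_left_mono) auto
      also have "\<dots> \<le> norm w * ((C + C0) * p ^ t)"
        using C0_nonneg p by (intro mult_left_mono mult_right_mono) auto
      finally show ?thesis by (simp add: mult_ac)
    qed simp
  qed
qed

end

section \<open>The exact objective and its gradient\<close>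

text \<open>The standing assumptions on the upper-level objective.\<close>

locale bilevel = lower_level blk g gh ghh ghy \<eta> Lg \<Omega>g \<Lambda>g \<tau>h \<tau>y \<rho>h \<rho>y
  for blk :: "'n::finite \<Rightarrow> 'p::finite"
    and g :: "real^'n \<Rightarrow> real^'u::finite \<Rightarrow> real"
    and gh ghh ghy \<eta> Lg \<Omega>g \<Lambda>g \<tau>h \<tau>y \<rho>h \<rho>y +
  fixes f :: "real^'n \<Rightarrow> real^'u \<Rightarrow> real"
    and fh :: "real^'n \<Rightarrow> real^'u \<Rightarrow> real^'n"
    and fy :: "real^'n \<Rightarrow> real^'u \<Rightarrow> real^'u"
    and Lf \<Omega>f :: real
  assumes pos_f: "0 < Lf" "0 < \<Omega>f"
    and f_deriv: "\<And>h y. h \<in> simplex_prod blk \<Longrightarrow>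
          ((\<lambda>(h, y). f h y) has_derivative (\<lambda>(v, w). fh h y \<bullet> v + fy h y \<bullet> w))
            (at (h, y) within simplex_prod blk \<times> UNIV)"
    and f_lipschitz: "Lf-lipschitz_on (simplex_prod blk \<times> UNIV) (\<lambda>(h, y). (fh h y, fy h y))"
    and f_bound: "\<And>h y. h \<in> simplex_prod blk \<Longrightarrow> norm (fh h y, fy h y) \<le> \<Omega>f"
    and F_bdd: "bdd_below (range (F_obj blk f g \<eta>))"
begin

abbreviation F where "F \<equiv> F_obj blk f g \<eta>"

text \<open>The gradient of the objective, with the Jacobian of the solution map written as \<open>Rs\<close>.\<close>

definition gradF :: "real^'u \<Rightarrow> real^'u" where
  "gradF y = fy (hs y) y + transpose (Rs y) *v fh (hs y) y"

lemma F_grad_eq: "F_grad blk UNIV fh fy g \<eta> y = gradF y"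
  by (simp add: F_grad_def gradF_def R_star_eq)

lemma fh_fy_norm_diff_le:
  assumes "h \<in> H" "h' \<in> H"
  shows "norm (fh h y - fh h' y') \<le> Lf * (norm (h - h') + norm (y - y'))"
    and "norm (fy h y - fy h' y') \<le> Lf * (norm (h - h') + norm (y - y'))"
proof -
  have "norm (fh h y - fh h' y', fy h y - fy h' y') \<le> Lf * norm (h - h', y - y')"
    using lipschitz_onD[OF f_lipschitz, of "(h, y)" "(h', y')"] assms by (simp add: dist_norm)
  also have "\<dots> \<le> Lf * (norm (h - h') + norm (y - y'))"
    using pos_f by (intro mult_left_mono norm_Pair_le) auto
  finally have *: "norm (fh h y - fh h' y', fy h y - fy h' y') \<le> Lf * (norm (h - h') + norm (y - y'))" .
  show "norm (fh h y - fh h' y') \<le> Lf * (norm (h - h') + norm (y - y'))"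
    using norm_fst_le[of "fh h y - fh h' y'" "fy h y - fy h' y'"] * by linarith
  show "norm (fy h y - fy h' y') \<le> Lf * (norm (h - h') + norm (y - y'))"
    using norm_snd_le[of "fy h y - fy h' y'" "fh h y - fh h' y'"] * by linarith
qed

lemma fh_norm_le: "h \<in> H \<Longrightarrow> norm (fh h y) \<le> \<Omega>f"
  using norm_fst_le[of "fh h y" "fy h y"] f_bound[of h y] by linarith

text \<open>The comparison of two hypergradient formulas of the form \<open>fy + R\<^sup>T fh\<close>, used both for the
  Lipschitz continuity of the exact gradient and for the error of the estimated one.\<close>

lemma hypergradient_diff_le:
  fixes R R' :: "real^'u^'n"
  assumes h: "h \<in> H" "h' \<in> H" and R': "\<And>w. norm (R' *v w) \<le> \<kappa> * norm w"
    and RR': "\<And>w. norm (R *v w - R' *v w) \<le> \<epsilon> * norm w"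
  shows "norm ((fy h y + transpose R *v fh h y) - (fy h' y' + transpose R' *v fh h' y'))
    \<le> (1 + \<kappa>) * Lf * (norm (h - h') + norm (y - y')) + \<epsilon> * \<Omega>f"
proof -
  let ?m = "norm (h - h') + norm (y - y')"
  have tr: "transpose (R - R') = transpose R - transpose R'" by (simp add: transpose_def vec_eq_iff)
  have 1: "norm (transpose (R - R') *v fh h y) \<le> \<epsilon> * norm (fh h y)"
    using RR' by (intro norm_transpose_mult_le) (simp add: matrix_vector_mult_diff_rdistrib)
  have "0 \<le> \<epsilon> * norm (axis undefined 1 :: real^'u)"
    using RR'[of "axis undefined 1"] norm_ge_zero order_trans by blast
  then have "0 \<le> \<epsilon>" by simp
  with 1 have 1: "norm (transpose (R - R') *v fh h y) \<le> \<epsilon> * \<Omega>f"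
    using mult_left_mono[OF fh_norm_le[OF h(1), of y]] by (meson order_trans)
  have "norm (transpose R' *v (fh h y - fh h' y')) \<le> \<kappa> * norm (fh h y - fh h' y')"
    by (rule norm_transpose_mult_le[OF R'])
  also have "\<dots> \<le> \<kappa> * (Lf * ?m)"
    using fh_fy_norm_diff_le(1)[OF h] kappa_pos by (intro mult_left_mono) auto
  finally have 2: "norm (transpose R' *v (fh h y - fh h' y')) \<le> \<kappa> * (Lf * ?m)" .
  have 3: "norm (fy h y - fy h' y') \<le> Lf * ?m" by (rule fh_fy_norm_diff_le(2)[OF h])
  have "(fy h y + transpose R *v fh h y) - (fy h' y' + transpose R' *v fh h' y')
      = (fy h y - fy h' y') + transpose R' *v (fh h y - fh h' y') + transpose (R - R') *v fh h y"
    unfolding tr matrix_vector_mult_diff_distrib matrix_vector_mult_diff_rdistrib by simp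
  also have "norm \<dots> \<le> norm (fy h y - fy h' y') + norm (transpose R' *v (fh h y - fh h' y'))
      + norm (transpose (R - R') *v fh h y)"
    by (meson add_right_mono norm_triangle_ineq order_trans)
  also have "\<dots> \<le> Lf * ?m + \<kappa> * (Lf * ?m) + \<epsilon> * \<Omega>f" by (intro add_mono 1 2 3)
  finally show ?thesis by (simp add: algebra_simps)
qed

lemma F_has_derivative: "(F has_derivative (\<lambda>w. gradF y \<bullet> w)) (at y)"
proof -
  have pair: "((\<lambda>y. (hs y, y)) has_derivative (\<lambda>w. (Rs y *v w, w))) (at y)"
    by (intro has_derivative_Pair hs_has_derivative has_derivative_ident)
  have "((\<lambda>(h, y). f h y) has_derivative (\<lambda>(v, w). fh (hs y) y \<bullet> v + fy (hs y) y \<bullet> w))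
      (at (hs y, y) within range (\<lambda>y. (hs y, y)))"
    by (rule has_derivative_subset[OF f_deriv[OF hs_in_H]]) (auto simp: hs_in_H)
  note has_derivative_in_compose[OF pair this]
  then have "(F has_derivative (\<lambda>w. fh (hs y) y \<bullet> (Rs y *v w) + fy (hs y) y \<bullet> w)) (at y)"
    unfolding F_obj_def by simp
  moreover have "fh (hs y) y \<bullet> (Rs y *v w) + fy (hs y) y \<bullet> w = gradF y \<bullet> w" for w
    by (simp add: gradF_def inner_add_left dot_lmul_matrix)
  ultimately show ?thesis by simp
qed

text \<open>A Lipschitz constant of the gradient of the objective. It does not involve the inner step
  size, so neither does the range of outer step sizes.\<close>

definition "L\<^sub>F = (1 + \<kappa>) * Lf * (\<kappa> + 1) + C\<^sub>2 * \<Omega>f"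

lemma L\<^sub>F_pos: "0 < L\<^sub>F"
  unfolding L\<^sub>F_def using kappa_pos pos_f C\<^sub>2_nonneg by (intro add_pos_nonneg) auto

lemma gradF_lipschitz: "norm (gradF y - gradF y') \<le> L\<^sub>F * norm (y - y')"
proof -
  have "norm (gradF y - gradF y')
      \<le> (1 + \<kappa>) * Lf * (norm (hs y - hs y') + norm (y - y')) + (C\<^sub>2 * norm (y - y')) * \<Omega>f"
    unfolding gradF_def by (intro hypergradient_diff_le hs_in_H Rs_norm_le Rs_lipschitz)
  also have "\<dots> \<le> (1 + \<kappa>) * Lf * (\<kappa> * norm (y - y') + norm (y - y')) + (C\<^sub>2 * norm (y - y')) * \<Omega>f"
    using hs_norm_diff_le kappa_pos pos_f by (intro add_right_mono mult_left_mono) auto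
  also have "\<dots> = L\<^sub>F * norm (y - y')" by (simp add: L\<^sub>F_def algebra_simps)
  finally show ?thesis .
qed

lemma F_descent: "F y' \<le> F y + gradF y \<bullet> (y' - y) + L\<^sub>F * (norm (y' - y))\<^sup>2"
proof -
  have "norm (F y' - F y - gradF y \<bullet> (y' - y)) \<le> L\<^sub>F * (norm (y' - y))\<^sup>2"
  proof (rule linearization_quadratic_error[where S = UNIV and \<phi>' = "\<lambda>y w. gradF y \<bullet> w"])
    show "norm (gradF x \<bullet> v - gradF y \<bullet> v) \<le> L\<^sub>F * norm (x - y) * norm v" for x v
    proof -
      have "norm (gradF x \<bullet> v - gradF y \<bullet> v) \<le> norm (gradF x - gradF y) * norm v"
        using Cauchy_Schwarz_ineq2[of "gradF x - gradF y" v] by (simp add: inner_diff_left)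
      also have "\<dots> \<le> L\<^sub>F * norm (x - y) * norm v"
        using gradF_lipschitz by (intro mult_right_mono) auto
      finally show ?thesis .
    qed
  qed (use F_has_derivative L\<^sub>F_pos in auto)
  then show ?thesis by (simp add: abs_le_iff)
qed

text \<open>For step sizes up to \<open>1 / (2 * L\<^sub>F)\<close> the second-order term of the descent inequality is
  absorbed by completing the square.\<close>

lemma inexact_gradient_step:
  assumes \<beta>: "0 < \<beta>" "\<beta> \<le> 1 / (2 * L\<^sub>F)"
  shows "(norm (gradF y))\<^sup>2 \<le> 2 / \<beta> * (F y - F (y - \<beta> *\<^sub>R d)) + (norm (d - gradF y))\<^sup>2"
proof -
  have "\<beta> * L\<^sub>F \<le> 1 / 2" using \<beta> L\<^sub>F_pos by (simp add: pos_le_divide_eq mult_ac)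
  then have "\<beta> * (norm d)\<^sup>2 * (\<beta> * L\<^sub>F) \<le> \<beta> * (norm d)\<^sup>2 * (1 / 2)"
    using \<beta> by (intro mult_left_mono) auto
  then have 1: "\<beta> * (\<beta> * L\<^sub>F) * (norm d)\<^sup>2 \<le> \<beta> * (norm d)\<^sup>2 / 2"
    by (simp add: mult_ac)
  have 2: "F (y - \<beta> *\<^sub>R d) \<le> F y - \<beta> * (gradF y \<bullet> d) + \<beta> * (\<beta> * L\<^sub>F) * (norm d)\<^sup>2"
    using F_descent[of "y - \<beta> *\<^sub>R d" y] by (simp add: power_mult_distrib power2_eq_square mult_ac)
  have 3: "\<beta> * (norm (d - gradF y))\<^sup>2
      = \<beta> * (norm d)\<^sup>2 - 2 * (\<beta> * (gradF y \<bullet> d)) + \<beta> * (norm (gradF y))\<^sup>2"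
    by (simp add: power2_norm_eq_inner inner_diff_left inner_diff_right inner_commute algebra_simps)
  have "\<beta> * (norm (gradF y))\<^sup>2 \<le> 2 * (F y - F (y - \<beta> *\<^sub>R d)) + \<beta> * (norm (d - gradF y))\<^sup>2"
  proof -
    have "gg \<le> 2 * (F0 - F1) + ee"
      if "x \<le> dd / 2" "F1 \<le> F0 - v + x" "ee = dd - 2 * v + gg" for x dd F0 F1 v ee gg :: real
      using that by simp
    from this[OF 1 2 3] show ?thesis .
  qed
  then have "(norm (gradF y))\<^sup>2 \<le> (2 * (F y - F (y - \<beta> *\<^sub>R d)) + \<beta> * (norm (d - gradF y))\<^sup>2) / \<beta>"
    using \<beta> by (simp add: pos_le_divide_eq mult.commute)
  then show ?thesis using \<beta> by (simp add: add_divide_distrib)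
qed

section \<open>Inexact gradient descent\<close>

abbreviation est where "est \<equiv> F_grad_est blk fh fy gh ghh ghy \<eta>"

lemma gradient_estimate_error:
  assumes \<alpha>: "small_step \<alpha>"
  obtains C p where "0 \<le> C" "0 < p" "p < 1"
    "\<And>D h y. h \<in> balanced blk Q \<Longrightarrow> norm (est \<alpha> D h y - gradF y) \<le> C * p ^ D"
proof -
  have a: "0 < \<alpha>" "\<alpha> * \<eta> \<le> 1" using \<alpha> by (auto simp: small_step_def)
  obtain C p where C: "0 \<le> C" and p: "0 < p" "p < 1"
    and hconv: "\<And>h y t. h \<in> balanced blk Q \<Longrightarrow> norm (md_iter blk gh \<eta> \<alpha> y h t - hs y) \<le> C * p ^ t"
    and Rconv: "\<And>h y t w. h \<in> balanced blk Q \<Longrightarrow>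
       norm (R_iter blk gh ghh ghy \<eta> \<alpha> y h t *v w - Rs y *v w) \<le> C * p ^ t * norm w"
    using inner_loop_convergence[OF \<alpha>] by metis
  show ?thesis
  proof
    show "0 \<le> (1 + \<kappa>) * Lf * C + C * \<Omega>f" using C kappa_pos pos_f by simp
    show "0 < p" "p < 1" using p by auto
    show "norm (est \<alpha> D h y - gradF y) \<le> ((1 + \<kappa>) * Lf * C + C * \<Omega>f) * p ^ D"
      if h: "h \<in> balanced blk Q" for D h y
    proof -
      let ?h = "md_iter blk gh \<eta> \<alpha> y h D"
      have "?h \<in> H" using md_iter_balanced[OF h, of \<alpha>] a by (auto simp: balanced_def)
      then have "norm (est \<alpha> D h y - gradF y)
          \<le> (1 + \<kappa>) * Lf * (norm (?h - hs y) + norm (y - y)) + (C * p ^ D) * \<Omega>f"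
        unfolding F_grad_est_def gradF_def
        by (intro hypergradient_diff_le hs_in_H Rs_norm_le Rconv[OF h])
      also have "\<dots> \<le> (1 + \<kappa>) * Lf * (C * p ^ D) + (C * p ^ D) * \<Omega>f"
        using hconv[OF h, of y D] kappa_pos pos_f by (intro add_right_mono mult_left_mono) auto
      also have "\<dots> = ((1 + \<kappa>) * Lf * C + C * \<Omega>f) * p ^ D" by (simp add: algebra_simps)
      finally show ?thesis .
    qed
  qed
qed

text \<open>The initial inner iterate of each outer iteration enters only through its membership in the
  invariant region, so the warm start plays no role in the rate.\<close>

lemma average_gradient_bound:
  assumes \<alpha>: "small_step \<alpha>"
  obtains q where "0 < q" "q < 1"
    "\<And>y0 h0. h0 \<in> trunc_simplex_prod blk \<eta> \<Omega>g \<Longrightarrow>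
      \<exists>c1 c2. c1 \<ge> 0 \<and> c2 \<ge> 0 \<and>
        (\<forall>K D \<beta>. K \<ge> 1 \<and> 1 / (4 * L\<^sub>F) \<le> \<beta> \<and> \<beta> \<le> 1 / (2 * L\<^sub>F) \<longrightarrow>
          (1 / real K) * (\<Sum>k<K. (norm (F_grad blk UNIV fh fy g \<eta>
              (y_iter blk UNIV fh fy gh ghh ghy \<eta> (\<lambda>_. \<alpha>) (\<lambda>_. \<beta>) D h0 y0 k)))\<^sup>2)
            \<le> c1 / real K + c2 * q ^ D)"
proof -
  have a: "0 < \<alpha>" "\<alpha> * \<eta> \<le> 1" using \<alpha> by (auto simp: small_step_def)
  obtain C p where C: "0 \<le> C" and p: "0 < p" "p < 1"
    and err: "\<And>D h y. h \<in> balanced blk Q \<Longrightarrow> norm (est \<alpha> D h y - gradF y) \<le> C * p ^ D"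
    using gradient_estimate_error[OF \<alpha>] by metis
  obtain m where m: "\<And>y. m \<le> F y" using F_bdd unfolding bdd_below_def by auto
  have main: "(1 / real K) * (\<Sum>k<K. (norm (F_grad blk UNIV fh fy g \<eta>
          (y_iter blk UNIV fh fy gh ghh ghy \<eta> (\<lambda>_. \<alpha>) (\<lambda>_. \<beta>) D h0 y0 k)))\<^sup>2)
        \<le> 2 / \<beta> * (F y0 - m) / real K + C\<^sup>2 * p ^ D"
    if h0: "h0 \<in> trunc_simplex_prod blk \<eta> \<Omega>g" and K: "K \<ge> 1" and \<beta>: "0 < \<beta>" "\<beta> \<le> 1 / (2 * L\<^sub>F)"
    for y0 h0 K D \<beta>
  proof -
    define st where "st = alg_state blk UNIV fh fy gh ghh ghy \<eta> (\<lambda>_. \<alpha>) (\<lambda>_. \<beta>) D h0 y0"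
    define y where "y k = snd (st k)" for k
    have st_Suc: "st (Suc k) = (md_iter blk gh \<eta> \<alpha> (y k) (fst (st k)) D,
        y k - \<beta> *\<^sub>R est \<alpha> D (fst (st k)) (y k))" for k
      by (simp add: st_def y_def case_prod_beta closest_point_self)
    have bal: "fst (st k) \<in> balanced blk Q" for k
    proof (induction k)
      case 0
      show ?case using h0 trunc_subset_balanced by (auto simp: st_def)
    next
      case (Suc k)
      then show ?case unfolding st_Suc using a by (auto intro!: md_iter_balanced)
    qed
    have step: "(norm (gradF (y k)))\<^sup>2 \<le> 2 / \<beta> * (F (y k) - F (y (Suc k))) + C\<^sup>2 * p ^ D" for k
    proof -
      have "(norm (gradF (y k)))\<^sup>2 \<le> 2 / \<beta> * (F (y k) - F (y (Suc k)))
          + (norm (est \<alpha> D (fst (st k)) (y k) - gradF (y k)))\<^sup>2"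
        using inexact_gradient_step[OF \<beta>, of "y k" "est \<alpha> D (fst (st k)) (y k)"]
        by (simp add: y_def[of "Suc k"] st_Suc)
      also have "(norm (est \<alpha> D (fst (st k)) (y k) - gradF (y k)))\<^sup>2 \<le> (C * p ^ D)\<^sup>2"
        by (intro power_mono err bal) auto
      also have "\<dots> = C\<^sup>2 * (p ^ D * p ^ D)" by (simp add: power2_eq_square)
      also have "\<dots> \<le> C\<^sup>2 * (p ^ D * 1)"
        using p by (intro mult_left_mono power_le_one) auto
      finally show ?thesis by simp
    qed
    have "(\<Sum>k<K. (norm (gradF (y k)))\<^sup>2)
        \<le> (\<Sum>k<K. 2 / \<beta> * (F (y k) - F (y (Suc k))) + C\<^sup>2 * p ^ D)"
      by (rule sum_mono) (rule step)
    also have "\<dots> = 2 / \<beta> * (F (y 0) - F (y K)) + real K * (C\<^sup>2 * p ^ D)"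
      unfolding sum.distrib sum_distrib_left[symmetric]
        sum_lessThan_telescope'[of "\<lambda>k. F (y k)"] by simp
    also have "\<dots> \<le> 2 / \<beta> * (F y0 - m) + real K * (C\<^sup>2 * p ^ D)"
    proof -
      have "y 0 = y0" by (simp add: y_def st_def)
      then show ?thesis using m[of "y K"] \<beta> by (intro add_right_mono mult_left_mono) auto
    qed
    finally have "(1 / real K) * (\<Sum>k<K. (norm (gradF (y k)))\<^sup>2)
        \<le> (1 / real K) * (2 / \<beta> * (F y0 - m) + real K * (C\<^sup>2 * p ^ D))"
      by (intro mult_left_mono) auto
    also have "\<dots> = 2 / \<beta> * (F y0 - m) / real K + C\<^sup>2 * p ^ D"
      using K by (simp add: distrib_left)
    finally show ?thesis by (simp add: F_grad_eq y_iter_def y_def st_def)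
  qed
  show ?thesis
  proof (rule that[OF p])
    fix y0 h0 assume h0: "h0 \<in> trunc_simplex_prod blk \<eta> \<Omega>g"
    have "(1 / real K) * (\<Sum>k<K. (norm (F_grad blk UNIV fh fy g \<eta>
          (y_iter blk UNIV fh fy gh ghh ghy \<eta> (\<lambda>_. \<alpha>) (\<lambda>_. \<beta>) D h0 y0 k)))\<^sup>2)
        \<le> 8 * L\<^sub>F * (F y0 - m) / real K + C\<^sup>2 * p ^ D"
      if K: "K \<ge> 1" and \<beta>: "1 / (4 * L\<^sub>F) \<le> \<beta>" "\<beta> \<le> 1 / (2 * L\<^sub>F)" for K D \<beta>
    proof -
      have "0 < 1 / (4 * L\<^sub>F)" using L\<^sub>F_pos by simp
      then have "0 < \<beta>" using \<beta>(1) by linarith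
      have "2 \<le> 8 * L\<^sub>F * \<beta>" using \<beta>(1) L\<^sub>F_pos by (simp add: divide_le_eq mult_ac)
      then have "2 / \<beta> \<le> 8 * L\<^sub>F" using \<open>0 < \<beta>\<close> by (simp add: divide_le_eq)
      then have "2 / \<beta> * (F y0 - m) / real K \<le> 8 * L\<^sub>F * (F y0 - m) / real K"
        using m[of y0] by (intro divide_right_mono mult_right_mono) auto
      then show ?thesis using main[OF h0 K \<open>0 < \<beta>\<close> \<beta>(2), where ?y0.0 = y0 and D = D] by linarith
    qed
    moreover have "0 \<le> 8 * L\<^sub>F * (F y0 - m)" using m[of y0] L\<^sub>F_pos by simp
    ultimately show "\<exists>c1 c2. c1 \<ge> 0 \<and> c2 \<ge> 0 \<and>
        (\<forall>K D \<beta>. K \<ge> 1 \<and> 1 / (4 * L\<^sub>F) \<le> \<beta> \<and> \<beta> \<le> 1 / (2 * L\<^sub>F) \<longrightarrow>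
          (1 / real K) * (\<Sum>k<K. (norm (F_grad blk UNIV fh fy g \<eta>
              (y_iter blk UNIV fh fy gh ghh ghy \<eta> (\<lambda>_. \<alpha>) (\<lambda>_. \<beta>) D h0 y0 k)))\<^sup>2)
            \<le> c1 / real K + c2 * p ^ D)"
      by (intro exI[of _ "8 * L\<^sub>F * (F y0 - m)"] exI[of _ "C\<^sup>2"]) auto
  qed
qed

end

theorem theorem1:
  fixes blk :: "'n::finite \<Rightarrow> 'p::finite"
    and C :: "(real^'u) set"
    and H :: "(real^'n) set"
    and f g :: "real^'n \<Rightarrow> real^'u \<Rightarrow> real"
    and fh gh :: "real^'n \<Rightarrow> real^'u \<Rightarrow> real^'n"
    and fy :: "real^'n \<Rightarrow> real^'u \<Rightarrow> real^'u"
    and ghh :: "real^'n \<Rightarrow> real^'u \<Rightarrow> real^'n^'n"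
    and ghy :: "real^'n \<Rightarrow> real^'u \<Rightarrow> real^'u^'n"
    and \<eta> Lf \<Omega>f Lg \<Omega>g \<Lambda>g \<tau>h \<tau>y \<rho>h \<rho>y :: real
  assumes surj: "surj blk"
    and C: "C = UNIV"
    and H: "H = simplex_prod blk"
    and eta: "\<eta> > 0"
    and pos: "Lf > 0" "\<Omega>f > 0" "Lg > 0" "\<Omega>g > 0" "\<Lambda>g > 0"
             "\<tau>h > 0" "\<tau>y > 0" "\<rho>h > 0" "\<rho>y > 0"
    and f_deriv: "\<And>h y. h \<in> H \<Longrightarrow> y \<in> C \<Longrightarrow>
          ((\<lambda>(h, y). f h y) has_derivative (\<lambda>(v, w). fh h y \<bullet> v + fy h y \<bullet> w))
            (at (h, y) within H \<times> C)"
    and g_deriv: "\<And>h y. h \<in> H \<Longrightarrow> y \<in> C \<Longrightarrow>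
          ((\<lambda>h. g h y) has_derivative (\<lambda>v. gh h y \<bullet> v)) (at h within H)"
    and gh_deriv_h: "\<And>h y. h \<in> H \<Longrightarrow> y \<in> C \<Longrightarrow>
          ((\<lambda>h. gh h y) has_derivative (\<lambda>v. ghh h y *v v)) (at h within H)"
    and gh_deriv_y: "\<And>h y. h \<in> H \<Longrightarrow> y \<in> C \<Longrightarrow>
          ((\<lambda>y. gh h y) has_derivative (\<lambda>w. ghy h y *v w)) (at y within C)"
    and g_convex: "\<And>y. y \<in> C \<Longrightarrow> convex_on H (\<lambda>h. g h y)"
    and f_lipschitz: "Lf-lipschitz_on (H \<times> C) (\<lambda>(h, y). (fh h y, fy h y))"
    and f_bound: "\<And>h y. h \<in> H \<Longrightarrow> y \<in> C \<Longrightarrow> norm (fh h y, fy h y) \<le> \<Omega>f"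
    and gh_lipschitz: "\<And>y. y \<in> C \<Longrightarrow> Lg-lipschitz_on H (\<lambda>h. gh h y)"
    and gh_bound: "\<And>h y. h \<in> H \<Longrightarrow> y \<in> C \<Longrightarrow> norm (gh h y) \<le> \<Omega>g"
    and ghh_bound: "\<And>h y. h \<in> H \<Longrightarrow> y \<in> C \<Longrightarrow> spectral_norm (ghh h y) \<le> Lg"
    and ghy_bound: "\<And>h y. h \<in> H \<Longrightarrow> y \<in> C \<Longrightarrow> spectral_norm (ghy h y) \<le> \<Lambda>g"
    and ghy_lipschitz_h: "\<And>h h' y. h \<in> H \<Longrightarrow> h' \<in> H \<Longrightarrow> y \<in> C \<Longrightarrow>
          spectral_norm (ghy h y - ghy h' y) \<le> \<tau>h * norm (h - h')"
    and ghy_lipschitz_y: "\<And>h y y'. h \<in> H \<Longrightarrow> y \<in> C \<Longrightarrow> y' \<in> C \<Longrightarrow>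
          spectral_norm (ghy h y - ghy h y') \<le> \<tau>y * norm (y - y')"
    and ghh_lipschitz_h: "\<And>h h' y. h \<in> H \<Longrightarrow> h' \<in> H \<Longrightarrow> y \<in> C \<Longrightarrow>
          spectral_norm (ghh h y - ghh h' y) \<le> \<rho>h * norm (h - h')"
    and ghh_lipschitz_y: "\<And>h y y'. h \<in> H \<Longrightarrow> y \<in> C \<Longrightarrow> y' \<in> C \<Longrightarrow>
          spectral_norm (ghh h y - ghh h y') \<le> \<rho>y * norm (y - y')"
    and F_bdd: "bdd_below (F_obj blk f g \<eta> ` C)"
  shows "\<exists>\<alpha>max \<beta>min \<beta>max. \<alpha>max > 0 \<and> 0 < \<beta>min \<and> \<beta>min \<le> \<beta>max \<and>
    (\<forall>\<alpha>. 0 < \<alpha> \<and> \<alpha> \<le> \<alpha>max \<longrightarrow>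
      (\<exists>q D0. 0 < q \<and> q < 1 \<and>
        (\<forall>y0 \<in> C. \<forall>h0 \<in> trunc_simplex_prod blk \<eta> \<Omega>g.
          \<exists>c1 c2. c1 \<ge> 0 \<and> c2 \<ge> 0 \<and>
            (\<forall>K D \<beta>. K \<ge> 1 \<and> D \<ge> 1 \<and> D \<ge> D0 \<and> \<beta>min \<le> \<beta> \<and> \<beta> \<le> \<beta>max \<longrightarrow>
              (1 / real K) * (\<Sum>k<K. (norm (F_grad blk C fh fy g \<eta>
                  (y_iter blk C fh fy gh ghh ghy \<eta> (\<lambda>_. \<alpha>) (\<lambda>_. \<beta>) D h0 y0 k)))\<^sup>2)
                \<le> c1 / real K + c2 * q ^ D))))"
proof -
  interpret bilevel blk g gh ghh ghy \<eta> Lg \<Omega>g \<Lambda>g \<tau>h \<tau>y \<rho>h \<rho>y f fh fy Lf \<Omega>f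
    using assms unfolding C H by unfold_locales auto
  obtain \<alpha>max where \<alpha>max: "0 < \<alpha>max" "\<And>\<alpha>. 0 < \<alpha> \<Longrightarrow> \<alpha> \<le> \<alpha>max \<Longrightarrow> small_step \<alpha>"
    using small_step_exists by blast
  have \<beta>: "0 < 1 / (4 * L\<^sub>F)" "1 / (4 * L\<^sub>F) \<le> 1 / (2 * L\<^sub>F)"
    using L\<^sub>F_pos by (auto simp: field_simps)
  have "\<exists>q D0. 0 < q \<and> q < 1 \<and>
        (\<forall>y0 \<in> C. \<forall>h0 \<in> trunc_simplex_prod blk \<eta> \<Omega>g.
          \<exists>c1 c2. c1 \<ge> 0 \<and> c2 \<ge> 0 \<and>
            (\<forall>K D \<beta>. K \<ge> 1 \<and> D \<ge> 1 \<and> D \<ge> D0 \<and> 1 / (4 * L\<^sub>F) \<le> \<beta> \<and> \<beta> \<le> 1 / (2 * L\<^sub>F) \<longrightarrow>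
              (1 / real K) * (\<Sum>k<K. (norm (F_grad blk C fh fy g \<eta>
                  (y_iter blk C fh fy gh ghh ghy \<eta> (\<lambda>_. \<alpha>) (\<lambda>_. \<beta>) D h0 y0 k)))\<^sup>2)
                \<le> c1 / real K + c2 * q ^ D))" (is "?rate \<alpha>")
    if \<alpha>: "0 < \<alpha>" "\<alpha> \<le> \<alpha>max" for \<alpha>
  proof -
    obtain q where q: "0 < q" "q < 1"
      and bound: "\<And>y0 h0. h0 \<in> trunc_simplex_prod blk \<eta> \<Omega>g \<Longrightarrow>
      \<exists>c1 c2. c1 \<ge> 0 \<and> c2 \<ge> 0 \<and>
        (\<forall>K D \<beta>. K \<ge> 1 \<and> 1 / (4 * L\<^sub>F) \<le> \<beta> \<and> \<beta> \<le> 1 / (2 * L\<^sub>F) \<longrightarrow>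
          (1 / real K) * (\<Sum>k<K. (norm (F_grad blk UNIV fh fy g \<eta>
              (y_iter blk UNIV fh fy gh ghh ghy \<eta> (\<lambda>_. \<alpha>) (\<lambda>_. \<beta>) D h0 y0 k)))\<^sup>2)
            \<le> c1 / real K + c2 * q ^ D)"
      using average_gradient_bound[OF \<alpha>max(2)[OF \<alpha>]] by blast
    show ?thesis unfolding C
    proof (rule exI[of _ q], rule exI[of _ "0 :: nat"], intro conjI q ballI)
      fix y0 h0
      assume "h0 \<in> trunc_simplex_prod blk \<eta> \<Omega>g"
      from bound[OF this(1)] obtain c1 c2 where c: "c1 \<ge> 0" "c2 \<ge> 0"
        and le: "\<And>K D \<beta>. K \<ge> 1 \<Longrightarrow> 1 / (4 * L\<^sub>F) \<le> \<beta> \<Longrightarrow> \<beta> \<le> 1 / (2 * L\<^sub>F) \<Longrightarrow>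
            (1 / real K) * (\<Sum>k<K. (norm (F_grad blk UNIV fh fy g \<eta>
                (y_iter blk UNIV fh fy gh ghh ghy \<eta> (\<lambda>_. \<alpha>) (\<lambda>_. \<beta>) D h0 y0 k)))\<^sup>2)
              \<le> c1 / real K + c2 * q ^ D" by metis
      show "\<exists>c1 c2. c1 \<ge> 0 \<and> c2 \<ge> 0 \<and>
          (\<forall>K D \<beta>. K \<ge> 1 \<and> D \<ge> 1 \<and> D \<ge> 0 \<and> 1 / (4 * L\<^sub>F) \<le> \<beta> \<and> \<beta> \<le> 1 / (2 * L\<^sub>F) \<longrightarrow>
            (1 / real K) * (\<Sum>k<K. (norm (F_grad blk UNIV fh fy g \<eta>
                (y_iter blk UNIV fh fy gh ghh ghy \<eta> (\<lambda>_. \<alpha>) (\<lambda>_. \<beta>) D h0 y0 k)))\<^sup>2)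
              \<le> c1 / real K + c2 * q ^ D)"
        by (intro exI[of _ c1] exI[of _ c2] conjI c allI impI le) auto
    qed
  qed
  then have rate: "\<forall>\<alpha>. 0 < \<alpha> \<and> \<alpha> \<le> \<alpha>max \<longrightarrow> ?rate \<alpha>" by blast
  show ?thesis
    by (rule exI[of _ \<alpha>max], rule exI[of _ "1 / (4 * L\<^sub>F)"],
        rule exI[of _ "1 / (2 * L\<^sub>F)"]) (intro conjI \<alpha>max(1) \<beta> rate)
qed

end
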